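(* (i) For $\ell=1,\dots,k$, the process $(V_\ell(t),\,t\ge0)$ is self-similar with exponent $H=d(2k-\ell-1)/2$. (ii) For $\ell=1,\dots,k$ and every $T>0$, the process $(V_\ell(t),\,0\le t\le T)$ has a modification whose sample paths are Hölder continuous of any order in $[0,1/2)$.
   Context: Fix integers $d\ge1$, $k\ge2$, a real $\alpha>d$, and a connected graph $\Gamma$ with $k$ vertices. For a finite set $\mathcal{X}\subset\mathbb{R}^d$ and $t\ge0$, $G(\mathcal{X},t)$ is the undirected graph with vertex set $\mathcal{X}$ and an edge between distinct $x,y\in\mathcal{X}$ iff $\|x-y\|\le t$ (Euclidean norm); $\cong$ denotes graph isomorphism. For $x_1,\dots,x_k\in\mathbb{R}^d$, $h_t(x_1,\dots,x_k)=\mathbf{1}\{G(\{x_1,\dots,x_k\},t)\cong\Gamma\}$. For $\ell=1,\dots,k$ let $B_\ell=\dfrac{s_{d-1}}{\ell!\,((k-\ell)!)^2\,(\alpha(2k-\ell)-d)}$, where $s_{d-1}$ is the surface area of the unit sphere in $\mathbb{R}^d$. For $\ell=2,\dots,k$ let $\lambda_\ell$ be Lebesgue measure on $(\mathbb{R}^d)^{\ell-1}$ and $G_\ell$ a Gaussian $B_\ell\lambda_\ell$-noise (centered Gaussian random measure with $G_\ell(A)\sim\mathcal{N}(0,B_\ell\lambda_\ell(A))$ when $\lambda_\ell(A)<\infty$, independent on disjoint sets). $G_1$ is a centered Gaussian random variable with variance $B_1$. $G_1,\dots,G_k$ are independent. For $t\ge0$, $$V_\ell(t)=\int_{(\mathbb{R}^d)^{\ell-1}}\int_{(\mathbb{R}^d)^{k-\ell}}h_t(0,\mathbf{y},\mathbf{z})\,d\mathbf{z}\,G_\ell(d\mathbf{y})\quad(2\le\ell\le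 k-1),$$ $$V_k(t)=\int_{(\mathbb{R}^d)^{k-1}}h_t(0,\mathbf{y})\,G_k(d\mathbf{y}),\qquad V_1(t)=\Bigl(\int_{(\mathbb{R}^d)^{k-1}}h_t(0,\mathbf{z})\,d\mathbf{z}\Bigr)G_1.$$ A process $(X(t),\,t\ge0)$ is self-similar with exponent $H$ if $(X(ct_i),\,i=1,\dots,q)\stackrel{d}{=}(c^HX(t_i),\,i=1,\dots,q)$ for all $c>0$, $q\ge1$, $t_1,\dots,t_q\ge0$. *)

theory Defs
  imports "HOL-Probability.Probability" "Graph_Theory.Graph_Theory"
begin

section \<open>Geometric graphs\<close>

text \<open>
  Finite simple graphs are represented by the symmetric loop-free digraphs of Graph_Theory
  (locale \<^locale>\<open>pair_graph\<close>): every edge is present as two opposite arcs.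
\<close>

definition geometric_graph :: "'a::metric_space set \<Rightarrow> real \<Rightarrow> 'a pair_pre_digraph" where
  "geometric_graph X t =
    \<lparr> pverts = X, parcs = {(x, y). x \<in> X \<and> y \<in> X \<and> x \<noteq> y \<and> dist x y \<le> t} \<rparr>"

text \<open>
  A tuple \<open>(x\<^sub>1, \<dots>, x\<^sub>k)\<close> is a function on \<open>{1..k}\<close>. The vertex set is the \<^emph>\<open>set\<close> of its entries,
  so that coinciding entries give a graph with fewer than \<open>k\<close> vertices.
\<close>

definition subgraph_ind ::
    "'v pair_pre_digraph \<Rightarrow> nat \<Rightarrow> real \<Rightarrow> (nat \<Rightarrow> 'a::metric_space) \<Rightarrow> real" where
  "subgraph_ind \<Gamma> k t x =
    (if digraph_iso (with_proj (geometric_graph (x ` {1..k}) t)) (with_proj \<Gamma>) then 1 else 0)"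


section \<open>Gaussian noise and the Wiener integral\<close>

text \<open>The law \<open>N(0, v)\<close>; for \<open>v = 0\<close> it is the point mass at \<open>0\<close>.\<close>

definition centered_normal :: "real \<Rightarrow> real measure" where
  "centered_normal v =
    (if v = 0 then return borel 0 else density lborel (normal_density 0 (sqrt v)))"

text \<open>
  A centered Gaussian random measure with control measure \<open>\<mu>\<close>. It is indexed by the sets of finite
  \<open>\<mu>\<close>-measure; countable additivity holds almost surely, with an exceptional null set
  that may depend on the sequence of sets.
\<close>

definition gaussian_noise ::
    "'w measure \<Rightarrow> 'b measure \<Rightarrow> ('b set \<Rightarrow> 'w \<Rightarrow> real) \<Rightarrow> bool" where
  "gaussian_noise M \<mu> G \<longleftrightarrow>
    (\<forall>A\<in>fmeasurable \<mu>.
       G A \<in> borel_measurable M \<and> distr M borel (G A) = centered_normal (measure \<mu> A)) \<and>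
    (\<forall>(I::nat set) A. finite I \<longrightarrow> A ` I \<subseteq> fmeasurable \<mu> \<longrightarrow> disjoint_family_on A I \<longrightarrow>
       prob_space.indep_vars M (\<lambda>_. borel) (\<lambda>i. G (A i)) I) \<and>
    (\<forall>A::nat \<Rightarrow> 'b set. range A \<subseteq> fmeasurable \<mu> \<longrightarrow> disjoint_family A \<longrightarrow>
       (\<Union>i. A i) \<in> fmeasurable \<mu> \<longrightarrow>
       (AE \<omega> in M. (\<lambda>i. G (A i) \<omega>) sums G (\<Union>i. A i) \<omega>))"

text \<open>
  For a simple function with support of finite measure the integral is the finite sum
  \<open>\<Sum>\<^sub>c c \<cdot> G {f = c}\<close>; the integral of a general \<open>f \<in> L\<^sup>2(\<mu>)\<close> is the
  \<open>L\<^sup>2\<close>-limit of integrals of simple functions that converge to \<open>f\<close> in \<open>L\<^sup>2(\<mu>)\<close>. The term for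
  \<open>c = 0\<close>, where \<open>{f = 0}\<close> may have infinite measure, vanishes because of the factor \<open>c\<close>.
\<close>

definition simple_wiener_integral ::
    "'b measure \<Rightarrow> ('b set \<Rightarrow> 'w \<Rightarrow> real) \<Rightarrow> ('b \<Rightarrow> real) \<Rightarrow> 'w \<Rightarrow> real" where
  "simple_wiener_integral \<mu> G f \<omega> =
    (\<Sum>c\<in>f ` space \<mu>. c * G {x \<in> space \<mu>. f x = c} \<omega>)"

definition has_wiener_integral ::
    "'w measure \<Rightarrow> 'b measure \<Rightarrow> ('b set \<Rightarrow> 'w \<Rightarrow> real) \<Rightarrow> ('b \<Rightarrow> real) \<Rightarrow> ('w \<Rightarrow> real) \<Rightarrow> bool" where
  "has_wiener_integral M \<mu> G f Y \<longleftrightarrow>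
    f \<in> borel_measurable \<mu> \<and> Y \<in> borel_measurable M \<and>
    (\<exists>s::nat \<Rightarrow> 'b \<Rightarrow> real.
       (\<forall>n. Bochner_Integration.simple_bochner_integrable \<mu> (s n)) \<and>
       (\<lambda>n. \<integral>\<^sup>+ x. ennreal ((s n x - f x)\<^sup>2) \<partial>\<mu>) \<longlonglongrightarrow> 0 \<and>
       (\<lambda>n. \<integral>\<^sup>+ \<omega>. ennreal ((simple_wiener_integral \<mu> G (s n) \<omega> - Y \<omega>)\<^sup>2) \<partial>M) \<longlonglongrightarrow> 0)"

text \<open>The integral is only determined almost surely; an arbitrary version is selected.\<close>

definition wiener_integral ::
    "'w measure \<Rightarrow> 'b measure \<Rightarrow> ('b set \<Rightarrow> 'w \<Rightarrow> real) \<Rightarrow> ('b \<Rightarrow> real) \<Rightarrow> 'w \<Rightarrow> real" where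
  "wiener_integral M \<mu> G f = (SOME Y. has_wiener_integral M \<mu> G f Y)"


section \<open>The limiting processes\<close>

text \<open>
  Surface measure on the unit sphere in the form \<open>\<sigma>(A) = d \<cdot> \<lambda>{r x | 0 < r \<le> 1, x \<in> A}\<close>
  (polar coordinates).
\<close>

definition surface_measure :: "'a::euclidean_space set \<Rightarrow> real" where
  "surface_measure A =
    real DIM('a) * measure lborel {r *\<^sub>R x | r x. 0 < r \<and> r \<le> 1 \<and> x \<in> A}"

definition noise_const :: "'a::euclidean_space itself \<Rightarrow> real \<Rightarrow> nat \<Rightarrow> nat \<Rightarrow> real" where
  "noise_const _ \<alpha> k l =
    surface_measure (sphere (0::'a) 1) /
    (fact l * (fact (k - l))\<^sup>2 * (\<alpha> * (2 * real k - real l) - real DIM('a)))"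

text \<open>
  Lebesgue measure on \<open>(\<real>\<^sup>d)\<^sup>n\<close> is the product of \<open>n\<close> copies of \<^const>\<open>lborel\<close>. The copies are
  indexed by the positions which the variables take in \<open>h\<^sub>t(x\<^sub>1, \<dots>, x\<^sub>k)\<close>, where \<open>x\<^sub>1 = 0\<close>:
  \<open>y\<close> fills the positions \<open>{2..l}\<close> and \<open>z\<close> the positions \<open>{l+1..k}\<close>.
\<close>

abbreviation lebesgue_on_positions :: "nat set \<Rightarrow> (nat \<Rightarrow> 'a::euclidean_space) measure" where
  "lebesgue_on_positions I \<equiv> PiM I (\<lambda>_. lborel)"

definition noise_intensity :: "real \<Rightarrow> nat \<Rightarrow> nat \<Rightarrow> (nat \<Rightarrow> 'a::euclidean_space) measure" where
  "noise_intensity \<alpha> k l =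
    scale_measure (ennreal (noise_const TYPE('a) \<alpha> k l)) (lebesgue_on_positions {2..l})"

definition limit_process ::
    "'w measure \<Rightarrow> 'v pair_pre_digraph \<Rightarrow> nat \<Rightarrow> real \<Rightarrow> ('w \<Rightarrow> real) \<Rightarrow>
     (nat \<Rightarrow> (nat \<Rightarrow> 'a::euclidean_space) set \<Rightarrow> 'w \<Rightarrow> real) \<Rightarrow> nat \<Rightarrow> real \<Rightarrow> 'w \<Rightarrow> real" where
  "limit_process M \<Gamma> k \<alpha> G1 G l t =
    (if l = 1 then
       (\<lambda>\<omega>. (\<integral>z. subgraph_ind \<Gamma> k t (z(1 := 0 :: 'a)) \<partial>lebesgue_on_positions {2..k}) * G1 \<omega>)
     else if l = k then
       wiener_integral M (noise_intensity \<alpha> k k) (G k) (\<lambda>y. subgraph_ind \<Gamma> k t (y(1 := 0)))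
     else
       wiener_integral M (noise_intensity \<alpha> k l) (G l)
         (\<lambda>y. \<integral>z. subgraph_ind \<Gamma> k t ((merge {2..l} {Suc l..k} (y, z))(1 := 0))
                \<partial>lebesgue_on_positions {Suc l..k}))"

definition generated_events :: "'w measure \<Rightarrow> ('w \<Rightarrow> real) set \<Rightarrow> 'w set set" where
  "generated_events M \<X> =
    sigma_sets (space M) {X -` S \<inter> space M | X S. X \<in> \<X> \<and> S \<in> sets borel}"


section \<open>Self-similarity and modifications\<close>

definition self_similar :: "'w measure \<Rightarrow> (real \<Rightarrow> 'w \<Rightarrow> real) \<Rightarrow> real \<Rightarrow> bool" where
  "self_similar M X H \<longleftrightarrow>
    (\<forall>t\<ge>0. X t \<in> borel_measurable M) \<and>
    (\<forall>c>0. \<forall>q::nat. \<forall>t::nat \<Rightarrow> real. q \<ge> 1 \<longrightarrow> (\<forall>i\<in>{1..q}. t i \<ge> 0) \<longrightarrow>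
       distr M (PiM {1..q} (\<lambda>_. borel)) (\<lambda>\<omega>. \<lambda>i\<in>{1..q}. X (c * t i) \<omega>) =
       distr M (PiM {1..q} (\<lambda>_. borel)) (\<lambda>\<omega>. \<lambda>i\<in>{1..q}. c powr H * X (t i) \<omega>))"

definition modification_on ::
    "'w measure \<Rightarrow> real set \<Rightarrow> (real \<Rightarrow> 'w \<Rightarrow> real) \<Rightarrow> (real \<Rightarrow> 'w \<Rightarrow> real) \<Rightarrow> bool" where
  "modification_on M I X Y \<longleftrightarrow>
    (\<forall>t\<in>I. Y t \<in> borel_measurable M \<and> (AE \<omega> in M. Y t \<omega> = X t \<omega>))"

definition hoelder_on :: "real \<Rightarrow> real set \<Rightarrow> (real \<Rightarrow> real) \<Rightarrow> bool" where
  "hoelder_on \<gamma> I f \<longleftrightarrow> (\<exists>C. \<forall>s\<in>I. \<forall>t\<in>I. \<bar>f s - f t\<bar> \<le> C * \<bar>s - t\<bar> powr \<gamma>)"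

end

theory Submission
  imports Defs
begin

text \<open>
  Both parts rest on two properties of the kernel \<open>f\<^sub>t(y) = \<integral> h\<^sub>t(0, y, z) dz\<close> which
  \<open>V\<^sub>l(t)\<close> integrates against the noise (\<open>partial_kernel\<close>).

  Scaling: \<open>h\<^sub>c\<^sub>t(c x) = h\<^sub>t(x)\<close>, because the geometric graph depends only on the comparison of
  distances with \<open>t\<close>. Substituting \<open>c z\<close> for \<open>z\<close> gives \<open>f\<^sub>c\<^sub>t(y) = c powr (d (k - l)) f\<^sub>t(y / c)\<close>
  (\<open>partial_kernel_scale\<close>). Integrating the composition with \<open>y \<mapsto> y / c\<close> against the
  noise is, jointly in law, the same as multiplying the integrals by the square root of the Jacobian,
  \<open>c powr (d (l - 1) / 2)\<close> (\<open>joint_law_wiener_integral_pullback\<close>). To see this, note that for step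
  functions the integrals are linear combinations, with the same coefficients, of the noise of finitely
  many disjoint sets and of their preimages; both families are independent and centered normal,
  and the variances differ by the Jacobian. Limits in \<open>L\<^sup>2\<close> preserve equality of joint laws.
  Together this is self-similarity with exponent \<open>d (k - l) + d (l - 1) / 2\<close>.

  Increments: for \<open>s \<le> t \<le> T\<close> the indicators \<open>h\<^sub>s\<close> and \<open>h\<^sub>t\<close> differ only where some pairwise distance
  lies between \<open>s\<close> and \<open>t\<close>, and since the pattern is connected they vanish unless all points lie in
  a fixed ball. The volume of a shell is of the order \<open>t - s\<close>, hence so is the
  \<open>L\<^sup>1\<close>-norm of \<open>h\<^sub>t - h\<^sub>s\<close> (\<open>nn_integral_abs_diff_pinned_ind_le\<close>), and, as kernels are bounded,
  the square of the \<open>L\<^sup>2\<close>-norm of \<open>f\<^sub>t - f\<^sub>s\<close> (\<open>nn_integral_partial_kernel_diff_square_le\<close>). Wiener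
  integrals are Gaussian, so the moment of order \<open>2 m\<close> of \<open>V\<^sub>l(t) - V\<^sub>l(s)\<close> is at most a
  constant times \<open>(t - s)\<^sup>m\<close> for every \<open>m\<close> (\<open>wiener_integral_diff_moment\<close>). The
  Kolmogorov-Chentsov theorem (\<open>kolmogorov_chentsov\<close>) then gives a single modification that is Hoelder
  continuous of every order below \<open>1/2 - 1/(2 m)\<close> for all \<open>m\<close>, that is, of every order below 1/2.

  For \<open>l = 1\<close> the process is a deterministic function times \<open>G\<^sub>1\<close>: the scaling identity is
  self-similarity itself, and the estimate of the indicators shows that the paths are Lipschitz continuous.
\<close>

section \<open>Geometric graphs isomorphic to a fixed pattern\<close>

lemma pair_graph_arcD:
  assumes "pair_graph \<Gamma>" "(u, v) \<in> parcs \<Gamma>"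
  shows "u \<in> pverts \<Gamma>" "v \<in> pverts \<Gamma>" "u \<noteq> v"
proof -
  interpret pair_graph \<Gamma> by fact
  show "u \<in> pverts \<Gamma>" "v \<in> pverts \<Gamma>" "u \<noteq> v"
    using assms(2) in_arcsD1 in_arcsD2 no_loops' by blast+
qed

lemma pair_graph_finite_pverts: "pair_graph \<Gamma> \<Longrightarrow> finite (pverts \<Gamma>)"
proof -
  assume "pair_graph \<Gamma>"
  then interpret pair_graph \<Gamma> .
  show ?thesis by (rule pair_finite_verts)
qed

text \<open>
  Since the pattern has \<open>k\<close> vertices, an isomorphism forces the \<open>k\<close> entries to be distinct, and as
  there are no parallel arcs the arc map is determined by the vertex map. So an isomorphism is the same
  as a labelling of the positions. The right-hand side involves only finitely many labellings and
  comparisons of pairwise distances with \<open>t\<close>; scale invariance, measurability and the dependence on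
  \<open>t\<close> are read off from it.
\<close>
lemma subgraph_ind_eq_1_iff:
  fixes \<Gamma> :: "'v pair_pre_digraph" and x :: "nat \<Rightarrow> 'a::metric_space"
  assumes "pair_graph \<Gamma>" and card: "card (pverts \<Gamma>) = k"
  shows "subgraph_ind \<Gamma> k t x = 1 \<longleftrightarrow>
    (\<exists>\<phi>\<in>{1..k} \<rightarrow>\<^sub>E pverts \<Gamma>. bij_betw \<phi> {1..k} (pverts \<Gamma>) \<and> inj_on x {1..k} \<and>
      (\<forall>i\<in>{1..k}. \<forall>j\<in>{1..k}. i \<noteq> j \<longrightarrow> (dist (x i) (x j) \<le> t \<longleftrightarrow> (\<phi> i, \<phi> j) \<in> parcs \<Gamma>)))"
    (is "_ \<longleftrightarrow> ?R")
proof -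
  let ?H = "geometric_graph (x ` {1..k}) t"
  have wf: "wf_digraph (with_proj ?H)"
    by unfold_locales (auto simp: geometric_graph_def)
  have iff: "digraph_iso (with_proj ?H) (with_proj \<Gamma>) \<longleftrightarrow> ?R"
  proof
    assume "digraph_iso (with_proj ?H) (with_proj \<Gamma>)"
    then obtain f where f: "pre_digraph.digraph_isomorphism (with_proj ?H) f"
      and eq: "with_proj \<Gamma> = app_iso f (with_proj ?H)"
      by (auto simp: digraph_iso_def)
    define g where "g = iso_verts f"
    have injg: "inj_on g (x ` {1..k})"
      using f by (auto simp: pre_digraph.digraph_isomorphism_def g_def geometric_graph_def)
    have img: "pverts \<Gamma> = g ` x ` {1..k}"
      using arg_cong[OF eq, of verts] by (simp add: g_def geometric_graph_def)
    have tl: "iso_tail f = fst" "iso_head f = snd"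
      using arg_cong[OF eq, of tail] arg_cong[OF eq, of head] by (simp_all add: with_proj_def app_iso_def)
    have arcs: "iso_arcs f a = (g (fst a), g (snd a))" if "a \<in> parcs ?H" for a
      using f that by (auto simp: pre_digraph.digraph_isomorphism_def g_def tl prod_eq_iff)
    have parcs: "parcs \<Gamma> = (\<lambda>a. (g (fst a), g (snd a))) ` parcs ?H"
      using arg_cong[OF eq, of arcs] arcs by (auto simp: image_iff)
    have cx: "card (x ` {1..k}) = k"
      using card_image[OF injg] img card by simp
    then have injx: "inj_on x {1..k}"
      by (intro eq_card_imp_inj_on) auto
    define \<phi> where "\<phi> = (\<lambda>i\<in>{1..k}. g (x i))"
    have bij: "bij_betw \<phi> {1..k} (pverts \<Gamma>)"
      unfolding bij_betw_def
    proof
      show "inj_on \<phi> {1..k}"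
        using comp_inj_on[OF injx injg] unfolding \<phi>_def inj_on_restrict_eq comp_def .
      show "\<phi> ` {1..k} = pverts \<Gamma>" by (simp add: img \<phi>_def image_image)
    qed
    show ?R
    proof (rule bexI[of _ \<phi>], intro conjI ballI impI)
      show "bij_betw \<phi> {1..k} (pverts \<Gamma>)" "inj_on x {1..k}" by fact+
      show "\<phi> \<in> {1..k} \<rightarrow>\<^sub>E pverts \<Gamma>"
        using bij_betw_imp_surj_on[OF bij] unfolding PiE_iff by (auto simp: \<phi>_def)
      fix i j assume ij: "i \<in> {1..k}" "j \<in> {1..k}" "i \<noteq> j"
      then have "x i \<noteq> x j" using inj_onD[OF injx] by blast
      have "(g (x i), g (x j)) \<in> parcs \<Gamma> \<longleftrightarrow> (x i, x j) \<in> parcs ?H"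
      proof
        assume "(g (x i), g (x j)) \<in> parcs \<Gamma>"
        then obtain p q where pq: "(p, q) \<in> parcs ?H" "g (x i) = g p" "g (x j) = g q"
          unfolding parcs by auto
        then have "p \<in> x ` {1..k}" "q \<in> x ` {1..k}" by (simp_all add: geometric_graph_def)
        then have "x i = p" "x j = q"
          using inj_onD[OF injg pq(2)] inj_onD[OF injg pq(3)] ij by simp_all
        then show "(x i, x j) \<in> parcs ?H" using pq by simp
      next
        assume "(x i, x j) \<in> parcs ?H"
        then show "(g (x i), g (x j)) \<in> parcs \<Gamma>" unfolding parcs by (rule rev_image_eqI) simp
      qed
      then show "(dist (x i) (x j) \<le> t) = ((\<phi> i, \<phi> j) \<in> parcs \<Gamma>)"
        using ij \<open>x i \<noteq> x j\<close> by (simp add: \<phi>_def geometric_graph_def)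
    qed
  next
    assume ?R
    then obtain \<phi> where bij: "bij_betw \<phi> {1..k} (pverts \<Gamma>)" and injx: "inj_on x {1..k}"
      and edge: "\<And>i j. i \<in> {1..k} \<Longrightarrow> j \<in> {1..k} \<Longrightarrow> i \<noteq> j \<Longrightarrow>
         (dist (x i) (x j) \<le> t) = ((\<phi> i, \<phi> j) \<in> parcs \<Gamma>)" by blast
    define g where "g = (\<lambda>p. \<phi> (the_inv_into {1..k} x p))"
    have gx: "g (x i) = \<phi> i" if "i \<in> {1..k}" for i
      using that injx by (simp add: g_def the_inv_into_f_f)
    have injg: "inj_on g (x ` {1..k})"
    proof (rule inj_on_imageI)
      have "inj_on (g \<circ> x) {1..k} \<longleftrightarrow> inj_on \<phi> {1..k}"
        by (rule inj_on_cong) (simp add: gx)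
      then show "inj_on (g \<circ> x) {1..k}" using bij_betw_imp_inj_on[OF bij] by simp
    qed
    define f where "f = \<lparr>iso_verts = g, iso_arcs = (\<lambda>a. (g (fst a), g (snd a))),
      iso_head = snd, iso_tail = fst\<rparr>"
    have "pre_digraph.digraph_isomorphism (with_proj ?H) f"
      unfolding pre_digraph.digraph_isomorphism_def
    proof (intro conjI wf ballI)
      show "inj_on (iso_verts f) (verts (with_proj ?H))"
        using injg by (simp add: f_def geometric_graph_def)
      show "inj_on (iso_arcs f) (arcs (with_proj ?H))"
      proof (rule inj_onI)
        fix a b assume "a \<in> arcs (with_proj ?H)" "b \<in> arcs (with_proj ?H)"
          and e: "iso_arcs f a = iso_arcs f b"
        then have "fst a \<in> x ` {1..k}" "snd a \<in> x ` {1..k}" "fst b \<in> x ` {1..k}" "snd b \<in> x ` {1..k}"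
          by (auto simp: geometric_graph_def)
        then show "a = b" using e inj_onD[OF injg, of "fst a" "fst b"] inj_onD[OF injg, of "snd a" "snd b"]
          by (simp add: f_def prod_eq_iff)
      qed
    qed (simp_all add: f_def)
    moreover have "with_proj \<Gamma> = app_iso f (with_proj ?H)"
    proof (rule pre_digraph.equality)
      show "verts (with_proj \<Gamma>) = verts (app_iso f (with_proj ?H))"
        using bij_betw_imp_surj_on[OF bij] gx by (simp add: f_def geometric_graph_def image_image)
      have "parcs \<Gamma> = (\<lambda>a. (g (fst a), g (snd a))) ` parcs ?H"
      proof (rule equalityI)
        show "parcs \<Gamma> \<subseteq> (\<lambda>a. (g (fst a), g (snd a))) ` parcs ?H"
        proof (rule subrelI)
        fix u v assume uv: "(u, v) \<in> parcs \<Gamma>"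
        then have "u \<in> pverts \<Gamma>" "v \<in> pverts \<Gamma>" "u \<noteq> v"
          using pair_graph_arcD[OF assms(1)] by blast+
        then obtain i j where ij: "i \<in> {1..k}" "j \<in> {1..k}" "u = \<phi> i" "v = \<phi> j" "i \<noteq> j"
          using bij_betw_imp_surj_on[OF bij] by blast
        then have "x i \<noteq> x j" using inj_onD[OF injx] by blast
        then have "(x i, x j) \<in> parcs ?H"
          using edge[OF ij(1,2,5)] uv ij by (simp add: geometric_graph_def)
        then show "(u, v) \<in> (\<lambda>a. (g (fst a), g (snd a))) ` parcs ?H"
          by (rule rev_image_eqI) (simp only: ij(3,4) gx[OF ij(1)] gx[OF ij(2)] fst_conv snd_conv)
        qed
        show "(\<lambda>a. (g (fst a), g (snd a))) ` parcs ?H \<subseteq> parcs \<Gamma>"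
        proof (rule image_subsetI)
        fix a assume "a \<in> parcs ?H"
        then obtain i j where ij: "i \<in> {1..k}" "j \<in> {1..k}" "fst a = x i" "snd a = x j"
            "fst a \<noteq> snd a" "dist (fst a) (snd a) \<le> t"
          unfolding geometric_graph_def by auto
        then have "i \<noteq> j" by auto
        then show "(g (fst a), g (snd a)) \<in> parcs \<Gamma>"
          using edge[OF ij(1,2)] ij(6) unfolding ij(3,4) gx[OF ij(1)] gx[OF ij(2)] by simp
        qed
      qed
      then show "arcs (with_proj \<Gamma>) = arcs (app_iso f (with_proj ?H))"
        by (simp add: f_def)
    qed (simp_all add: f_def)
    ultimately show "digraph_iso (with_proj ?H) (with_proj \<Gamma>)"
      by (auto simp: digraph_iso_def)
  qed
  then show ?thesis by (simp add: subgraph_ind_def)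
qed

lemma subgraph_ind_cases: "subgraph_ind \<Gamma> k t x = 0 \<or> subgraph_ind \<Gamma> k t x = 1"
  by (simp add: subgraph_ind_def)

lemma subgraph_ind_nonneg: "0 \<le> subgraph_ind \<Gamma> k t x"
  by (simp add: subgraph_ind_def)

lemma subgraph_ind_scaleR:
  fixes x :: "nat \<Rightarrow> 'a::real_normed_vector"
  assumes "pair_graph \<Gamma>" "card (pverts \<Gamma>) = k" "c > 0"
  shows "subgraph_ind \<Gamma> k (c * t) (\<lambda>i. c *\<^sub>R x i) = subgraph_ind \<Gamma> k t x"
proof -
  have d: "dist (c *\<^sub>R a) (c *\<^sub>R b) \<le> c * t \<longleftrightarrow> dist a b \<le> t" for a b :: 'a
  proof -
    have "dist (c *\<^sub>R a) (c *\<^sub>R b) = c * dist a b"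
      using assms(3) by (simp add: dist_norm flip: scaleR_diff_right)
    then show ?thesis using assms(3) by simp
  qed
  have i: "inj_on (\<lambda>i. c *\<^sub>R x i) {1..k} \<longleftrightarrow> inj_on x {1..k}"
    using assms(3) by (simp add: inj_on_def)
  have "subgraph_ind \<Gamma> k (c * t) (\<lambda>i. c *\<^sub>R x i) = 1 \<longleftrightarrow> subgraph_ind \<Gamma> k t x = 1"
    unfolding subgraph_ind_eq_1_iff[OF assms(1,2)] d i ..
  then show ?thesis using subgraph_ind_cases by metis
qed

lemma subgraph_ind_cong:
  "(\<And>i. i \<in> {1..k} \<Longrightarrow> x i = y i) \<Longrightarrow> subgraph_ind \<Gamma> k t x = subgraph_ind \<Gamma> k t y"
  unfolding subgraph_ind_def by (metis image_cong)

lemma measurable_subgraph_ind [measurable (raw)]: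
  fixes x :: "'b \<Rightarrow> nat \<Rightarrow> 'a::euclidean_space"
  assumes \<Gamma>: "pair_graph \<Gamma>" "card (pverts \<Gamma>) = k"
    and x: "\<And>i. i \<in> {1..k} \<Longrightarrow> (\<lambda>w. x w i) \<in> borel_measurable N"
  shows "(\<lambda>w. subgraph_ind \<Gamma> k t (x w)) \<in> borel_measurable N"
proof -
  have [measurable]: "Measurable.pred N (\<lambda>w. x w i = x w j)" "Measurable.pred N (\<lambda>w. dist (x w i) (x w j) \<le> t)"
    if "i \<in> {1..k}" "j \<in> {1..k}" for i j
    using x[OF that(1)] x[OF that(2)] by measurable
  have fin: "finite ({1..k} \<rightarrow>\<^sub>E pverts \<Gamma>)" using pair_graph_finite_pverts[OF \<Gamma>(1)] by (intro finite_PiE) auto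
  have eq: "subgraph_ind \<Gamma> k t (x w) = (if subgraph_ind \<Gamma> k t (x w) = 1 then 1 else 0)" for w
    using subgraph_ind_cases[of \<Gamma> k t "x w"] by auto
  have "Measurable.pred N (\<lambda>w. subgraph_ind \<Gamma> k t (x w) = 1)"
    unfolding subgraph_ind_eq_1_iff[OF \<Gamma>] inj_on_def
    by (intro pred_intros_finite pred_intros_logic fin finite_atLeastAtMost)
       (auto intro!: pred_intros_logic)
  then show ?thesis by (subst eq) (intro measurable_If; simp)
qed

lemma dist_endpoints_vwalk:
  fixes y :: "'v \<Rightarrow> 'a::metric_space"
  assumes "vwalk p (with_proj \<Gamma>)" "\<And>u v. (u, v) \<in> parcs \<Gamma> \<Longrightarrow> dist (y u) (y v) \<le> t"
  shows "dist (y (hd p)) (y (last p)) \<le> real (length p - 1) * t"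
  using assms(1)
proof (induction p rule: vwalk_arcs.induct)
  case (3 u v p)
  then have w: "vwalk (v # p) (with_proj \<Gamma>)" and uv: "(u, v) \<in> parcs \<Gamma>"
    by (auto simp: vwalk_def arcs_ends_def arc_to_ends_def)
  have "dist (y u) (y (last (v # p))) \<le> dist (y u) (y v) + dist (y v) (y (last (v # p)))"
    by (rule dist_triangle)
  also have "\<dots> \<le> t + real (length (v # p) - 1) * t"
    using 3(1)[OF w] assms(2)[OF uv] by simp
  finally show ?case by (simp add: algebra_simps)
qed (auto simp: vwalk_def)

text \<open>
  A path in the pattern visits at most \<open>k\<close> vertices and each of its arcs has length at most \<open>t\<close>.
  Connectedness is used for this bound, which makes all integrals over the whole space finite.
\<close>
lemma dist_le_of_subgraph_ind:
  fixes x :: "nat \<Rightarrow> 'a::metric_space"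
  assumes \<Gamma>: "pair_graph \<Gamma>" "card (pverts \<Gamma>) = k"
    and conn: "Digraph_Component.connected (with_proj \<Gamma>)"
    and h: "subgraph_ind \<Gamma> k t x = 1" and i: "i \<in> {1..k}" and t: "t \<ge> 0"
  shows "dist (x 1) (x i) \<le> real k * t"
proof -
  obtain \<phi> where bij: "bij_betw \<phi> {1..k} (pverts \<Gamma>)"
    and edge: "\<And>i j. i \<in> {1..k} \<Longrightarrow> j \<in> {1..k} \<Longrightarrow> i \<noteq> j \<Longrightarrow>
         (dist (x i) (x j) \<le> t) = ((\<phi> i, \<phi> j) \<in> parcs \<Gamma>)"
    using h unfolding subgraph_ind_eq_1_iff[OF \<Gamma>] by blast
  have one: "1 \<in> {1..k}" using i by auto
  define y where "y v = x (the_inv_into {1..k} \<phi> v)" for v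
  have y: "y (\<phi> j) = x j" if "j \<in> {1..k}" for j
    using that bij by (simp add: y_def bij_betw_def the_inv_into_f_f)
  have arc: "dist (y u) (y v) \<le> t" if uv: "(u, v) \<in> parcs \<Gamma>" for u v
  proof -
    have "u \<in> pverts \<Gamma>" "v \<in> pverts \<Gamma>" "u \<noteq> v"
      using pair_graph_arcD[OF \<Gamma>(1) uv] by blast+
    moreover obtain i j where "i \<in> {1..k}" "j \<in> {1..k}" "u = \<phi> i" "v = \<phi> j"
      using bij_betw_imp_surj_on[OF bij] \<open>u \<in> _\<close> \<open>v \<in> _\<close> by blast
    ultimately show ?thesis using edge[of i j] uv y by force
  qed
  have vs: "\<phi> 1 \<in> pverts \<Gamma>" "\<phi> i \<in> pverts \<Gamma>" using bij one i by (auto simp: bij_betw_def)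
  have "\<phi> 1 \<rightarrow>\<^sup>*\<^bsub>with_proj \<Gamma>\<^esub> \<phi> i"
  proof -
    interpret pair_graph \<Gamma> by fact
    show ?thesis
      using symmetric_connected_imp_strongly_connected[OF sym_arcs conn] vs
      by (simp add: strongly_connected_def)
  qed
  then obtain p where p: "vpath p (with_proj \<Gamma>)" "hd p = \<phi> 1" "last p = \<phi> i"
  proof -
    interpret pair_graph \<Gamma> by fact
    assume *: "\<phi> 1 \<rightarrow>\<^sup>*\<^bsub>with_proj \<Gamma>\<^esub> \<phi> i"
      and "\<And>p. vpath p (with_proj \<Gamma>) \<Longrightarrow> hd p = \<phi> 1 \<Longrightarrow> last p = \<phi> i \<Longrightarrow> thesis"
    then show thesis using reachable_vpath_conv by blast
  qed
  then have "vwalk p (with_proj \<Gamma>)" "distinct p" "set p \<subseteq> pverts \<Gamma>"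
    by (auto simp: vpath_def vwalk_def)
  then have "length p \<le> k"
    using card_mono[OF pair_graph_finite_pverts[OF \<Gamma>(1)], of "set p"] \<Gamma>(2) by (simp add: distinct_card)
  have "dist (x 1) (x i) \<le> real (length p - 1) * t"
    using dist_endpoints_vwalk[where y = y, OF \<open>vwalk p _\<close> arc] p(2,3) y[OF one] y[OF i] by simp
  also have "\<dots> \<le> real k * t"
    using \<open>length p \<le> k\<close> t by (intro mult_right_mono) auto
  finally show ?thesis .
qed

text \<open>
  The indicator depends on \<open>t\<close> only through the comparisons of pairwise distances with \<open>t\<close>. Of the two
  positions of a pair at least one differs from 1; it is named \<open>j\<close>, so that \<open>x\<^sub>j\<close> is a variable of
  integration even after \<open>x\<^sub>1\<close> has been fixed at the origin.
\<close>
lemma subgraph_ind_neq_imp_crossing: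
  fixes x :: "nat \<Rightarrow> 'a::metric_space"
  assumes \<Gamma>: "pair_graph \<Gamma>" "card (pverts \<Gamma>) = k"
    and neq: "subgraph_ind \<Gamma> k s x \<noteq> subgraph_ind \<Gamma> k t x" and "s \<le> t"
  shows "\<exists>i\<in>{1..k}. \<exists>j\<in>{2..k}. i \<noteq> j \<and> s < dist (x i) (x j) \<and> dist (x i) (x j) \<le> t" (is ?thesis')
proof (rule ccontr)
  assume *: "\<not> ?thesis"
  have no: "\<not> (s < dist (x i) (x j) \<and> dist (x i) (x j) \<le> t)"
    if "i \<in> {1..k}" "j \<in> {2..k}" "i \<noteq> j" for i j
  proof
    assume "s < dist (x i) (x j) \<and> dist (x i) (x j) \<le> t"
    then have "?thesis'" using that by (intro bexI[of _ i] bexI[of _ j] conjI) simp_all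
    then show False using * by contradiction
  qed
  have "dist (x i) (x j) \<le> s \<longleftrightarrow> dist (x i) (x j) \<le> t"
    if ij: "i \<in> {1..k}" "j \<in> {1..k}" "i \<noteq> j" for i j
  proof (cases "j = 1")
    case True
    then have "i \<in> {2..k}" using ij by auto
    then show ?thesis using no[of j i] ij \<open>s \<le> t\<close> by (auto simp: dist_commute)
  next
    case False
    then have "j \<in> {2..k}" using ij by auto
    then show ?thesis using no[of i j] ij \<open>s \<le> t\<close> by auto
  qed
  then have "subgraph_ind \<Gamma> k s x = 1 \<longleftrightarrow> subgraph_ind \<Gamma> k t x = 1"
    unfolding subgraph_ind_eq_1_iff[OF \<Gamma>]
    by (intro bex_cong conj_cong ball_cong refl imp_cong) simp_all
  then show False using neq subgraph_ind_cases[of \<Gamma> k s x] subgraph_ind_cases[of \<Gamma> k t x] by auto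
qed

section \<open>Shells and dilations\<close>

lemma product_sigma_finite_lborel: "product_sigma_finite (\<lambda>_. lborel :: 'a::euclidean_space measure)"
  by (simp add: product_sigma_finite_def sigma_finite_lborel)

lemma nn_integral_PiM_cball:
  assumes "finite I" "R \<ge> 0"
  shows "(\<integral>\<^sup>+x. (\<Prod>i\<in>I. indicator (cball (0::'a::euclidean_space) R) (x i)) \<partial>PiM I (\<lambda>_. lborel)) =
    ennreal ((unit_ball_vol DIM('a) * R ^ DIM('a)) ^ card I)"
proof -
  interpret product_sigma_finite "\<lambda>_. lborel :: 'a measure"
    by (rule product_sigma_finite_lborel)
  show ?thesis
    using assms by (subst product_nn_integral_prod)
      (auto intro!: borel_measurable_indicator simp: emeasure_cball ennreal_power)
qed

lemma power_diff_le:
  fixes s t T :: real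
  assumes "0 \<le> s" "s \<le> t" "t \<le> T"
  shows "t ^ n - s ^ n \<le> real n * T ^ (n - 1) * (t - s)"
proof -
  have "t ^ n - s ^ n = (t - s) * (\<Sum>i<n. s ^ (n - Suc i) * t ^ i)"
    by (rule power_diff_sumr2)
  also have "\<dots> \<le> (t - s) * (\<Sum>i<n. T ^ (n - 1))"
  proof (intro mult_left_mono sum_mono)
    fix i assume "i \<in> {..<n}"
    then have *: "n - 1 = (n - Suc i) + i" by auto
    show "s ^ (n - Suc i) * t ^ i \<le> T ^ (n - 1)"
      unfolding * power_add using assms by (intro mult_mono power_mono) auto
  qed (use assms in auto)
  finally show ?thesis by (simp add: algebra_simps)
qed

text \<open>
  The volume of a shell is linear in its thickness. This is the origin of the order
  1/2: it makes the second moments of the increments of the processes of first order in \<open>t - s\<close>.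
\<close>
lemma emeasure_shell_le:
  fixes a :: "'a::euclidean_space"
  assumes "0 \<le> s" "s \<le> t" "t \<le> T"
  shows "emeasure lborel {y. s < dist a y \<and> dist a y \<le> t} \<le>
    ennreal (unit_ball_vol DIM('a) * (real DIM('a) * T ^ (DIM('a) - 1)) * (t - s))"
proof -
  have "{y. s < dist a y \<and> dist a y \<le> t} = cball a t - cball a s" by auto
  then have "emeasure lborel {y. s < dist a y \<and> dist a y \<le> t} =
      emeasure lborel (cball a t) - emeasure lborel (cball a s)"
    using assms by (simp add: emeasure_Diff emeasure_cball subset_cball)
  also have "\<dots> = ennreal (unit_ball_vol DIM('a) * (t ^ DIM('a) - s ^ DIM('a)))"
    using assms by (simp add: emeasure_cball ennreal_minus right_diff_distrib)
  also have "\<dots> \<le> ennreal (unit_ball_vol DIM('a) * (real DIM('a) * T ^ (DIM('a) - 1) * (t - s)))"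
    using power_diff_le[OF assms] by (intro ennreal_leI mult_left_mono) auto
  finally show ?thesis by (simp add: mult.assoc)
qed

lemma nn_integral_scale_distr:
  assumes "distr \<mu> \<mu> E = scale_measure r \<mu>" "E \<in> \<mu> \<rightarrow>\<^sub>M \<mu>" "f \<in> borel_measurable \<mu>"
  shows "(\<integral>\<^sup>+x. f (E x) \<partial>\<mu>) = r * (\<integral>\<^sup>+x. f x \<partial>\<mu>)"
proof -
  have "(\<integral>\<^sup>+x. f (E x) \<partial>\<mu>) = (\<integral>\<^sup>+x. f x \<partial>distr \<mu> \<mu> E)"
    by (rule nn_integral_distr[symmetric, OF assms(2)]) (use assms(3) in simp)
  also have "\<dots> = r * (\<integral>\<^sup>+x. f x \<partial>\<mu>)"
    unfolding assms(1) using assms(3) by (simp add: nn_integral_scale_measure)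
  finally show ?thesis .
qed

definition dilate :: "real \<Rightarrow> 'i set \<Rightarrow> ('i \<Rightarrow> 'a::real_vector) \<Rightarrow> 'i \<Rightarrow> 'a" where
  "dilate c I x = (\<lambda>i\<in>I. c *\<^sub>R x i)"

lemma measurable_dilate [measurable]:
  "dilate c I \<in> PiM I (\<lambda>_. lborel) \<rightarrow>\<^sub>M PiM I (\<lambda>_. lborel :: 'a::euclidean_space measure)"
  unfolding dilate_def by measurable

text \<open>
  It suffices to compare the two measures on boxes, where one uses in each of the \<open>card I\<close> factors that
  Lebesgue measure is homogeneous of degree \<open>d\<close>.
\<close>
lemma distr_PiM_dilate:
  fixes c :: real
  assumes "c > 0" and I: "finite I"
  shows "distr (PiM I (\<lambda>_. lborel :: 'a::euclidean_space measure)) (PiM I (\<lambda>_. lborel)) (dilate (1 / c) I) =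
    scale_measure (ennreal (c ^ (DIM('a) * card I))) (PiM I (\<lambda>_. lborel))" (is "distr ?P _ ?E = _")
proof -
  interpret product_sigma_finite "\<lambda>_. lborel :: 'a measure"
    by (rule product_sigma_finite_lborel)
  let ?k = "c ^ (DIM('a) * card I)"
  have k0: "?k > 0" using assms by simp
  have one: "emeasure lborel ((\<lambda>x. (1/c) *\<^sub>R x) -` A) = ennreal (c ^ DIM('a)) * emeasure lborel A"
    if [measurable]: "A \<in> sets borel" for A :: "'a set"
  proof -
    let ?B = "(\<lambda>x. (1/c) *\<^sub>R x) -` A"
    have [measurable]: "?B \<in> sets borel"
      using measurable_sets_borel[of "\<lambda>x. (1/c) *\<^sub>R x" borel A] by simp
    have "emeasure lborel ?B = emeasure (density (distr lborel borel (\<lambda>x. 0 + c *\<^sub>R x)) (\<lambda>_. \<bar>c\<bar>^DIM('a))) ?B"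
      using lborel_affine[of c "0::'a"] assms by simp
    also have "\<dots> = ennreal (c ^ DIM('a)) * emeasure lborel ((\<lambda>x. c *\<^sub>R x) -` ?B)"
      using assms by (simp add: emeasure_density nn_integral_cmult emeasure_distr)
    also have "(\<lambda>x. c *\<^sub>R x) -` ?B = A" using assms by auto
    finally show ?thesis .
  qed
  have "scale_measure (ennreal (1 / ?k)) (distr ?P ?P ?E) = ?P"
  proof (rule PiM_eqI[OF I])
    fix A :: "'b \<Rightarrow> 'a set" assume "\<And>i. i \<in> I \<Longrightarrow> A i \<in> sets lborel"
    then have A: "A i \<in> sets borel" if "i \<in> I" for i using that by simp
    have pre: "?E -` (Pi\<^sub>E I A) \<inter> space ?P = (\<Pi>\<^sub>E i\<in>I. (\<lambda>x. (1/c) *\<^sub>R x) -` A i)"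
      by (auto simp: dilate_def space_PiM PiE_iff)
    have B: "(\<lambda>x. (1/c) *\<^sub>R x) -` A i \<in> sets lborel" if "i \<in> I" for i
      using measurable_sets_borel[of "\<lambda>x. (1/c) *\<^sub>R x" borel "A i"] A[OF that] by simp
    have "emeasure (distr ?P ?P ?E) (Pi\<^sub>E I A) = (\<Prod>i\<in>I. ennreal (c ^ DIM('a)) * emeasure lborel (A i))"
      using A I by (subst emeasure_distr)
        (auto intro!: sets_PiM_I_finite simp: pre emeasure_PiM[OF I B] one intro: prod.cong)
    also have "\<dots> = ennreal ?k * (\<Prod>i\<in>I. emeasure lborel (A i))"
      using assms by (simp add: prod.distrib ennreal_power power_mult)
    finally show "emeasure (scale_measure (ennreal (1 / ?k)) (distr ?P ?P ?E)) (Pi\<^sub>E I A) =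
        (\<Prod>i\<in>I. emeasure lborel (A i))"
      using k0 assms by (simp add: mult.assoc[symmetric] ennreal_mult[symmetric])
  qed simp
  then have "scale_measure (ennreal ?k) ?P =
      scale_measure (ennreal ?k) (scale_measure (ennreal (1 / ?k)) (distr ?P ?P ?E))" by simp
  also have "\<dots> = distr ?P ?P ?E"
    using k0 assms by (simp add: ennreal_mult[symmetric])
  finally show ?thesis ..
qed

section \<open>Increments of the pattern indicator\<close>

locale connected_pattern =
  fixes \<Gamma> :: "'v pair_pre_digraph" and k :: nat
  assumes pair_graph: "pair_graph \<Gamma>"
    and conn: "Digraph_Component.connected (with_proj \<Gamma>)"
    and card_pverts: "card (pverts \<Gamma>) = k"
begin

text \<open>
  The indicator \<open>h\<^sub>t(0, x\<^sub>2, \<dots>, x\<^sub>k)\<close>.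
\<close>
abbreviation pinned_ind :: "real \<Rightarrow> (nat \<Rightarrow> 'a::euclidean_space) \<Rightarrow> real" where
  "pinned_ind t x \<equiv> subgraph_ind \<Gamma> k t (x(1 := 0))"

lemma measurable_pinned_ind [measurable]:
  "pinned_ind t \<in> borel_measurable (PiM {2..k} (\<lambda>_. lborel :: 'a::euclidean_space measure))"
proof (rule measurable_subgraph_ind[OF pair_graph card_pverts])
  fix i assume "i \<in> {1..k}"
  show "(\<lambda>w. (w(1 := 0)) i) \<in> borel_measurable (PiM {2..k} (\<lambda>_. lborel :: 'a measure))"
  proof (cases "i = 1")
    case False
    then have "i \<in> {2..k}" using \<open>i \<in> {1..k}\<close> by auto
    then have "(\<lambda>w. w i) \<in> PiM {2..k} (\<lambda>_. lborel :: 'a measure) \<rightarrow>\<^sub>M lborel" by measurable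
    then show ?thesis using False by simp
  qed simp
qed

lemma pinned_ind_nonneg: "0 \<le> pinned_ind t x"
  by (rule subgraph_ind_nonneg)

lemma pinned_ind_le_box:
  fixes x :: "nat \<Rightarrow> 'a::euclidean_space"
  assumes "0 \<le> t" "t \<le> T" "J \<subseteq> {2..k}"
  shows "pinned_ind t x \<le> (\<Prod>i\<in>J. indicator (cball 0 (real k * T)) (x i))"
proof (cases "pinned_ind t x = 1")
  case True
  have "x i \<in> cball 0 (real k * T)" if "i \<in> J" for i
  proof -
    have i: "i \<in> {1..k}" "i \<noteq> 1" using that assms by auto
    have "dist 0 (x i) \<le> real k * t"
      using dist_le_of_subgraph_ind[OF pair_graph card_pverts conn True i(1) assms(1)] i by simp
    also have "\<dots> \<le> real k * T" using assms by (intro mult_left_mono) auto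
    finally show ?thesis by simp
  qed
  then show ?thesis using True by (simp cong: prod.cong)
next
  case False
  then have "pinned_ind t x = 0" using subgraph_ind_cases by blast
  then show ?thesis by (simp add: prod_nonneg)
qed

text \<open>
  The volume of a ball that contains every point of a configuration with \<open>x\<^sub>1 = 0\<close> and \<open>h\<^sub>t = 1\<close>, for
  all \<open>t \<le> T\<close>.
\<close>
definition box_volume :: "'a::euclidean_space itself \<Rightarrow> real \<Rightarrow> real" where
  "box_volume _ T = unit_ball_vol DIM('a) * (real k * T) ^ DIM('a)"

lemma box_volume_nonneg: "0 \<le> T \<Longrightarrow> 0 \<le> box_volume TYPE('a::euclidean_space) T"
  by (simp add: box_volume_def)

text \<open>
  A union bound over the pairs whose distance may cross the interval. The factor for
  \<open>x\<^sub>j\<close> in the box is dropped, so that \<open>x\<^sub>j\<close> occurs in the shell condition only.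
\<close>
lemma abs_diff_pinned_ind_le:
  fixes x :: "nat \<Rightarrow> 'a::euclidean_space"
  assumes st: "0 \<le> s" "s \<le> t" "t \<le> T"
  shows "\<bar>pinned_ind t x - pinned_ind s x\<bar> \<le>
    (\<Sum>j\<in>{2..k}. \<Sum>i\<in>{1..k} - {j}.
      (\<Prod>m\<in>{2..k} - {j}. indicator (cball 0 (real k * T)) (x m)) *
      indicator {y. s < dist (if i = 1 then 0 else x i) y \<and> dist (if i = 1 then 0 else x i) y \<le> t} (x j))"
proof -
  define B where "B j = (\<Prod>m\<in>{2..k} - {j}. indicator (cball 0 (real k * T)) (x m) :: real)" for j
  define S where "S i j = (indicator {y. s < dist (if i = 1 then 0 else x i) y \<and>
    dist (if i = 1 then 0 else x i) y \<le> t} (x j) :: real)" for i j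
  have nonneg: "0 \<le> B j * S i j" for i j
    by (simp add: B_def S_def prod_nonneg)
  have "\<bar>pinned_ind t x - pinned_ind s x\<bar> \<le> (\<Sum>j\<in>{2..k}. \<Sum>i\<in>{1..k} - {j}. B j * S i j)"
  proof (cases "pinned_ind s x = pinned_ind t x")
    case True
    then show ?thesis using nonneg by (simp add: sum_nonneg)
  next
    case False
    obtain i j where ij: "i \<in> {1..k}" "j \<in> {2..k}" "i \<noteq> j"
      and d: "s < dist ((x(1:=0)) i) ((x(1:=0)) j)" "dist ((x(1:=0)) i) ((x(1:=0)) j) \<le> t"
      using subgraph_ind_neq_imp_crossing[OF pair_graph card_pverts False st(2)] by blast
    have "j \<noteq> 1" using ij by auto
    then have S: "S i j = 1" using d by (auto simp: S_def indicator_def split: if_splits)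
    have "\<bar>pinned_ind t x - pinned_ind s x\<bar> \<le> max (pinned_ind t x) (pinned_ind s x)"
      using pinned_ind_nonneg[of t x] pinned_ind_nonneg[of s x] by linarith
    also have "\<dots> \<le> B j"
      using pinned_ind_le_box[of t T "{2..k} - {j}" x] pinned_ind_le_box[of s T "{2..k} - {j}" x] st
      by (auto simp: B_def)
    also have "\<dots> = B j * S i j" unfolding S by simp
    also have "\<dots> \<le> (\<Sum>i\<in>{1..k} - {j}. B j * S i j)"
      using ij nonneg by (intro member_le_sum[where f = "\<lambda>i. B j * S i j"]) simp_all
    also have "\<dots> \<le> (\<Sum>j\<in>{2..k}. \<Sum>i\<in>{1..k} - {j}. B j * S i j)"
      using ij nonneg
      by (intro member_le_sum[of j _ "\<lambda>j. \<Sum>i\<in>{1..k} - {j}. B j * S i j"] sum_nonneg) simp_all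
    finally show ?thesis .
  qed
  then show ?thesis unfolding B_def S_def .
qed

text \<open>
  At most \<open>k\<^sup>2\<close> pairs, each contributing \<open>k - 2\<close> free balls and one shell.
\<close>
definition increment_const :: "'a::euclidean_space itself \<Rightarrow> real \<Rightarrow> real" where
  "increment_const _ T = real k * real k * (box_volume TYPE('a) T ^ (k - 2) *
     (unit_ball_vol DIM('a) * (real DIM('a) * T ^ (DIM('a) - 1))))"

lemma increment_const_nonneg: "0 \<le> T \<Longrightarrow> 0 \<le> increment_const TYPE('a::euclidean_space) T"
  by (simp add: increment_const_def box_volume_nonneg)

text \<open>
  For each pair \<open>x\<^sub>j\<close> is integrated first: with the other points fixed it ranges over a shell around
  \<open>x\<^sub>i\<close>, whose volume does not depend on the centre.
\<close>
lemma nn_integral_abs_diff_pinned_ind_le: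
  assumes st: "0 \<le> s" "s \<le> t" "t \<le> T"
  shows "(\<integral>\<^sup>+x. ennreal \<bar>pinned_ind t x - pinned_ind s x\<bar> \<partial>PiM {2..k} (\<lambda>_. lborel :: 'a::euclidean_space measure))
    \<le> ennreal (increment_const TYPE('a) T * (t - s))"
proof -
  interpret product_sigma_finite "\<lambda>_. lborel :: 'a measure"
    by (rule product_sigma_finite_lborel)
  let ?P = "PiM {2..k} (\<lambda>_. lborel :: 'a measure)"
  define a :: "nat \<Rightarrow> (nat \<Rightarrow> 'a) \<Rightarrow> 'a" where "a i x = (if i = 1 then 0 else x i)" for i x
  define B :: "nat \<Rightarrow> (nat \<Rightarrow> 'a) \<Rightarrow> ennreal"
    where "B j x = (\<Prod>m\<in>{2..k} - {j}. indicator (cball 0 (real k * T)) (x m))" for j x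
  define S :: "nat \<Rightarrow> nat \<Rightarrow> (nat \<Rightarrow> 'a) \<Rightarrow> ennreal"
    where "S i j x = indicator {y. s < dist (a i x) y \<and> dist (a i x) y \<le> t} (x j)" for i j x
  let ?shell = "unit_ball_vol DIM('a) * (real DIM('a) * T ^ (DIM('a) - 1))"
  have comp: "(\<lambda>x. x i) \<in> borel_measurable (PiM I (\<lambda>_. lborel :: 'a measure))" if "i \<in> I" for i I
    using measurable_component_singleton[OF that, of "\<lambda>_. lborel :: 'a measure"] by simp
  have a_meas: "a i \<in> borel_measurable (PiM I (\<lambda>_. lborel :: 'a measure))" if "i = 1 \<or> i \<in> I" for i I
    using that comp[of i I] by (cases "i = 1") (simp_all add: a_def[abs_def])
  have B_meas: "B j \<in> borel_measurable (PiM I (\<lambda>_. lborel :: 'a measure))" if "{2..k} - {j} \<subseteq> I" for I j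
    unfolding B_def
  proof (rule borel_measurable_prod_ennreal)
    fix m assume "m \<in> {2..k} - {j}"
    then have "(\<lambda>x. x m) \<in> borel_measurable (PiM I (\<lambda>_. lborel :: 'a measure))"
      using that by (intro comp) auto
    from measurable_compose[OF this, of "indicator (cball 0 (real k * T))" borel]
    show "(\<lambda>x. indicator (cball 0 (real k * T)) (x m) :: ennreal) \<in> borel_measurable (PiM I (\<lambda>_. lborel :: 'a measure))"
      by (simp add: borel_measurable_indicator)
  qed
  have S_meas: "S i j \<in> borel_measurable ?P" if "i \<in> {1..k}" "j \<in> {2..k}" for i j
  proof -
    have i: "i = 1 \<or> i \<in> {2..k}" using that by auto
    note [measurable] = a_meas[OF i] comp[OF that(2)]
    have "S i j = (\<lambda>x. if s < dist (a i x) (x j) \<and> dist (a i x) (x j) \<le> t then 1 else 0)"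
      by (auto simp: S_def indicator_def fun_eq_iff)
    moreover have "(\<lambda>x. if s < dist (a i x) (x j) \<and> dist (a i x) (x j) \<le> t then 1 else 0 :: ennreal) \<in> borel_measurable ?P"
      by measurable
    ultimately show ?thesis by (simp only:)
  qed
  have pair: "(\<integral>\<^sup>+x. B j x * S i j x \<partial>?P) \<le> ennreal (box_volume TYPE('a) T ^ (k - 2) * ?shell * (t - s))"
    if j: "j \<in> {2..k}" and i: "i \<in> {1..k} - {j}" for i j
  proof -
    let ?I = "{2..k} - {j}"
    have ins: "insert j ?I = {2..k}" using j by auto
    have [measurable]: "B j \<in> borel_measurable ?P" "S i j \<in> borel_measurable ?P"
      using i j by (auto intro!: B_meas S_meas)
    have "(\<integral>\<^sup>+x. B j x * S i j x \<partial>?P) =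
        (\<integral>\<^sup>+x. (\<integral>\<^sup>+y. B j (x(j := y)) * S i j (x(j := y)) \<partial>lborel) \<partial>PiM ?I (\<lambda>_. lborel))"
    proof -
      have "(\<lambda>x. B j x * S i j x) \<in> borel_measurable (PiM (insert j ?I) (\<lambda>_. lborel :: 'a measure))"
        unfolding ins by measurable
      moreover have "finite ?I" "j \<notin> ?I" by auto
      ultimately show ?thesis
        using product_nn_integral_insert[of ?I j "\<lambda>x. B j x * S i j x"] unfolding ins by blast
    qed
    also have "\<dots> \<le> (\<integral>\<^sup>+x. ennreal (?shell * (t - s)) * B j x \<partial>PiM ?I (\<lambda>_. lborel))"
    proof (rule nn_integral_mono)
      fix x :: "nat \<Rightarrow> 'a"
      have Bj: "B j (x(j := y)) = B j x" for y
        unfolding B_def by (intro prod.cong) auto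
      have aj: "a i (x(j := y)) = a i x" for y using i by (auto simp: a_def)
      have "(\<integral>\<^sup>+y. B j (x(j := y)) * S i j (x(j := y)) \<partial>lborel) =
          (\<integral>\<^sup>+y. B j x * indicator {y. s < dist (a i x) y \<and> dist (a i x) y \<le> t} y \<partial>lborel)"
        unfolding Bj by (simp add: S_def aj)
      also have "\<dots> = B j x * emeasure lborel {y. s < dist (a i x) y \<and> dist (a i x) y \<le> t}"
        by (simp add: nn_integral_cmult)
      also have "\<dots> \<le> B j x * ennreal (?shell * (t - s))"
        by (intro mult_left_mono emeasure_shell_le st) auto
      finally show "(\<integral>\<^sup>+y. B j (x(j := y)) * S i j (x(j := y)) \<partial>lborel) \<le> ennreal (?shell * (t - s)) * B j x"
        by (simp add: mult.commute)
    qed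
    also have "\<dots> = ennreal (?shell * (t - s)) * (\<integral>\<^sup>+x. B j x \<partial>PiM ?I (\<lambda>_. lborel))"
      by (intro nn_integral_cmult B_meas) auto
    also have "(\<integral>\<^sup>+x. B j x \<partial>PiM ?I (\<lambda>_. lborel)) = ennreal (box_volume TYPE('a) T ^ (k - 2))"
      unfolding B_def using j st by (subst nn_integral_PiM_cball) (auto simp: box_volume_def numeral_2_eq_2)
    finally show ?thesis
      using st by (simp add: ennreal_mult[symmetric] box_volume_nonneg mult_ac)
  qed
  define Br :: "nat \<Rightarrow> (nat \<Rightarrow> 'a) \<Rightarrow> real"
    where "Br j x = (\<Prod>m\<in>{2..k} - {j}. indicator (cball 0 (real k * T)) (x m))" for j x
  define Sr :: "nat \<Rightarrow> nat \<Rightarrow> (nat \<Rightarrow> 'a) \<Rightarrow> real"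
    where "Sr i j x = indicator {y. s < dist (a i x) y \<and> dist (a i x) y \<le> t} (x j)" for i j x
  have nonneg: "0 \<le> Br j x" "0 \<le> Sr i j x" for i j x
    by (simp_all add: Br_def Sr_def prod_nonneg)
  have BS: "ennreal (Br j x) * ennreal (Sr i j x) = B j x * S i j x" for i j x
  proof -
    have "ennreal (Br j x) = B j x"
      unfolding Br_def B_def by (subst prod_ennreal[symmetric]) (auto simp: ennreal_indicator)
    then show ?thesis by (simp add: S_def Sr_def ennreal_indicator)
  qed
  have "(\<integral>\<^sup>+x. ennreal \<bar>pinned_ind t x - pinned_ind s x\<bar> \<partial>?P) \<le>
      (\<integral>\<^sup>+x. (\<Sum>j\<in>{2..k}. \<Sum>i\<in>{1..k} - {j}. B j x * S i j x) \<partial>?P)"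
  proof (rule nn_integral_mono)
    fix x :: "nat \<Rightarrow> 'a"
    have "ennreal \<bar>pinned_ind t x - pinned_ind s x\<bar> \<le>
        ennreal (\<Sum>j\<in>{2..k}. \<Sum>i\<in>{1..k} - {j}. Br j x * Sr i j x)"
      unfolding Br_def Sr_def a_def by (intro ennreal_leI abs_diff_pinned_ind_le st)
    also have "\<dots> = (\<Sum>j\<in>{2..k}. \<Sum>i\<in>{1..k} - {j}. B j x * S i j x)"
      by (simp only: sum_ennreal[symmetric] sum_nonneg mult_nonneg_nonneg nonneg ennreal_mult BS)
    finally show "ennreal \<bar>pinned_ind t x - pinned_ind s x\<bar> \<le> (\<Sum>j\<in>{2..k}. \<Sum>i\<in>{1..k} - {j}. B j x * S i j x)" .
  qed
  also have "\<dots> = (\<Sum>j\<in>{2..k}. \<Sum>i\<in>{1..k} - {j}. (\<integral>\<^sup>+x. B j x * S i j x \<partial>?P))"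
  proof -
    have *: "(\<lambda>x. B j x * S i j x) \<in> borel_measurable ?P" if "j \<in> {2..k}" "i \<in> {1..k} - {j}" for i j
      using that by (intro borel_measurable_times_ennreal B_meas S_meas) auto
    have "(\<integral>\<^sup>+x. (\<Sum>j\<in>{2..k}. \<Sum>i\<in>{1..k} - {j}. B j x * S i j x) \<partial>?P) =
        (\<Sum>j\<in>{2..k}. (\<integral>\<^sup>+x. (\<Sum>i\<in>{1..k} - {j}. B j x * S i j x) \<partial>?P))"
      by (intro nn_integral_sum borel_measurable_sum *)
    also have "\<dots> = (\<Sum>j\<in>{2..k}. \<Sum>i\<in>{1..k} - {j}. (\<integral>\<^sup>+x. B j x * S i j x \<partial>?P))"
      by (intro sum.cong nn_integral_sum refl *)
    finally show ?thesis .
  qed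
  also have "\<dots> \<le> (\<Sum>j\<in>{2..k}. \<Sum>i\<in>{1..k} - {j}. ennreal (box_volume TYPE('a) T ^ (k - 2) * ?shell * (t - s)))"
    by (rule sum_mono, rule sum_mono, rule pair)
  also have "\<dots> = of_nat (k - 1) * (of_nat (k - 1) * ennreal (box_volume TYPE('a) T ^ (k - 2) * ?shell * (t - s)))"
  proof -
    have "(\<Sum>i\<in>{1..k} - {j}. X) = of_nat (k - 1) * X" if "j \<in> {2..k}" for j and X :: ennreal
      using that by simp
    then show ?thesis by simp
  qed
  also have "\<dots> \<le> of_nat k * (of_nat k * ennreal (box_volume TYPE('a) T ^ (k - 2) * ?shell * (t - s)))"
    by (intro mult_mono of_nat_mono) auto
  finally have le: "(\<integral>\<^sup>+x. ennreal \<bar>pinned_ind t x - pinned_ind s x\<bar> \<partial>?P) \<le>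
      of_nat k * (of_nat k * ennreal (box_volume TYPE('a) T ^ (k - 2) * ?shell * (t - s)))" .
  have "of_nat k * (of_nat k * ennreal X) = ennreal (real k * real k * X)" if "0 \<le> X" for X
    using that by (simp add: ennreal_of_nat_eq_real_of_nat ennreal_mult mult.assoc)
  moreover have "0 \<le> box_volume TYPE('a) T ^ (k - 2) * ?shell * (t - s)"
    using st by (simp add: box_volume_nonneg)
  ultimately show ?thesis
    using le unfolding increment_const_def by (simp only: mult.assoc)
qed

end

section \<open>Partially integrated indicators\<close>

text \<open>
  The squared \<open>L\<^sup>2\<close>-distance.
\<close>
abbreviation sqdist :: "'b measure \<Rightarrow> ('b \<Rightarrow> real) \<Rightarrow> ('b \<Rightarrow> real) \<Rightarrow> ennreal" where
  "sqdist N f g \<equiv> (\<integral>\<^sup>+x. ennreal ((f x - g x)\<^sup>2) \<partial>N)"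

context connected_pattern
begin

text \<open>
  The integrand of \<open>V\<^sub>l(t)\<close> as a function of the variables of the noise. For \<open>l = k\<close> the inner integral
  is over a one-point space, and for \<open>l = 1\<close> the function lives on a one-point space, so that all
  cases are treated together.
\<close>
definition partial_kernel :: "nat \<Rightarrow> real \<Rightarrow> (nat \<Rightarrow> 'a::euclidean_space) \<Rightarrow> real" where
  "partial_kernel l t y =
    (\<integral>z. pinned_ind t (merge {2..l} {Suc l..k} (y, z)) \<partial>lebesgue_on_positions {Suc l..k})"

lemma measurable_pinned_ind_merge:
  assumes "l \<in> {1..k}"
  shows "(\<lambda>w. pinned_ind t (merge {2..l} {Suc l..k} w)) \<in> borel_measurable
    (lebesgue_on_positions {2..l} \<Otimes>\<^sub>M (lebesgue_on_positions {Suc l..k} :: (nat \<Rightarrow> 'a::euclidean_space) measure))"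
proof -
  have "{2..l} \<union> {Suc l..k} = {2..k}" using assms by auto
  then show ?thesis
    using measurable_compose[OF measurable_merge, of "pinned_ind t" "{2..l}" "{Suc l..k}" "\<lambda>_. lborel :: 'a measure" borel]
      measurable_pinned_ind[of t] by simp
qed

lemma measurable_pinned_ind_merge2:
  assumes "l \<in> {1..k}" "y \<in> space (lebesgue_on_positions {2..l} :: (nat \<Rightarrow> 'a::euclidean_space) measure)"
  shows "(\<lambda>z. pinned_ind t (merge {2..l} {Suc l..k} (y, z))) \<in> borel_measurable
    (lebesgue_on_positions {Suc l..k} :: (nat \<Rightarrow> 'a) measure)"
  using measurable_Pair2[OF measurable_pinned_ind_merge[OF assms(1)] assms(2)] .

lemma sigma_finite_lebesgue_on_positions:
  "finite I \<Longrightarrow> sigma_finite_measure (lebesgue_on_positions I :: (nat \<Rightarrow> 'a::euclidean_space) measure)"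
  using product_sigma_finite.sigma_finite[OF product_sigma_finite_lborel] by blast

lemma measurable_partial_kernel:
  assumes "l \<in> {1..k}"
  shows "partial_kernel l t \<in> borel_measurable (lebesgue_on_positions {2..l} :: (nat \<Rightarrow> 'a::euclidean_space) measure)"
proof -
  interpret sigma_finite_measure "lebesgue_on_positions {Suc l..k} :: (nat \<Rightarrow> 'a) measure"
    by (rule sigma_finite_lebesgue_on_positions) simp
  show ?thesis
    unfolding partial_kernel_def
    using measurable_pinned_ind_merge[OF assms, of t]
    by (intro borel_measurable_lebesgue_integral) (simp add: case_prod_beta')
qed

lemma nn_integral_pinned_ind_merge_le:
  assumes "l \<in> {1..k}" "0 \<le> t" "t \<le> T"
  shows "(\<integral>\<^sup>+z. ennreal (pinned_ind t (merge {2..l} {Suc l..k} (y, z)))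
      \<partial>(lebesgue_on_positions {Suc l..k} :: (nat \<Rightarrow> 'a::euclidean_space) measure))
    \<le> ennreal (box_volume TYPE('a) T ^ (k - l))"
proof -
  let ?J = "{Suc l..k}" and ?Q = "lebesgue_on_positions {Suc l..k} :: (nat \<Rightarrow> 'a) measure"
  have J: "?J \<subseteq> {2..k}" using assms by auto
  have "(\<integral>\<^sup>+z. ennreal (pinned_ind t (merge {2..l} ?J (y, z))) \<partial>?Q)
      \<le> (\<integral>\<^sup>+z. (\<Prod>i\<in>?J. indicator (cball 0 (real k * T)) (z i)) \<partial>?Q)"
  proof (rule nn_integral_mono)
    fix z :: "nat \<Rightarrow> 'a"
    have "pinned_ind t (merge {2..l} ?J (y, z)) \<le>
        (\<Prod>i\<in>?J. indicator (cball 0 (real k * T)) ((merge {2..l} ?J (y, z)) i))"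
      by (rule pinned_ind_le_box[OF assms(2,3) J])
    also have "\<dots> = (\<Prod>i\<in>?J. indicator (cball 0 (real k * T)) (z i))"
      by (intro prod.cong) (auto simp: merge_def)
    finally have "ennreal (pinned_ind t (merge {2..l} ?J (y, z))) \<le>
        ennreal (\<Prod>i\<in>?J. indicator (cball 0 (real k * T)) (z i))"
      by (rule ennreal_leI)
    also have "\<dots> = (\<Prod>i\<in>?J. indicator (cball 0 (real k * T)) (z i))"
      by (subst prod_ennreal[symmetric]) (simp_all add: ennreal_indicator)
    finally show "ennreal (pinned_ind t (merge {2..l} ?J (y, z))) \<le> \<dots>" .
  qed
  also have "\<dots> = ennreal (box_volume TYPE('a) T ^ (k - l))"
    using assms by (subst nn_integral_PiM_cball) (simp_all add: box_volume_def)
  finally show ?thesis .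
qed

lemma partial_kernel_eq_nn_integral:
  assumes "l \<in> {1..k}" "y \<in> space (lebesgue_on_positions {2..l} :: (nat \<Rightarrow> 'a::euclidean_space) measure)"
  shows "partial_kernel l t y = enn2real (\<integral>\<^sup>+z. ennreal (pinned_ind t (merge {2..l} {Suc l..k} (y, z)))
      \<partial>lebesgue_on_positions {Suc l..k})"
  unfolding partial_kernel_def
  using measurable_pinned_ind_merge2[OF assms, of t]
  by (intro integral_eq_nn_integral) (simp_all add: subgraph_ind_nonneg)

lemma integrable_pinned_ind_merge:
  assumes "l \<in> {1..k}" "y \<in> space (lebesgue_on_positions {2..l} :: (nat \<Rightarrow> 'a::euclidean_space) measure)" "0 \<le> t"
  shows "integrable (lebesgue_on_positions {Suc l..k}) (\<lambda>z. pinned_ind t (merge {2..l} {Suc l..k} (y, z)))"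
proof (rule integrableI_nonneg)
  show "(\<lambda>z. pinned_ind t (merge {2..l} {Suc l..k} (y, z))) \<in> borel_measurable (lebesgue_on_positions {Suc l..k})"
    by (rule measurable_pinned_ind_merge2[OF assms(1,2)])
  show "(\<integral>\<^sup>+z. ennreal (pinned_ind t (merge {2..l} {Suc l..k} (y, z))) \<partial>lebesgue_on_positions {Suc l..k}) < \<infinity>"
    using le_less_trans[OF nn_integral_pinned_ind_merge_le[OF assms(1) assms(3) order_refl, of y] ennreal_less_top]
    by simp
qed (simp add: subgraph_ind_nonneg)

lemma partial_kernel_bounds:
  assumes "l \<in> {1..k}" "y \<in> space (lebesgue_on_positions {2..l} :: (nat \<Rightarrow> 'a::euclidean_space) measure)"
    "0 \<le> t" "t \<le> T"
  shows "0 \<le> partial_kernel l t y" "partial_kernel l t y \<le> box_volume TYPE('a) T ^ (k - l)"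
proof -
  show "0 \<le> partial_kernel l t y" by (simp add: partial_kernel_eq_nn_integral[OF assms(1,2)])
  show "partial_kernel l t y \<le> box_volume TYPE('a) T ^ (k - l)"
    unfolding partial_kernel_eq_nn_integral[OF assms(1,2)]
    using enn2real_mono[OF nn_integral_pinned_ind_merge_le[OF assms(1,3,4), of y]] assms
    by (simp add: box_volume_nonneg)
qed

lemma nn_integral_partial_kernel_diff_le:
  assumes l: "l \<in> {1..k}" and st: "0 \<le> s" "s \<le> t" "t \<le> T"
  shows "(\<integral>\<^sup>+y. ennreal \<bar>partial_kernel l t y - partial_kernel l s y\<bar>
      \<partial>(lebesgue_on_positions {2..l} :: (nat \<Rightarrow> 'a::euclidean_space) measure))
    \<le> ennreal (increment_const TYPE('a) T * (t - s))"
proof -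
  interpret product_sigma_finite "\<lambda>_. lborel :: 'a measure"
    by (rule product_sigma_finite_lborel)
  let ?I = "{2..l}" and ?J = "{Suc l..k}"
  let ?P = "lebesgue_on_positions {2..l} :: (nat \<Rightarrow> 'a) measure"
    and ?Q = "lebesgue_on_positions {Suc l..k} :: (nat \<Rightarrow> 'a) measure"
  let ?h = "\<lambda>t y z. pinned_ind t (merge ?I ?J (y, z))"
  have IJ: "?I \<union> ?J = {2..k}" "?I \<inter> ?J = {}" using l by auto
  have "(\<integral>\<^sup>+y. ennreal \<bar>partial_kernel l t y - partial_kernel l s y\<bar> \<partial>?P)
     \<le> (\<integral>\<^sup>+y. (\<integral>\<^sup>+z. ennreal \<bar>?h t y z - ?h s y z\<bar> \<partial>?Q) \<partial>?P)"
  proof (rule nn_integral_mono)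
    fix y :: "nat \<Rightarrow> 'a" assume y: "y \<in> space ?P"
    have int: "integrable (?Q) (\<lambda>z. ?h t y z)" "integrable (?Q) (\<lambda>z. ?h s y z)"
      by (rule integrable_pinned_ind_merge[OF l y order_trans[OF st(1,2)]])
        (rule integrable_pinned_ind_merge[OF l y st(1)])
    have "partial_kernel l t y - partial_kernel l s y = (\<integral>z. ?h t y z - ?h s y z \<partial>?Q)"
      unfolding partial_kernel_def by (rule Bochner_Integration.integral_diff[symmetric, OF int])
    then have "\<bar>partial_kernel l t y - partial_kernel l s y\<bar> \<le> (\<integral>z. \<bar>?h t y z - ?h s y z\<bar> \<partial>?Q)"
      by (simp only: integral_abs_bound)
    then have "ennreal \<bar>partial_kernel l t y - partial_kernel l s y\<bar> \<le> ennreal (\<integral>z. \<bar>?h t y z - ?h s y z\<bar> \<partial>?Q)"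
      by (rule ennreal_leI)
    also have "\<dots> = (\<integral>\<^sup>+z. ennreal \<bar>?h t y z - ?h s y z\<bar> \<partial>?Q)"
      by (intro nn_integral_eq_integral[symmetric] integrable_abs Bochner_Integration.integrable_diff int) simp
    finally show "ennreal \<bar>partial_kernel l t y - partial_kernel l s y\<bar> \<le> \<dots>" .
  qed
  also have "\<dots> = (\<integral>\<^sup>+x. ennreal \<bar>pinned_ind t x - pinned_ind s x\<bar> \<partial>(lebesgue_on_positions {2..k} :: (nat \<Rightarrow> 'a) measure))"
  proof -
    have "(\<lambda>x. ennreal \<bar>pinned_ind t x - pinned_ind s x\<bar>) \<in> borel_measurable (lebesgue_on_positions (?I \<union> ?J) :: (nat \<Rightarrow> 'a) measure)"
      unfolding IJ by measurable
    from product_nn_integral_fold[OF IJ(2) finite_atLeastAtMost finite_atLeastAtMost this]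
    show ?thesis unfolding IJ(1) ..
  qed
  also have "\<dots> \<le> ennreal (increment_const TYPE('a) T * (t - s))"
    by (rule nn_integral_abs_diff_pinned_ind_le[OF st])
  finally show ?thesis .
qed

text \<open>
  The kernels are bounded by the volume of a box, hence the square of their difference is at most a
  constant times its absolute value, and the estimate in \<open>L\<^sup>1\<close> is enough.
\<close>
lemma nn_integral_partial_kernel_diff_square_le:
  assumes l: "l \<in> {1..k}" and st: "0 \<le> s" "s \<le> t" "t \<le> T"
  shows "sqdist (lebesgue_on_positions {2..l} :: (nat \<Rightarrow> 'a::euclidean_space) measure) (partial_kernel l t) (partial_kernel l s)
    \<le> ennreal (box_volume TYPE('a) T ^ (k - l) * increment_const TYPE('a) T * (t - s))"
proof -
  let ?P = "lebesgue_on_positions {2..l} :: (nat \<Rightarrow> 'a) measure"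
  let ?V = "box_volume TYPE('a) T ^ (k - l)"
  have V: "0 \<le> ?V" using st by (simp add: box_volume_nonneg)
  have [measurable]: "partial_kernel l t \<in> borel_measurable ?P" for t by (rule measurable_partial_kernel[OF l])
  have "sqdist ?P (partial_kernel l t) (partial_kernel l s)
     \<le> (\<integral>\<^sup>+y. ennreal ?V * ennreal \<bar>partial_kernel l t y - partial_kernel l s y\<bar> \<partial>?P)"
  proof (rule nn_integral_mono)
    fix y assume y: "y \<in> space ?P"
    let ?D = "partial_kernel l t y - partial_kernel l s y"
    have "\<bar>?D\<bar> \<le> ?V"
      using partial_kernel_bounds[OF l y, of t T] partial_kernel_bounds[OF l y, of s T] st by linarith
    then have "\<bar>?D\<bar> * \<bar>?D\<bar> \<le> ?V * \<bar>?D\<bar>" by (intro mult_right_mono) auto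
    then show "ennreal (?D\<^sup>2) \<le> ennreal ?V * ennreal \<bar>?D\<bar>"
      using V by (simp add: ennreal_mult[symmetric] power2_eq_square)
  qed
  also have "\<dots> = ennreal ?V * (\<integral>\<^sup>+y. ennreal \<bar>partial_kernel l t y - partial_kernel l s y\<bar> \<partial>?P)"
    by (rule nn_integral_cmult) measurable
  also have "\<dots> \<le> ennreal ?V * ennreal (increment_const TYPE('a) T * (t - s))"
    by (intro mult_left_mono nn_integral_partial_kernel_diff_le[OF l st]) simp
  also have "\<dots> = ennreal (?V * increment_const TYPE('a) T * (t - s))"
    using V st by (simp add: ennreal_mult[symmetric] increment_const_nonneg mult.assoc)
  finally show ?thesis .
qed

text \<open>
  At \<open>t = 0\<close> the pattern cannot occur: its points would be connected by steps of length 0, but they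
  are distinct. So square integrability is the increment bound between 0 and \<open>t\<close>.
\<close>
lemma nn_integral_partial_kernel_square_finite:
  assumes l: "l \<in> {1..k}" and t: "0 \<le> t" and k: "2 \<le> k"
  shows "(\<integral>\<^sup>+y. ennreal ((partial_kernel l t y)\<^sup>2)
      \<partial>(lebesgue_on_positions {2..l} :: (nat \<Rightarrow> 'a::euclidean_space) measure)) < \<infinity>"
proof -
  have "pinned_ind 0 x = 0" for x :: "nat \<Rightarrow> 'a"
  proof (rule ccontr)
    assume "pinned_ind 0 x \<noteq> 0"
    then have h: "pinned_ind 0 x = 1" using subgraph_ind_cases by blast
    then have "inj_on (x(1 := 0)) {1..k}"
      unfolding subgraph_ind_eq_1_iff[OF pair_graph card_pverts] by blast
    moreover have "dist ((x(1 := 0)) 1) ((x(1 := 0)) 2) \<le> real k * 0"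
      using k by (intro dist_le_of_subgraph_ind[OF pair_graph card_pverts conn h]) auto
    then have "(x(1 := 0)) 1 = (x(1 := 0)) 2" by simp
    ultimately show False using k inj_onD[of "x(1 := 0)" "{1..k}" 1 2] by simp
  qed
  then have "partial_kernel l 0 y = 0" for y :: "nat \<Rightarrow> 'a" by (simp add: partial_kernel_def)
  then show ?thesis
    using nn_integral_partial_kernel_diff_square_le[OF l order_refl t order_refl, where 'a = 'a]
    by (auto intro: le_less_trans)
qed

lemma pinned_ind_merge_dilate:
  fixes y z :: "nat \<Rightarrow> 'a::euclidean_space"
  assumes l: "l \<in> {1..k}" and c: "0 < c"
  shows "pinned_ind (c * t) (merge {2..l} {Suc l..k} (y, z)) =
    pinned_ind t (merge {2..l} {Suc l..k} (dilate (1 / c) {2..l} y, dilate (1 / c) {Suc l..k} z))"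
proof -
  let ?w = "(merge {2..l} {Suc l..k} (dilate (1 / c) {2..l} y, dilate (1 / c) {Suc l..k} z))(1 := 0)"
  have "pinned_ind (c * t) (merge {2..l} {Suc l..k} (y, z)) = subgraph_ind \<Gamma> k (c * t) (\<lambda>i. c *\<^sub>R ?w i)"
    by (rule subgraph_ind_cong) (use l c in \<open>auto simp: merge_def dilate_def\<close>)
  then show ?thesis by (simp only: subgraph_ind_scaleR[OF pair_graph card_pverts c])
qed

text \<open>
  Scale invariance of the indicator turns the factor \<open>c\<close> in \<open>t\<close> into a dilation of \<open>y\<close> and \<open>z\<close>; the
  dilation of the \<open>k - l\<close> variables \<open>z\<close> is a change of variables.
\<close>
lemma partial_kernel_scale:
  fixes y :: "nat \<Rightarrow> 'a::euclidean_space"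
  assumes l: "l \<in> {1..k}" and c: "0 < c" and y: "y \<in> space (lebesgue_on_positions {2..l})"
  shows "partial_kernel l (c * t) y = c ^ (DIM('a) * (k - l)) * partial_kernel l t (dilate (1 / c) {2..l} y)"
proof -
  let ?Q = "lebesgue_on_positions {Suc l..k} :: (nat \<Rightarrow> 'a) measure"
  let ?y = "dilate (1 / c) {2..l} y"
  have y': "?y \<in> space (lebesgue_on_positions {2..l})"
    by (rule measurable_space[OF measurable_dilate y])
  have "(\<integral>\<^sup>+z. ennreal (pinned_ind (c * t) (merge {2..l} {Suc l..k} (y, z))) \<partial>?Q) =
      (\<integral>\<^sup>+z. ennreal (pinned_ind t (merge {2..l} {Suc l..k} (?y, dilate (1 / c) {Suc l..k} z))) \<partial>?Q)"
    by (simp only: pinned_ind_merge_dilate[OF l c])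
  also have "\<dots> = ennreal (c ^ (DIM('a) * card {Suc l..k})) *
      (\<integral>\<^sup>+z. ennreal (pinned_ind t (merge {2..l} {Suc l..k} (?y, z))) \<partial>?Q)"
    using measurable_pinned_ind_merge2[OF l y', of t]
    by (intro nn_integral_scale_distr distr_PiM_dilate c measurable_dilate) auto
  finally show ?thesis
    unfolding partial_kernel_eq_nn_integral[OF l y] partial_kernel_eq_nn_integral[OF l y']
    using c by (simp add: enn2real_mult)
qed

end

section \<open>The Kolmogorov-Chentsov theorem\<close>

definition dyadic_floor :: "nat \<Rightarrow> real \<Rightarrow> nat" where
  "dyadic_floor n u = nat \<lfloor>2 ^ n * u\<rfloor>"

lemma dyadic_floor_bounds:
  assumes "0 \<le> u"
  shows "real (dyadic_floor n u) \<le> 2 ^ n * u" "2 ^ n * u < real (dyadic_floor n u) + 1"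
proof -
  have "0 \<le> 2 ^ n * u" using assms by simp
  then have "real (dyadic_floor n u) = of_int \<lfloor>2 ^ n * u\<rfloor>" by (simp add: dyadic_floor_def)
  then show "real (dyadic_floor n u) \<le> 2 ^ n * u" "2 ^ n * u < real (dyadic_floor n u) + 1"
    by linarith+
qed

lemma dyadic_floor_le:
  assumes "0 \<le> u" "u \<le> 1"
  shows "dyadic_floor n u \<le> 2 ^ n"
proof -
  have "real (dyadic_floor n u) \<le> 2 ^ n * 1"
    using dyadic_floor_bounds(1)[OF assms(1)] assms(2) by (meson mult_left_mono order_trans zero_le_numeral zero_le_power)
  then have "real (dyadic_floor n u) \<le> real (2 ^ n)" by simp
  then show ?thesis by (simp only: of_nat_le_iff)
qed

lemma dyadic_floor_Suc:
  assumes "0 \<le> u"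
  shows "dyadic_floor (Suc n) u = 2 * dyadic_floor n u \<or> dyadic_floor (Suc n) u = Suc (2 * dyadic_floor n u)"
proof -
  have "real (2 * dyadic_floor n u) < real (dyadic_floor (Suc n) u) + 1"
    using dyadic_floor_bounds[OF assms, of n] dyadic_floor_bounds[OF assms, of "Suc n"] by simp
  moreover have "real (dyadic_floor (Suc n) u) < real (2 * dyadic_floor n u) + 2"
    using dyadic_floor_bounds[OF assms, of n] dyadic_floor_bounds[OF assms, of "Suc n"] by simp
  ultimately show ?thesis by linarith
qed

lemma dyadic_floor_close:
  assumes "0 \<le> u" "u \<le> v" "v - u \<le> 1 / 2 ^ n"
  shows "dyadic_floor n v = dyadic_floor n u \<or> dyadic_floor n v = Suc (dyadic_floor n u)"
proof -
  have "2 ^ n * v \<le> 2 ^ n * u + 1"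
    using assms(3) by (simp add: field_simps)
  moreover have "2 ^ n * u \<le> 2 ^ n * v" using assms(2) by simp
  moreover have "0 \<le> v" using assms by simp
  ultimately have "real (dyadic_floor n u) < real (dyadic_floor n v) + 1"
      "real (dyadic_floor n v) < real (dyadic_floor n u) + 2"
    using dyadic_floor_bounds[OF assms(1), of n] dyadic_floor_bounds[of v n] by linarith+
  then show ?thesis by linarith
qed

lemma dyadic_approx_tendsto:
  assumes "0 \<le> u"
  shows "(\<lambda>n. real (dyadic_floor n u) / 2 ^ n) \<longlonglongrightarrow> u"
proof (rule tendsto_sandwich)
  have "(\<lambda>n. u - (1/2) ^ n) \<longlonglongrightarrow> u - 0"
    by (intro tendsto_diff tendsto_const LIMSEQ_power_zero) simp
  then show "(\<lambda>n. u - (1/2) ^ n) \<longlonglongrightarrow> u" by simp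
  show "\<forall>\<^sub>F n in sequentially. u - (1 / 2) ^ n \<le> real (dyadic_floor n u) / 2 ^ n"
  proof (intro always_eventually allI)
    fix n
    have "u \<le> (real (dyadic_floor n u) + 1) / 2 ^ n"
      using dyadic_floor_bounds(2)[OF assms, of n] by (simp add: pos_le_divide_eq mult.commute)
    then show "u - (1 / 2) ^ n \<le> real (dyadic_floor n u) / 2 ^ n"
      by (simp add: add_divide_distrib power_divide)
  qed
  show "\<forall>\<^sub>F n in sequentially. real (dyadic_floor n u) / 2 ^ n \<le> u"
    using dyadic_floor_bounds(1)[OF assms] by (intro always_eventually allI) (simp add: field_simps)
qed simp

lemma geometric_increments_tail:
  fixes a :: "nat \<Rightarrow> real"
  assumes inc: "\<And>n. \<bar>a (Suc n) - a n\<bar> \<le> K * q ^ Suc n" and q: "0 < q" "q < 1" and K: "0 \<le> K"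
  shows "convergent a" "\<bar>lim a - a n\<bar> \<le> K * q ^ n * (q / (1 - q))"
proof -
  have tail: "\<bar>a (n + p) - a n\<bar> \<le> K * q ^ n * (q / (1 - q)) * (1 - q ^ p)" for n p
  proof (induction p)
    case (Suc p)
    have "\<bar>a (n + Suc p) - a n\<bar> \<le> \<bar>a (Suc (n + p)) - a (n + p)\<bar> + \<bar>a (n + p) - a n\<bar>" by simp
    also have "\<dots> \<le> K * q ^ Suc (n + p) + K * q ^ n * (q / (1 - q)) * (1 - q ^ p)"
      using inc[of "n + p"] Suc by linarith
    also have "\<dots> = K * q ^ n * (q / (1 - q)) * (1 - q ^ Suc p)"
      using q by (simp add: field_simps power_add)
    finally show ?case .
  qed simp
  have tail': "\<bar>a (n + p) - a n\<bar> \<le> K * q ^ n * (q / (1 - q))" for n p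
  proof -
    have "K * q ^ n * (q / (1 - q)) * (1 - q ^ p) \<le> K * q ^ n * (q / (1 - q)) * 1"
      using q K by (intro mult_left_mono) auto
    then show ?thesis using tail[of n p] by linarith
  qed
  have "(\<lambda>n. K * q ^ n * (q / (1 - q))) \<longlonglongrightarrow> K * 0 * (q / (1 - q))"
    using q by (intro tendsto_intros LIMSEQ_power_zero) auto
  then have null: "(\<lambda>n. K * q ^ n * (q / (1 - q))) \<longlonglongrightarrow> 0" by simp
  have "Cauchy a"
  proof (rule CauchyI')
    fix e :: real assume "0 < e"
    then obtain N where N: "K * q ^ n * (q / (1 - q)) < e" if "n \<ge> N" for n
      using order_tendstoD(2)[OF null] by (auto simp: eventually_sequentially)
    show "\<exists>M. \<forall>m\<ge>M. \<forall>n>m. dist (a m) (a n) < e"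
    proof (intro exI allI impI)
      fix m n assume "N \<le> m" "m < n"
      then show "dist (a m) (a n) < e"
        using tail'[of m "n - m"] N[of m] by (simp add: dist_real_def abs_minus_commute)
    qed
  qed
  then show conv: "convergent a" by (simp add: Cauchy_convergent)
  then have lim: "a \<longlonglongrightarrow> lim a" by (simp add: convergent_LIMSEQ_iff)
  have "(\<lambda>p. \<bar>a (p + n) - a n\<bar>) \<longlonglongrightarrow> \<bar>lim a - a n\<bar>"
    by (intro tendsto_intros LIMSEQ_ignore_initial_segment lim)
  then show "\<bar>lim a - a n\<bar> \<le> K * q ^ n * (q / (1 - q))"
    by (rule LIMSEQ_le_const2) (use tail'[of n] in \<open>auto simp: add.commute\<close>)
qed

lemma dyadic_scale_exists:
  fixes w :: real
  assumes "0 < w" "w \<le> 1"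
  obtains n where "1 / 2 ^ Suc n < w" "w \<le> 1 / 2 ^ n"
proof -
  \<comment> \<open>the least \<open>n\<close> with this property is the required scale\<close>
  define P where "P n \<longleftrightarrow> 1 / 2 ^ Suc n < w" for n
  obtain n0 where "(1/2) ^ n0 < w"
    using real_arch_pow_inv[OF assms(1), of "1/2"] by auto
  then have "P n0"
    unfolding P_def by (rule le_less_trans[rotated]) (simp add: field_simps)
  then have P: "P (LEAST n. P n)" by (rule LeastI)
  have "w \<le> 1 / 2 ^ (LEAST n. P n)"
  proof (cases "LEAST n. P n")
    case 0
    then show ?thesis using assms by simp
  next
    case (Suc m)
    then have "\<not> P m" by (intro not_less_Least) simp
    then have "w \<le> 1 / 2 ^ Suc m" by (simp add: P_def)
    then show ?thesis by (simp only: Suc)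
  qed
  then show ?thesis using P that unfolding P_def by blast
qed

text \<open>
  Chaining. The approximations of \<open>u\<close> from below in two successive dyadic grids are equal or
  neighbours in the finer one, so the values along them converge geometrically. If \<open>v - u\<close> is about
  \<open>2\<^sup>-\<^sup>n\<close>, the approximations of \<open>u\<close> and \<open>v\<close> in the grid of level \<open>n\<close> are equal or neighbours, and
  all three contributions to \<open>y v - y u\<close> are of the order \<open>2 powr (- \<gamma> n)\<close>.
\<close>
lemma hoelder_of_dyadic_increments:
  fixes x :: "real \<Rightarrow> real"
  assumes \<gamma>: "0 < \<gamma>" and K: "0 \<le> K"
    and inc: "\<And>n j. j < 2 ^ n \<Longrightarrow> \<bar>x (real (Suc j) / 2 ^ n) - x (real j / 2 ^ n)\<bar> \<le> K * (2 powr - \<gamma>) ^ n"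
  defines "y \<equiv> \<lambda>u. lim (\<lambda>n. x (real (dyadic_floor n u) / 2 ^ n))"
  shows "u \<in> {0..1} \<Longrightarrow> (\<lambda>n. x (real (dyadic_floor n u) / 2 ^ n)) \<longlonglongrightarrow> y u"
    and "hoelder_on \<gamma> {0..1} y"
proof -
  define q where "q = 2 powr - \<gamma>"
  have q: "0 < q" "q < 1" using \<gamma> by (simp_all add: q_def powr_less_one)
  define a where "a u n = x (real (dyadic_floor n u) / 2 ^ n)" for u n
  have step: "\<bar>a u (Suc n) - a u n\<bar> \<le> K * q ^ Suc n" if u: "0 \<le> u" "u \<le> 1" for u n
  proof -
    have e: "real (dyadic_floor n u) / 2 ^ n = real (2 * dyadic_floor n u) / 2 ^ Suc n" by simp
    from dyadic_floor_Suc[OF u(1), of n] show ?thesis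
    proof
      assume "dyadic_floor (Suc n) u = 2 * dyadic_floor n u"
      then show ?thesis unfolding a_def e using K q by simp
    next
      assume s: "dyadic_floor (Suc n) u = Suc (2 * dyadic_floor n u)"
      then have "2 * dyadic_floor n u < 2 ^ Suc n"
        using dyadic_floor_le[OF u, of "Suc n"] by simp
      from inc[OF this] show ?thesis unfolding a_def e s q_def .
    qed
  qed
  have y: "y u = lim (a u)" for u by (simp add: y_def a_def[abs_def])
  have conv: "a u \<longlonglongrightarrow> y u" and tail: "\<bar>y u - a u n\<bar> \<le> K * q ^ n * (q / (1 - q))" if "0 \<le> u" "u \<le> 1" for u n
    using geometric_increments_tail[of "a u" K q, OF step[OF that] q K] unfolding y
    by (simp_all add: convergent_LIMSEQ_iff)
  then show "u \<in> {0..1} \<Longrightarrow> (\<lambda>n. x (real (dyadic_floor n u) / 2 ^ n)) \<longlonglongrightarrow> y u"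
    by (simp add: a_def[abs_def])
  define C where "C = K * (1 + 2 * (q / (1 - q))) * 2 powr \<gamma>"
  have main: "\<bar>y v - y u\<bar> \<le> C * (v - u) powr \<gamma>" if uv: "0 \<le> u" "u < v" "v \<le> 1" for u v
  proof -
    obtain n where n: "1 / 2 ^ Suc n < v - u" "v - u \<le> 1 / 2 ^ n"
      using dyadic_scale_exists[of "v - u"] uv by auto
    have mid: "\<bar>a v n - a u n\<bar> \<le> K * q ^ n"
      using dyadic_floor_close[OF uv(1) less_imp_le[OF uv(2)] n(2)]
    proof
      assume s: "dyadic_floor n v = Suc (dyadic_floor n u)"
      then have "dyadic_floor n u < 2 ^ n" using dyadic_floor_le[of v n] uv by simp
      from inc[OF this] show ?thesis by (simp add: a_def s q_def)
    qed (use K q in \<open>simp add: a_def\<close>)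
    have "\<bar>y v - y u\<bar> \<le> \<bar>y v - a v n\<bar> + \<bar>a v n - a u n\<bar> + \<bar>y u - a u n\<bar>" by linarith
    also have "\<dots> \<le> K * q ^ n * (q / (1 - q)) + K * q ^ n + K * q ^ n * (q / (1 - q))"
      using tail[of v n] tail[of u n] mid uv by linarith
    also have "\<dots> = K * (1 + 2 * (q / (1 - q))) * q ^ n" by (simp add: algebra_simps)
    also have "q ^ n \<le> 2 powr \<gamma> * (v - u) powr \<gamma>"
    proof -
      have "q ^ n = (1 / 2 ^ n) powr \<gamma>"
      proof -
        have "q ^ n = 2 powr (- \<gamma> * real n)"
          by (simp add: q_def powr_powr flip: powr_realpow)
        also have "\<dots> = (2 powr - real n) powr \<gamma>" by (simp add: powr_powr mult.commute)
        also have "2 powr - real n = 1 / 2 ^ n" by (simp add: powr_minus_divide powr_realpow)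
        finally show ?thesis .
      qed
      also have "\<dots> \<le> (2 * (v - u)) powr \<gamma>"
        using n(1) \<gamma> by (intro powr_mono2) (auto simp: field_simps)
      also have "\<dots> = 2 powr \<gamma> * (v - u) powr \<gamma>" by (rule powr_mult)
      finally show ?thesis .
    qed
    finally show ?thesis
      using K q by (simp add: C_def mult_left_mono mult.assoc)
  qed
  show "hoelder_on \<gamma> {0..1} y"
    unfolding hoelder_on_def
  proof (intro exI[of _ C] ballI)
    fix s t :: real assume "s \<in> {0..1}" "t \<in> {0..1}"
    then show "\<bar>y s - y t\<bar> \<le> C * \<bar>s - t\<bar> powr \<gamma>"
      using main[of s t] main[of t s] by (cases s t rule: linorder_cases) (auto simp: abs_minus_commute)
  qed
qed

lemma hoelder_on_mono:
  assumes "hoelder_on \<gamma> {0..T} f" "\<gamma>' \<le> \<gamma>" "0 < T"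
  shows "hoelder_on \<gamma>' {0..T} f"
proof -
  obtain C where C: "\<And>s t. s \<in> {0..T} \<Longrightarrow> t \<in> {0..T} \<Longrightarrow> \<bar>f s - f t\<bar> \<le> C * \<bar>s - t\<bar> powr \<gamma>"
    using assms(1) unfolding hoelder_on_def by blast
  have "\<bar>f s - f t\<bar> \<le> \<bar>C\<bar> * T powr (\<gamma> - \<gamma>') * \<bar>s - t\<bar> powr \<gamma>'" if st: "s \<in> {0..T}" "t \<in> {0..T}" for s t
  proof -
    have "\<bar>f s - f t\<bar> \<le> C * \<bar>s - t\<bar> powr \<gamma>" by (rule C[OF st])
    also have "\<dots> \<le> \<bar>C\<bar> * \<bar>s - t\<bar> powr \<gamma>" by (intro mult_right_mono) auto
    also have "\<bar>s - t\<bar> powr \<gamma> = \<bar>s - t\<bar> powr (\<gamma> - \<gamma>') * \<bar>s - t\<bar> powr \<gamma>'"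
      by (simp flip: powr_add)
    also have "\<bar>C\<bar> * (\<bar>s - t\<bar> powr (\<gamma> - \<gamma>') * \<bar>s - t\<bar> powr \<gamma>') \<le> \<bar>C\<bar> * (T powr (\<gamma> - \<gamma>') * \<bar>s - t\<bar> powr \<gamma>')"
      using st assms by (intro mult_left_mono mult_right_mono powr_mono2) auto
    finally show ?thesis by (simp add: mult.assoc)
  qed
  then show ?thesis unfolding hoelder_on_def by blast
qed

text \<open>
  Fatou's lemma in the form in which it is used below: bounds of moments pass to almost sure limits.
\<close>
lemma nn_integral_abs_le_of_tendsto:
  fixes Z :: "nat \<Rightarrow> 'w \<Rightarrow> real"
  assumes [measurable]: "\<And>n. Z n \<in> borel_measurable M" "Y \<in> borel_measurable M"
    and lim: "AE \<omega> in M. (\<lambda>n. Z n \<omega>) \<longlonglongrightarrow> Y \<omega>"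
    and bound: "\<And>n. (\<integral>\<^sup>+\<omega>. ennreal \<bar>Z n \<omega>\<bar> \<partial>M) \<le> b n" and "b \<longlonglongrightarrow> L"
  shows "(\<integral>\<^sup>+\<omega>. ennreal \<bar>Y \<omega>\<bar> \<partial>M) \<le> L"
proof -
  have "(\<integral>\<^sup>+\<omega>. ennreal \<bar>Y \<omega>\<bar> \<partial>M) = (\<integral>\<^sup>+\<omega>. liminf (\<lambda>n. ennreal \<bar>Z n \<omega>\<bar>) \<partial>M)"
  proof (rule nn_integral_cong_AE)
    show "AE \<omega> in M. ennreal \<bar>Y \<omega>\<bar> = liminf (\<lambda>n. ennreal \<bar>Z n \<omega>\<bar>)"
      using lim
    proof eventually_elim
      case (elim \<omega>)
      then have "(\<lambda>n. ennreal \<bar>Z n \<omega>\<bar>) \<longlonglongrightarrow> ennreal \<bar>Y \<omega>\<bar>"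
        by (intro tendsto_ennrealI tendsto_rabs)
      then show ?case by (rule lim_imp_Liminf[OF trivial_limit_sequentially, symmetric])
    qed
  qed
  also have "\<dots> \<le> liminf (\<lambda>n. \<integral>\<^sup>+\<omega>. ennreal \<bar>Z n \<omega>\<bar> \<partial>M)"
    by (rule nn_integral_liminf) measurable
  also have "\<dots> \<le> liminf b"
    by (intro Liminf_mono always_eventually allI bound)
  also have "\<dots> = L" using \<open>b \<longlonglongrightarrow> L\<close> by (simp add: lim_imp_Liminf)
  finally show ?thesis .
qed

text \<open>
  Let \<open>S\<close> be the sum over all dyadic increments of the \<open>2 m\<close>-th powers, with weight
  \<open>2 powr (2 m \<gamma> n)\<close> on level \<open>n\<close>. There are \<open>2\<^sup>n\<close> increments of level \<open>n\<close>, each with moment at most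
  \<open>C 2 powr (- m n)\<close>, so \<open>S\<close> has a finite expectation if \<open>1 < m (1 - 2 \<gamma>)\<close>. Where \<open>S\<close> is
  finite, its \<open>2 m\<close>-th root bounds all weighted increments at once.
\<close>
lemma AE_dyadic_increments_bounded:
  fixes X :: "real \<Rightarrow> 'w \<Rightarrow> real"
  assumes meas: "\<And>t. t \<in> {0..1} \<Longrightarrow> X t \<in> borel_measurable M"
    and moment: "\<And>s t. s \<in> {0..1} \<Longrightarrow> t \<in> {0..1} \<Longrightarrow>
        (\<integral>\<^sup>+\<omega>. ennreal ((X t \<omega> - X s \<omega>) ^ (2 * m)) \<partial>M) \<le> ennreal (C * \<bar>t - s\<bar> ^ m)"
    and C: "0 \<le> C" and m: "1 < real m * (1 - 2 * \<gamma>)"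
  shows "AE \<omega> in M. \<exists>K\<ge>0. \<forall>n. \<forall>j<2 ^ n.
    \<bar>X (real (Suc j) / 2 ^ n) \<omega> - X (real j / 2 ^ n) \<omega>\<bar> \<le> K * (2 powr - \<gamma>) ^ n"
proof -
  define D where "D n j \<omega> = X (real (Suc j) / 2 ^ n) \<omega> - X (real j / 2 ^ n) \<omega>" for n j \<omega>
  define S where "S \<omega> = (\<Sum>n. \<Sum>j<2 ^ n. ennreal ((2 powr (\<gamma> * real n) * D n j \<omega>) ^ (2 * m)))" for \<omega>
  define r where "r = 2 powr (1 - real m * (1 - 2 * \<gamma>))"
  have r: "0 < r" "r < 1" using m by (simp_all add: r_def powr_less_one)
  have m0: "0 < m" using m by (cases m) auto
  have pt: "real j / 2 ^ n \<in> {0..1}" if "j \<le> 2 ^ n" for j n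
  proof -
    have "real j \<le> real (2 ^ n)" using that by (simp only: of_nat_le_iff)
    then show ?thesis by simp
  qed
  have D_meas: "D n j \<in> borel_measurable M" if "j < 2 ^ n" for n j
    unfolding D_def using that by (intro borel_measurable_diff meas pt) auto
  have term_meas: "(\<lambda>\<omega>. ennreal ((2 powr (\<gamma> * real n) * D n j \<omega>) ^ (2 * m))) \<in> borel_measurable M" if "j < 2 ^ n" for n j
    using D_meas[OF that] by measurable
  have S_meas: "S \<in> borel_measurable M"
    unfolding S_def by (intro borel_measurable_suminf_order borel_measurable_sum term_meas) simp
  have each: "(\<integral>\<^sup>+\<omega>. ennreal ((2 powr (\<gamma> * real n) * D n j \<omega>) ^ (2 * m)) \<partial>M)
      \<le> ennreal (C * (r ^ n / 2 ^ n))" if j: "j < 2 ^ n" for n j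
  proof -
    note [measurable] = D_meas[OF j]
    have "(\<integral>\<^sup>+\<omega>. ennreal ((2 powr (\<gamma> * real n) * D n j \<omega>) ^ (2 * m)) \<partial>M)
        = (\<integral>\<^sup>+\<omega>. ennreal ((2 powr (\<gamma> * real n)) ^ (2 * m)) * ennreal (D n j \<omega> ^ (2 * m)) \<partial>M)"
      by (simp add: power_mult_distrib ennreal_mult[symmetric])
    also have "\<dots> = ennreal ((2 powr (\<gamma> * real n)) ^ (2 * m)) * (\<integral>\<^sup>+\<omega>. ennreal (D n j \<omega> ^ (2 * m)) \<partial>M)"
      by (rule nn_integral_cmult) measurable
    also have "\<dots> \<le> ennreal ((2 powr (\<gamma> * real n)) ^ (2 * m)) * ennreal (C * (1 / 2 ^ n) ^ m)"
    proof (rule mult_left_mono)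
      have "real (Suc j) / 2 ^ n - real j / 2 ^ n = 1 / 2 ^ n" by (simp add: field_simps)
      then show "(\<integral>\<^sup>+\<omega>. ennreal (D n j \<omega> ^ (2 * m)) \<partial>M) \<le> ennreal (C * (1 / 2 ^ n) ^ m)"
        using moment[of "real j / 2 ^ n" "real (Suc j) / 2 ^ n"] pt[of j n] pt[of "Suc j" n] j
        unfolding D_def by (simp del: of_nat_Suc)
    qed simp
    also have "\<dots> = ennreal (C * ((2 powr (\<gamma> * real n)) ^ (2 * m) * (1 / 2 ^ n) ^ m))"
      using C by (simp add: ennreal_mult[symmetric] mult_ac)
    also have "(2 powr (\<gamma> * real n)) ^ (2 * m) * (1 / 2 ^ n) ^ m = r ^ n / 2 ^ n"
    proof -
      have "(2 powr (\<gamma> * real n)) ^ (2 * m) = 2 powr (\<gamma> * real n * (2 * real m))"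
        by (simp add: powr_powr flip: powr_realpow)
      moreover have "(1 / 2 ^ n) ^ m = (2::real) powr (- (real n * real m))"
        by (simp add: powr_minus_divide power_divide powr_powr flip: powr_realpow power_mult)
      moreover have "r ^ n = 2 powr ((1 - real m * (1 - 2 * \<gamma>)) * real n)"
        by (simp add: r_def powr_powr flip: powr_realpow)
      moreover have "(2::real) ^ n = 2 powr real n" by (simp add: powr_realpow)
      ultimately show ?thesis
        by (simp add: powr_diff[symmetric] powr_add[symmetric]) (simp add: algebra_simps)
    qed
    finally show ?thesis .
  qed
  have "(\<integral>\<^sup>+\<omega>. S \<omega> \<partial>M) = (\<Sum>n. \<Sum>j<2 ^ n. (\<integral>\<^sup>+\<omega>. ennreal ((2 powr (\<gamma> * real n) * D n j \<omega>) ^ (2 * m)) \<partial>M))"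
    unfolding S_def
    by (subst nn_integral_suminf, (intro borel_measurable_sum term_meas, simp)[1])
      (intro suminf_cong nn_integral_sum term_meas, simp)
  also have "\<dots> \<le> (\<Sum>n. ennreal (C * r ^ n))"
  proof (intro suminf_le summableI)
    fix n :: nat
    have "(\<Sum>j<2 ^ n. (\<integral>\<^sup>+\<omega>. ennreal ((2 powr (\<gamma> * real n) * D n j \<omega>) ^ (2 * m)) \<partial>M))
      \<le> (\<Sum>j<(2::nat) ^ n. ennreal (C * (r ^ n / 2 ^ n)))"
      by (intro sum_mono each) simp
    also have "\<dots> = ennreal (real (2 ^ n) * (C * (r ^ n / 2 ^ n)))"
      using C r by (subst ennreal_mult) (simp_all only: sum_constant card_lessThan ennreal_of_nat_eq_real_of_nat[symmetric] of_nat_0_le_iff, simp)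
    also have "real (2 ^ n) * (C * (r ^ n / 2 ^ n)) = C * r ^ n" by simp
    finally show "(\<Sum>j<2 ^ n. (\<integral>\<^sup>+\<omega>. ennreal ((2 powr (\<gamma> * real n) * D n j \<omega>) ^ (2 * m)) \<partial>M))
      \<le> ennreal (C * r ^ n)" .
  qed
  also have "\<dots> = ennreal (\<Sum>n. C * r ^ n)"
    using C r by (intro suminf_ennreal2 summable_mult summable_geometric) auto
  finally have "(\<integral>\<^sup>+\<omega>. S \<omega> \<partial>M) < \<infinity>" by (auto intro: le_less_trans)
  then have "AE \<omega> in M. S \<omega> \<noteq> \<infinity>"
    by (intro nn_integral_PInf_AE S_meas) simp
  then show ?thesis
  proof eventually_elim
    case (elim \<omega>)
    define K where "K = root (2 * m) (enn2real (S \<omega>))"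
    have K: "0 \<le> K" unfolding K_def by (intro real_root_pos_pos_le enn2real_nonneg)
    have "\<bar>D n j \<omega>\<bar> \<le> K * (2 powr - \<gamma>) ^ n" if j: "j < 2 ^ n" for n j
    proof -
      let ?x = "2 powr (\<gamma> * real n) * D n j \<omega>"
      have "ennreal (?x ^ (2 * m)) \<le> (\<Sum>j<2 ^ n. ennreal ((2 powr (\<gamma> * real n) * D n j \<omega>) ^ (2 * m)))"
        using j by (intro member_le_sum) auto
      also have "\<dots> \<le> S \<omega>"
        unfolding S_def
        using sum_le_suminf[OF summableI, of "{n}" "\<lambda>n. \<Sum>j<2 ^ n. ennreal ((2 powr (\<gamma> * real n) * D n j \<omega>) ^ (2 * m))"]
        by simp
      finally have "?x ^ (2 * m) \<le> enn2real (S \<omega>)"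
        using elim by (metis enn2real_mono enn2real_ennreal infinity_ennreal_def less_top zero_le_even_power dvd_triv_left)
      then have "\<bar>?x\<bar> ^ (2 * m) \<le> enn2real (S \<omega>)" by (simp add: power_even_abs)
      then have "root (2 * m) (\<bar>?x\<bar> ^ (2 * m)) \<le> K"
        unfolding K_def using m0 by (intro real_root_le_mono) auto
      then have "\<bar>?x\<bar> \<le> K" using m0 by (simp add: real_root_power_cancel)
      then have "2 powr (\<gamma> * real n) * \<bar>D n j \<omega>\<bar> \<le> K" by (simp add: abs_mult)
      then have "\<bar>D n j \<omega>\<bar> \<le> K / 2 powr (\<gamma> * real n)" by (simp add: pos_le_divide_eq mult.commute)
      also have "\<dots> = K * (2 powr - \<gamma>) ^ n"
        by (simp add: powr_minus_divide powr_powr power_divide flip: powr_realpow)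
      finally show ?thesis .
    qed
    then show ?case using K unfolding D_def by blast
  qed
qed

text \<open>
  All exponents below 1/2 are reached by the sequence \<open>g p\<close>, and the moment of order \<open>2 (p + 3)\<close> is
  high enough for \<open>g p\<close>. So a single null set serves all exponents, and one modification, the limit
  along the dyadic approximations from below, has all the required path properties.
\<close>
theorem kolmogorov_chentsov_unit_interval:
  fixes X :: "real \<Rightarrow> 'w \<Rightarrow> real" and C :: "nat \<Rightarrow> real"
  assumes meas: "\<And>t. t \<in> {0..1} \<Longrightarrow> X t \<in> borel_measurable M"
    and moment: "\<And>m s t. s \<in> {0..1} \<Longrightarrow> t \<in> {0..1} \<Longrightarrow>
        (\<integral>\<^sup>+\<omega>. ennreal ((X t \<omega> - X s \<omega>) ^ (2 * m)) \<partial>M) \<le> ennreal (C m * \<bar>t - s\<bar> ^ m)"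
    and C: "\<And>m. 0 \<le> C m"
  shows "\<exists>Y. modification_on M {0..1} X Y \<and>
    (\<forall>\<omega>\<in>space M. \<forall>\<gamma>\<in>{0..<1/2}. hoelder_on \<gamma> {0..1} (\<lambda>t. Y t \<omega>))"
proof -
  define g where "g p = (1 - 1 / (real p + 2)) / 2" for p :: nat
  have g: "0 < g p" for p by (simp add: g_def)
  define good where "good \<omega> \<longleftrightarrow> (\<forall>p. \<exists>K\<ge>0. \<forall>n. \<forall>j<2 ^ n.
    \<bar>X (real (Suc j) / 2 ^ n) \<omega> - X (real j / 2 ^ n) \<omega>\<bar> \<le> K * (2 powr - g p) ^ n)" for \<omega>
  have "AE \<omega> in M. good \<omega>"
    unfolding good_def AE_all_countable
  proof
    fix p
    have "1 < real (p + 3) * (1 - 2 * g p)" by (simp add: g_def field_simps)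
    from AE_dyadic_increments_bounded[OF meas moment C this]
    show "AE \<omega> in M. \<exists>K\<ge>0. \<forall>n. \<forall>j<2 ^ n.
      \<bar>X (real (Suc j) / 2 ^ n) \<omega> - X (real j / 2 ^ n) \<omega>\<bar> \<le> K * (2 powr - g p) ^ n" by blast
  qed
  then obtain N where N: "N \<in> null_sets M" "{\<omega>\<in>space M. \<not> good \<omega>} \<subseteq> N"
    by (auto simp: eventually_ae_filter)
  define \<Omega> where "\<Omega> = space M - N"
  have \<Omega>[measurable]: "\<Omega> \<in> sets M" using N by (auto simp: \<Omega>_def)
  have good: "good \<omega>" if "\<omega> \<in> \<Omega>" for \<omega> using that N by (auto simp: \<Omega>_def)
  have AE\<Omega>: "AE \<omega> in M. \<omega> \<in> \<Omega>"
    using AE_not_in[OF N(1)] by (auto simp: \<Omega>_def)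
  define d where "d n t = real (dyadic_floor n t) / 2 ^ n" for n t
  define Y where "Y t \<omega> = (if \<omega> \<in> \<Omega> then lim (\<lambda>n. X (d n t) \<omega>) else 0)" for t \<omega>
  have path: "hoelder_on (g p) {0..1} (\<lambda>t. Y t \<omega>)" "t \<in> {0..1} \<Longrightarrow> (\<lambda>n. X (d n t) \<omega>) \<longlonglongrightarrow> Y t \<omega>"
    if \<omega>: "\<omega> \<in> \<Omega>" for \<omega> p t
  proof -
    obtain K where "0 \<le> K" "\<And>n j. j < 2 ^ n \<Longrightarrow>
        \<bar>X (real (Suc j) / 2 ^ n) \<omega> - X (real j / 2 ^ n) \<omega>\<bar> \<le> K * (2 powr - g p) ^ n"
      using good[OF \<omega>] unfolding good_def by blast
    note h = hoelder_of_dyadic_increments[where x = "\<lambda>t. X t \<omega>", OF g this]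
    show "hoelder_on (g p) {0..1} (\<lambda>t. Y t \<omega>)" "t \<in> {0..1} \<Longrightarrow> (\<lambda>n. X (d n t) \<omega>) \<longlonglongrightarrow> Y t \<omega>"
      using h \<omega> by (simp_all add: Y_def d_def)
  qed
  have d01: "d n t \<in> {0..1}" if "t \<in> {0..1}" for n t
  proof -
    have "real (dyadic_floor n t) \<le> real (2 ^ n)"
      using that dyadic_floor_le[of t n] by (simp only: of_nat_le_iff atLeastAtMost_iff)
    then show ?thesis by (simp add: d_def)
  qed
  have Y_meas: "Y t \<in> borel_measurable M" if "t \<in> {0..1}" for t
  proof -
    have [measurable]: "X (d n t) \<in> borel_measurable M" for n by (intro meas d01 that)
    show ?thesis unfolding Y_def[abs_def] by measurable
  qed
  have "modification_on M {0..1} X Y"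
    unfolding modification_on_def
  proof (intro ballI conjI)
    fix t :: real assume t: "t \<in> {0..1}"
    show "Y t \<in> borel_measurable M" by (rule Y_meas[OF t])
    note [measurable] = Y_meas[OF t] meas[OF t] meas[OF d01[OF t]]
    have "(\<integral>\<^sup>+\<omega>. ennreal \<bar>(X t \<omega> - Y t \<omega>)\<^sup>2\<bar> \<partial>M) \<le> 0"
    proof (rule nn_integral_abs_le_of_tendsto)
      show "AE \<omega> in M. (\<lambda>n. (X t \<omega> - X (d n t) \<omega>)\<^sup>2) \<longlonglongrightarrow> (X t \<omega> - Y t \<omega>)\<^sup>2"
        using AE\<Omega> by eventually_elim (intro tendsto_intros path(2) t)
      show "(\<integral>\<^sup>+\<omega>. ennreal \<bar>(X t \<omega> - X (d n t) \<omega>)\<^sup>2\<bar> \<partial>M) \<le> ennreal (C 1 * \<bar>t - d n t\<bar>)" for n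
        using moment[OF d01[OF t] t, of n 1] by simp
      have "(\<lambda>n. C 1 * \<bar>t - d n t\<bar>) \<longlonglongrightarrow> C 1 * \<bar>t - t\<bar>"
        unfolding d_def using t by (intro tendsto_intros dyadic_approx_tendsto) auto
      then show "(\<lambda>n. ennreal (C 1 * \<bar>t - d n t\<bar>)) \<longlonglongrightarrow> 0"
        using tendsto_ennrealI by fastforce
    qed measurable
    then have "AE \<omega> in M. ennreal \<bar>(X t \<omega> - Y t \<omega>)\<^sup>2\<bar> = 0"
      by (subst nn_integral_0_iff_AE[symmetric]) auto
    then show "AE \<omega> in M. Y t \<omega> = X t \<omega>" by eventually_elim auto
  qed
  moreover have "hoelder_on \<gamma> {0..1} (\<lambda>t. Y t \<omega>)" if "\<omega> \<in> space M" "\<gamma> \<in> {0..<1/2}" for \<omega> \<gamma>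
  proof (cases "\<omega> \<in> \<Omega>")
    case True
    obtain p :: nat where "1 / (1 - 2 * \<gamma>) < real p" using reals_Archimedean2 by blast
    then have "\<gamma> \<le> g p" using that by (simp add: g_def field_simps)
    then show ?thesis using hoelder_on_mono[OF path(1)[OF True]] by simp
  next
    case False
    then show ?thesis by (auto simp: hoelder_on_def Y_def intro!: exI[of _ 0])
  qed
  ultimately show ?thesis by blast
qed

theorem kolmogorov_chentsov:
  fixes X :: "real \<Rightarrow> 'w \<Rightarrow> real" and C :: "nat \<Rightarrow> real"
  assumes T: "0 < T" and meas: "\<And>t. t \<in> {0..T} \<Longrightarrow> X t \<in> borel_measurable M"
    and moment: "\<And>m s t. s \<in> {0..T} \<Longrightarrow> t \<in> {0..T} \<Longrightarrow>
        (\<integral>\<^sup>+\<omega>. ennreal ((X t \<omega> - X s \<omega>) ^ (2 * m)) \<partial>M) \<le> ennreal (C m * \<bar>t - s\<bar> ^ m)"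
    and C: "\<And>m. 0 \<le> C m"
  shows "\<exists>Y. modification_on M {0..T} X Y \<and>
    (\<forall>\<omega>\<in>space M. \<forall>\<gamma>\<in>{0..<1/2}. hoelder_on \<gamma> {0..T} (\<lambda>t. Y t \<omega>))"
proof -
  have in_T: "T * u \<in> {0..T}" if "u \<in> {0..1}" for u
    using that T by (simp add: mult_left_le)
  have "\<exists>Y. modification_on M {0..1} (\<lambda>u. X (T * u)) Y \<and>
    (\<forall>\<omega>\<in>space M. \<forall>\<gamma>\<in>{0..<1/2}. hoelder_on \<gamma> {0..1} (\<lambda>t. Y t \<omega>))"
  proof (rule kolmogorov_chentsov_unit_interval[where C = "\<lambda>m. C m * T ^ m"])
    fix m and s t :: real assume st: "s \<in> {0..1}" "t \<in> {0..1}"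
    have "\<bar>T * t - T * s\<bar> = T * \<bar>t - s\<bar>" using T by (simp add: abs_mult flip: right_diff_distrib)
    then show "(\<integral>\<^sup>+\<omega>. ennreal ((X (T * t) \<omega> - X (T * s) \<omega>) ^ (2 * m)) \<partial>M) \<le> ennreal (C m * T ^ m * \<bar>t - s\<bar> ^ m)"
      using moment[OF in_T[OF st(1)] in_T[OF st(2)], of m] by (simp add: power_mult_distrib mult.assoc)
  qed (use T C meas in_T in auto)
  then obtain Y where mod: "modification_on M {0..1} (\<lambda>u. X (T * u)) Y"
    and hoe: "\<And>\<omega> \<gamma>. \<omega> \<in> space M \<Longrightarrow> \<gamma> \<in> {0..<1/2} \<Longrightarrow> hoelder_on \<gamma> {0..1} (\<lambda>t. Y t \<omega>)" by blast
  have in_1: "t / T \<in> {0..1}" if "t \<in> {0..T}" for t using that T by simp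
  show ?thesis
  proof (intro exI[of _ "\<lambda>t. Y (t / T)"] conjI ballI)
    show "modification_on M {0..T} X (\<lambda>t. Y (t / T))"
      unfolding modification_on_def
    proof
      fix t assume "t \<in> {0..T}"
      then show "Y (t / T) \<in> borel_measurable M \<and> (AE \<omega> in M. Y (t / T) \<omega> = X t \<omega>)"
        using bspec[OF mod[unfolded modification_on_def] in_1] T by simp
    qed
    fix \<omega> \<gamma> assume "\<omega> \<in> space M" "\<gamma> \<in> {0..<1/2::real}"
    from hoe[OF this] obtain K where K: "\<And>s t. s \<in> {0..1} \<Longrightarrow> t \<in> {0..1} \<Longrightarrow> \<bar>Y s \<omega> - Y t \<omega>\<bar> \<le> K * \<bar>s - t\<bar> powr \<gamma>"
      unfolding hoelder_on_def by blast
    show "hoelder_on \<gamma> {0..T} (\<lambda>t. Y (t / T) \<omega>)"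
      unfolding hoelder_on_def
    proof (intro exI[of _ "K / T powr \<gamma>"] ballI)
      fix s t assume "s \<in> {0..T}" "t \<in> {0..T}"
      from K[OF in_1[OF this(1)] in_1[OF this(2)]]
      have "\<bar>Y (s / T) \<omega> - Y (t / T) \<omega>\<bar> \<le> K * (\<bar>s - t\<bar> / T) powr \<gamma>"
        using T by (simp add: diff_divide_distrib[symmetric])
      then show "\<bar>Y (s / T) \<omega> - Y (t / T) \<omega>\<bar> \<le> K / T powr \<gamma> * \<bar>s - t\<bar> powr \<gamma>"
        using T by (simp add: powr_divide)
    qed
  qed
qed

section \<open>Wiener integrals with respect to Gaussian noise\<close>

abbreviation step_function :: "'b measure \<Rightarrow> ('b \<Rightarrow> real) \<Rightarrow> bool" where
  "step_function \<equiv> Bochner_Integration.simple_bochner_integrable"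

text \<open>
  The moment of order \<open>2 m\<close> of the standard normal law.
\<close>
definition normal_moment :: "nat \<Rightarrow> real" where
  "normal_moment m = fact (2 * m) / (2 ^ m * fact m)"

lemma normal_moment_nonneg: "0 \<le> normal_moment m"
  by (simp add: normal_moment_def)

lemma normal_moment_0_1: "normal_moment 0 = 1" "normal_moment 1 = 1"
  by (simp_all add: normal_moment_def)

lemma centered_normal_eq_distr:
  assumes "0 < v"
  shows "centered_normal v = distr std_normal_distribution borel (\<lambda>x. sqrt v * x)"
proof -
  interpret prob_space std_normal_distribution by (rule prob_space_normal_density) simp
  have "distributed std_normal_distribution lborel (\<lambda>x. x) (normal_density 0 1)"
    by (simp add: distributed_def distr_id2)
  from normal_density_affine[OF this, of "sqrt v" 0] assms
  have "distr std_normal_distribution lborel (\<lambda>x. sqrt v * x) = density lborel (normal_density 0 (sqrt v))"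
    by (simp add: distributed_def)
  then show ?thesis using assms by (simp add: centered_normal_def cong: distr_cong)
qed

lemma real_distribution_centered_normal:
  assumes "0 \<le> v"
  shows "real_distribution (centered_normal v)"
proof (cases "v = 0")
  case True
  then show ?thesis
    by (simp add: centered_normal_def real_distribution_def real_distribution_axioms_def prob_space_return)
next
  case False
  interpret prob_space std_normal_distribution by (rule prob_space_normal_density) simp
  show ?thesis
    using assms False
    by (simp add: centered_normal_eq_distr real_distribution_def real_distribution_axioms_def prob_space_distr)
qed

lemma char_centered_normal:
  assumes "0 \<le> v"
  shows "char (centered_normal v) t = complex_of_real (exp (- (v * t\<^sup>2) / 2))"
proof (cases "v = 0")
  case True
  then show ?thesis by (simp add: centered_normal_def char_def integral_return)
next
  case False
  then have "char (centered_normal v) t = char std_normal_distribution (sqrt v * t)"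
    using assms by (simp add: centered_normal_eq_distr char_def integral_distr mult_ac)
  then show ?thesis
    using assms by (simp add: char_std_normal_distribution power_mult_distrib)
qed

lemma nn_integral_centered_normal_even_power:
  assumes "0 \<le> v"
  shows "(\<integral>\<^sup>+x. ennreal (x ^ (2 * m)) \<partial>centered_normal v) = ennreal (normal_moment m * v ^ m)"
proof (cases "v = 0")
  case True
  then show ?thesis
    by (cases m) (simp_all add: centered_normal_def nn_integral_return normal_moment_def)
next
  case False
  then have v: "0 < v" using assms by simp
  have "has_bochner_integral lborel (\<lambda>x. normal_density 0 (sqrt v) x * x ^ (2 * m)) (normal_moment m * v ^ m)"
    using normal_moment_even[of "sqrt v" 0 m] v
    by (simp add: normal_moment_def power_divide field_simps)
  then have "(\<integral>\<^sup>+x. ennreal (normal_density 0 (sqrt v) x * x ^ (2 * m)) \<partial>lborel) = ennreal (normal_moment m * v ^ m)"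
    by (subst nn_integral_eq_integral) (auto simp: has_bochner_integral_iff)
  then show ?thesis
    using v by (simp add: centered_normal_def nn_integral_density ennreal_mult)
qed

lemma AE_tendsto_zero_subseq:
  fixes u :: "nat \<Rightarrow> 'w \<Rightarrow> real"
  assumes meas [measurable]: "\<And>n. u n \<in> borel_measurable M"
    and lim: "(\<lambda>n. \<integral>\<^sup>+\<omega>. ennreal ((u n \<omega>)\<^sup>2) \<partial>M) \<longlonglongrightarrow> 0"
  obtains r :: "nat \<Rightarrow> nat" where "strict_mono r" "AE \<omega> in M. (\<lambda>n. u (r n) \<omega>) \<longlonglongrightarrow> 0"
proof -
  \<comment> \<open>from \<open>N\<close> on the squares are integrable\<close>
  obtain N where N: "(\<integral>\<^sup>+\<omega>. ennreal ((u n \<omega>)\<^sup>2) \<partial>M) < 1" if "n \<ge> N" for n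
    using order_tendstoD(2)[OF lim, of 1] by (auto simp: eventually_sequentially)
  define w where "w n \<omega> = (u (n + N) \<omega>)\<^sup>2" for n \<omega>
  have [measurable]: "w n \<in> borel_measurable M" for n unfolding w_def by measurable
  have int: "integrable M (w n)" for n
  proof (rule integrableI_nonneg)
    show "(\<integral>\<^sup>+\<omega>. ennreal (w n \<omega>) \<partial>M) < \<infinity>"
      using N[of "n + N"] by (auto simp: w_def intro: less_trans)
  qed (auto simp: w_def)
  have "(\<lambda>n. \<integral>\<omega>. norm (w n \<omega>) \<partial>M) \<longlonglongrightarrow> 0"
  proof -
    have "(\<integral>\<omega>. norm (w n \<omega>) \<partial>M) = enn2real (\<integral>\<^sup>+\<omega>. ennreal ((u (n + N) \<omega>)\<^sup>2) \<partial>M)" for n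
      by (subst integral_eq_nn_integral) (auto simp: w_def)
    moreover have "(\<lambda>n. enn2real (\<integral>\<^sup>+\<omega>. ennreal ((u (n + N) \<omega>)\<^sup>2) \<partial>M)) \<longlonglongrightarrow> 0"
      by (rule tendsto_enn2real) (use LIMSEQ_ignore_initial_segment[OF lim, of N] in simp_all)
    ultimately show ?thesis by simp
  qed
  from tendsto_L1_AE_subseq[OF int this] obtain r where r: "strict_mono r"
    and ae: "AE \<omega> in M. (\<lambda>n. w (r n) \<omega>) \<longlonglongrightarrow> 0" by auto
  show thesis
  proof (rule that[of "\<lambda>n. r n + N"])
    show "strict_mono (\<lambda>n. r n + N)" using r by (simp add: strict_mono_def)
    show "AE \<omega> in M. (\<lambda>n. u (r n + N) \<omega>) \<longlonglongrightarrow> 0"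
      using ae
    proof eventually_elim
      case (elim \<omega>)
      then have "(\<lambda>n. sqrt (w (r n) \<omega>)) \<longlonglongrightarrow> sqrt 0" by (rule tendsto_real_sqrt)
      then show ?case by (simp add: w_def tendsto_rabs_zero_iff)
    qed
  qed
qed

lemma nn_integral_diff_square_le:
  fixes a b :: "'x \<Rightarrow> real"
  assumes [measurable]: "a \<in> borel_measurable N" "b \<in> borel_measurable N"
  shows "sqdist N a b \<le>
    2 * (\<integral>\<^sup>+x. ennreal ((a x)\<^sup>2) \<partial>N) + 2 * (\<integral>\<^sup>+x. ennreal ((b x)\<^sup>2) \<partial>N)"
proof -
  have "sqdist N a b \<le> (\<integral>\<^sup>+x. 2 * ennreal ((a x)\<^sup>2) + 2 * ennreal ((b x)\<^sup>2) \<partial>N)"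
  proof (rule nn_integral_mono)
    fix x
    have "(a x - b x)\<^sup>2 \<le> 2 * (a x)\<^sup>2 + 2 * (b x)\<^sup>2"
      using zero_le_power2[of "a x + b x"] by (simp add: power2_eq_square algebra_simps)
    from ennreal_leI[OF this]
    show "ennreal ((a x - b x)\<^sup>2) \<le> 2 * ennreal ((a x)\<^sup>2) + 2 * ennreal ((b x)\<^sup>2)"
      by (simp add: ennreal_mult)
  qed
  also have "\<dots> = 2 * (\<integral>\<^sup>+x. ennreal ((a x)\<^sup>2) \<partial>N) + 2 * (\<integral>\<^sup>+x. ennreal ((b x)\<^sup>2) \<partial>N)"
    by (simp add: nn_integral_add nn_integral_cmult)
  finally show ?thesis .
qed

lemma step_functionD:
  assumes "step_function \<mu> s"
  shows "simple_function \<mu> s" "emeasure \<mu> {x \<in> space \<mu>. s x \<noteq> 0} \<noteq> \<infinity>" "finite (s ` space \<mu>)"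
    "{x \<in> space \<mu>. s x = c} \<in> sets \<mu>"
proof -
  show 1: "simple_function \<mu> s" and "emeasure \<mu> {x \<in> space \<mu>. s x \<noteq> 0} \<noteq> \<infinity>"
    using assms by (auto elim: Bochner_Integration.simple_bochner_integrable.cases)
  show "finite (s ` space \<mu>)" using 1 by (rule simple_functionD)
  have "s -` {c} \<inter> space \<mu> = {x \<in> space \<mu>. s x = c}" by auto
  then show "{x \<in> space \<mu>. s x = c} \<in> sets \<mu>" using simple_functionD(2)[OF 1, of "{c}"] by simp
qed

lemma step_function_level_set:
  assumes s: "step_function \<mu> s" and "c \<noteq> 0"
  shows "{x \<in> space \<mu>. s x = c} \<in> fmeasurable \<mu>"
proof (rule fmeasurableI)
  have "{x \<in> space \<mu>. s x \<noteq> 0} = space \<mu> - {x \<in> space \<mu>. s x = 0}" by auto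
  then have "{x \<in> space \<mu>. s x \<noteq> 0} \<in> sets \<mu>"
    using step_functionD(4)[OF s, of 0] by auto
  then have "emeasure \<mu> {x \<in> space \<mu>. s x = c} \<le> emeasure \<mu> {x \<in> space \<mu>. s x \<noteq> 0}"
    using \<open>c \<noteq> 0\<close> by (intro emeasure_mono) auto
  then show "emeasure \<mu> {x \<in> space \<mu>. s x = c} < \<infinity>"
    using step_functionD(2)[OF s] by (auto simp: less_top[symmetric] top_unique)
qed (rule step_functionD(4)[OF s])

definition atom :: "'b measure \<Rightarrow> 'i set \<Rightarrow> ('i \<Rightarrow> 'b \<Rightarrow> real) \<Rightarrow> ('i \<Rightarrow> real) \<Rightarrow> 'b set" where
  "atom \<mu> I s v = {x \<in> space \<mu>. \<forall>i\<in>I. s i x = v i}"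

text \<open>
  The functions \<open>v j\<close> list the nonzero joint values of the family \<open>s\<close>. The joint value 0 is left out,
  because its atom may have infinite measure. The values are numbered by naturals to match the
  independence property of the noise, and need not be attained: thus the list for \<open>s\<close> also
  serves for a family \<open>s \<circ> E\<close>.
\<close>
definition joint_values ::
    "'b measure \<Rightarrow> 'i set \<Rightarrow> ('i \<Rightarrow> 'b \<Rightarrow> real) \<Rightarrow> nat \<Rightarrow> (nat \<Rightarrow> 'i \<Rightarrow> real) \<Rightarrow> bool" where
  "joint_values \<mu> I s N v \<longleftrightarrow>
    (\<forall>j<N. \<exists>i\<in>I. v j i \<noteq> 0) \<and>
    (\<forall>j<N. \<forall>j'<N. j \<noteq> j' \<longrightarrow> (\<exists>i\<in>I. v j i \<noteq> v j' i)) \<and>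
    (\<forall>x\<in>space \<mu>. (\<forall>i\<in>I. s i x = 0) \<or> (\<exists>j<N. x \<in> atom \<mu> I s (v j)))"

text \<open>
  The joint values are taken as extensional functions, so that different ones differ at an
  index in \<open>I\<close>.
\<close>
lemma joint_values_exist:
  assumes I: "finite I" and s: "\<And>i. i \<in> I \<Longrightarrow> finite (s i ` space \<mu>)"
  obtains N v where "joint_values \<mu> I s N v"
proof -
  define \<phi> where "\<phi> x = (\<lambda>i\<in>I. s i x)" for x
  define W where "W = \<phi> ` space \<mu> - {\<lambda>i\<in>I. 0}"
  have "\<phi> ` space \<mu> \<subseteq> (\<Pi>\<^sub>E i\<in>I. s i ` space \<mu>)" by (auto simp: \<phi>_def)
  moreover have "finite (\<Pi>\<^sub>E i\<in>I. s i ` space \<mu>)" by (rule finite_PiE[OF I s])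
  ultimately have "finite (\<phi> ` space \<mu>)" by (rule finite_subset)
  then have "finite W" by (simp add: W_def)
  then obtain N :: nat and v where v: "bij_betw v {..<N} W"
    using ex_bij_betw_nat_finite[of W] by (auto simp: atLeast0LessThan)
  have vW: "v j \<in> W" if "j < N" for j using v that by (auto simp: bij_betw_def)
  have ext: "v j i = undefined" if "j < N" "i \<notin> I" for i j
    using vW[OF that(1)] that(2) by (auto simp: W_def \<phi>_def)
  show thesis
  proof (rule that[of N v], unfold joint_values_def, intro conjI allI impI ballI)
    fix j assume j: "j < N"
    show "\<exists>i\<in>I. v j i \<noteq> 0"
    proof (rule ccontr)
      assume "\<not> ?thesis"
      then have "v j = (\<lambda>i\<in>I. 0)" using ext[OF j] by (auto simp: fun_eq_iff restrict_def)
      then show False using vW[OF j] by (simp add: W_def)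
    qed
    fix j' assume j': "j' < N" "j \<noteq> j'"
    show "\<exists>i\<in>I. v j i \<noteq> v j' i"
    proof (rule ccontr)
      assume "\<not> ?thesis"
      then have "v j i = v j' i" for i using ext[OF j] ext[OF j'(1)] by (cases "i \<in> I") auto
      then have "v j = v j'" by (simp add: fun_eq_iff)
      then show False using j j' v by (auto simp: bij_betw_def inj_on_def)
    qed
  next
    fix x assume x: "x \<in> space \<mu>"
    show "(\<forall>i\<in>I. s i x = 0) \<or> (\<exists>j<N. x \<in> atom \<mu> I s (v j))"
    proof (cases "\<phi> x = (\<lambda>i\<in>I. 0)")
      case True
      have "s i x = 0" if "i \<in> I" for i
      proof -
        have "s i x = \<phi> x i" using that by (simp add: \<phi>_def)
        then show ?thesis using that by (simp add: True)
      qed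
      then show ?thesis by blast
    next
      case False
      then have "\<phi> x \<in> W" using x by (simp add: W_def)
      then obtain j where j: "j < N" "v j = \<phi> x" using v by (auto simp: bij_betw_def)
      have "s i x = v j i" if "i \<in> I" for i using that by (simp add: j(2) \<phi>_def)
      then show ?thesis using x j(1) by (auto simp: atom_def)
    qed
  qed
qed

lemma joint_values_compose:
  assumes "joint_values \<mu> I s N v" "E \<in> space \<mu> \<rightarrow> space \<mu>"
  shows "joint_values \<mu> I (\<lambda>i x. s i (E x)) N v"
  unfolding joint_values_def
proof (intro conjI ballI)
  show "\<forall>j<N. \<exists>i\<in>I. v j i \<noteq> 0" "\<forall>j<N. \<forall>j'<N. j \<noteq> j' \<longrightarrow> (\<exists>i\<in>I. v j i \<noteq> v j' i)"
    using assms(1) by (simp_all add: joint_values_def)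
  fix x assume x: "x \<in> space \<mu>"
  then have "E x \<in> space \<mu>" using assms(2) by blast
  then have "(\<forall>i\<in>I. s i (E x) = 0) \<or> (\<exists>j<N. E x \<in> atom \<mu> I s (v j))"
    using assms(1) by (simp add: joint_values_def)
  then show "(\<forall>i\<in>I. s i (E x) = 0) \<or> (\<exists>j<N. x \<in> atom \<mu> I (\<lambda>i x. s i (E x)) (v j))"
    using x by (auto simp: atom_def)
qed

lemma disjoint_atoms:
  assumes "joint_values \<mu> I s N v"
  shows "disjoint_family_on (\<lambda>j. atom \<mu> I s (v j)) {..<N}"
  unfolding disjoint_family_on_def
proof (intro ballI impI)
  fix j j' assume j: "j \<in> {..<N}" "j' \<in> {..<N}" "j \<noteq> j'"
  have "\<exists>i\<in>I. v j i \<noteq> v j' i" using assms j by (simp add: joint_values_def)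
  then obtain i where "i \<in> I" "v j i \<noteq> v j' i" by blast
  then show "atom \<mu> I s (v j) \<inter> atom \<mu> I s (v j') = {}" by (auto simp: atom_def)
qed

lemma simple_eq_sum_atoms:
  assumes jv: "joint_values \<mu> I s N v" and x: "x \<in> space \<mu>" and i: "i \<in> I"
  shows "s i x = (\<Sum>j<N. v j i * indicator (atom \<mu> I s (v j)) x)"
proof -
  consider "\<forall>i\<in>I. s i x = 0" | j where "j < N" "x \<in> atom \<mu> I s (v j)"
    using jv x unfolding joint_values_def by blast
  then show ?thesis
  proof cases
    case 1
    have "x \<notin> atom \<mu> I s (v j)" if j: "j < N" for j
    proof -
      obtain i' where "i' \<in> I" "v j i' \<noteq> 0" using jv j by (auto simp: joint_values_def)
      then show ?thesis using 1 by (auto simp: atom_def)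
    qed
    then show ?thesis using 1 i by simp
  next
    case 2
    have "x \<notin> atom \<mu> I s (v j')" if "j' < N" "j' \<noteq> j" for j'
      using disjoint_family_onD[OF disjoint_atoms[OF jv], of j j'] that 2 by auto
    then have "(\<Sum>j<N. v j i * indicator (atom \<mu> I s (v j)) x) = (\<Sum>j'<N. if j' = j then v j i else 0)"
      using 2 by (intro sum.cong) auto
    also have "\<dots> = v j i" using 2 by simp
    finally show ?thesis using 2 i by (simp add: atom_def)
  qed
qed

lemma atom_fmeasurable:
  assumes jv: "joint_values \<mu> I s N v" and I: "finite I"
    and s: "\<And>i. i \<in> I \<Longrightarrow> step_function \<mu> (s i)" and j: "j < N"
  shows "atom \<mu> I s (v j) \<in> fmeasurable \<mu>"
proof -
  obtain i where i: "i \<in> I" "v j i \<noteq> 0" using jv j by (auto simp: joint_values_def)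
  have "atom \<mu> I s (v j) = (\<Inter>i\<in>I. {x \<in> space \<mu>. s i x = v j i})"
    using i by (auto simp: atom_def)
  also have "\<dots> \<in> sets \<mu>"
    using i I by (intro sets.finite_INT) (auto intro: step_functionD(4)[OF s])
  finally show ?thesis
    using i by (intro fmeasurableI2[OF step_function_level_set[OF s[OF i(1)] i(2)]])
      (auto simp: atom_def)
qed

locale white_noise = prob_space M for M :: "'w measure" +
  fixes \<mu> :: "'b measure" and G :: "'b set \<Rightarrow> 'w \<Rightarrow> real"
  assumes noise: "gaussian_noise M \<mu> G"
begin

lemma measurable_noise: "A \<in> fmeasurable \<mu> \<Longrightarrow> G A \<in> borel_measurable M"
  and distr_noise: "A \<in> fmeasurable \<mu> \<Longrightarrow> distr M borel (G A) = centered_normal (measure \<mu> A)"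
  using noise unfolding gaussian_noise_def by blast+

lemma indep_noise:
  fixes I :: "nat set"
  assumes "finite I" "\<And>i. i \<in> I \<Longrightarrow> A i \<in> fmeasurable \<mu>" "disjoint_family_on A I"
  shows "indep_vars (\<lambda>_. borel) (\<lambda>i. G (A i)) I"
proof -
  have "A ` I \<subseteq> fmeasurable \<mu>" using assms(2) by blast
  then show ?thesis using noise assms(1,3) unfolding gaussian_noise_def by blast
qed

lemma AE_noise_empty: "AE \<omega> in M. G {} \<omega> = 0"
proof -
  have [measurable]: "G {} \<in> borel_measurable M" by (rule measurable_noise) simp
  have "emeasure M (G {} -` (UNIV - {0}) \<inter> space M) = emeasure (distr M borel (G {})) (UNIV - {0})"
    by (rule emeasure_distr[symmetric]) auto
  also have "\<dots> = 0" by (simp add: distr_noise centered_normal_def)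
  finally show ?thesis
    by (intro AE_I[where N = "G {} -` (UNIV - {0}) \<inter> space M"]) auto
qed

text \<open>
  Finite additivity is countable additivity for a sequence padded with empty sets, as the noise of
  the empty set has variance 0.
\<close>
lemma AE_noise_finite_Union:
  fixes I :: "nat set"
  assumes I: "finite I" and A: "\<And>i. i \<in> I \<Longrightarrow> A i \<in> fmeasurable \<mu>" and disj: "disjoint_family_on A I"
  shows "AE \<omega> in M. G (\<Union>i\<in>I. A i) \<omega> = (\<Sum>i\<in>I. G (A i) \<omega>)"
proof -
  define A' where "A' i = (if i \<in> I then A i else {})" for i
  have U: "(\<Union>i. A' i) = (\<Union>i\<in>I. A i)" by (auto simp: A'_def split: if_splits)
  have "range A' \<subseteq> fmeasurable \<mu>" using A by (auto simp: A'_def)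
  moreover have "disjoint_family A'"
    using disj by (auto simp: disjoint_family_on_def A'_def)
  moreover have "(\<Union>i. A' i) \<in> fmeasurable \<mu>"
    unfolding U using I A by (intro fmeasurable.finite_UN) auto
  ultimately have "AE \<omega> in M. (\<lambda>i. G (A' i) \<omega>) sums G (\<Union>i. A' i) \<omega>"
    using noise unfolding gaussian_noise_def by blast
  then show ?thesis
    using AE_noise_empty
  proof eventually_elim
    case (elim \<omega>)
    have "(\<lambda>i. G (A' i) \<omega>) sums (\<Sum>i\<in>I. G (A' i) \<omega>)"
      using I elim(2) by (intro sums_finite) (auto simp: A'_def)
    from sums_unique2[OF elim(1) this] show ?case
      unfolding U by (simp add: A'_def)
  qed
qed

lemma measurable_simple_wiener_integral:
  assumes s: "step_function \<mu> s"
  shows "simple_wiener_integral \<mu> G s \<in> borel_measurable M"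
proof -
  have "(\<lambda>\<omega>. c * G {x \<in> space \<mu>. s x = c} \<omega>) \<in> borel_measurable M" for c
  proof (cases "c = 0")
    case False
    then show ?thesis
      using measurable_noise[OF step_function_level_set[OF s False]] by measurable
  qed simp
  then show ?thesis
    unfolding simple_wiener_integral_def[abs_def] by (intro borel_measurable_sum)
qed

text \<open>
  Each level set of \<open>s i\<close> for a nonzero value is a finite disjoint union of atoms, so finite
  additivity of the noise expresses the integral by the noise of the atoms. The exceptional null sets
  are finite in number.
\<close>
lemma AE_simple_wiener_integral_eq:
  assumes jv: "joint_values \<mu> I s N v" and I: "finite I"
    and s: "\<And>i. i \<in> I \<Longrightarrow> step_function \<mu> (s i)" and i: "i \<in> I"
  shows "AE \<omega> in M. simple_wiener_integral \<mu> G (s i) \<omega> = (\<Sum>j<N. v j i * G (atom \<mu> I s (v j)) \<omega>)"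
proof -
  let ?A = "\<lambda>j. atom \<mu> I s (v j)"
  \<comment> \<open>includes listed values that are not attained; their level sets are empty and have noise 0 almost surely\<close>
  define C where "C = (s i ` space \<mu> \<union> (\<lambda>j. v j i) ` {..<N}) - {0}"
  have fin: "finite (s i ` space \<mu>)" by (rule step_functionD(3)[OF s[OF i]])
  then have C: "finite C" by (simp add: C_def)
  have level: "{x \<in> space \<mu>. s i x = c} = (\<Union>j\<in>{j. j < N \<and> v j i = c}. ?A j)" if "c \<noteq> 0" for c
  proof (intro equalityI subsetI)
    fix x assume "x \<in> {x \<in> space \<mu>. s i x = c}"
    then have x: "x \<in> space \<mu>" "s i x = c" by auto
    then obtain j where j: "j < N" "x \<in> ?A j"
      using jv i \<open>c \<noteq> 0\<close> unfolding joint_values_def by blast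
    then have "v j i = c" using x i by (auto simp: atom_def)
    then show "x \<in> (\<Union>j\<in>{j. j < N \<and> v j i = c}. ?A j)" using j by blast
  next
    fix x assume "x \<in> (\<Union>j\<in>{j. j < N \<and> v j i = c}. ?A j)"
    then show "x \<in> {x \<in> space \<mu>. s i x = c}" using i by (auto simp: atom_def)
  qed
  have "AE \<omega> in M. \<forall>c\<in>C. G {x \<in> space \<mu>. s i x = c} \<omega> = (\<Sum>j\<in>{j. j < N \<and> v j i = c}. G (?A j) \<omega>)"
  proof (intro AE_finite_allI C)
    fix c assume "c \<in> C"
    then have c: "c \<noteq> 0" by (simp add: C_def)
    show "AE \<omega> in M. G {x \<in> space \<mu>. s i x = c} \<omega> = (\<Sum>j\<in>{j. j < N \<and> v j i = c}. G (?A j) \<omega>)"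
      unfolding level[OF c]
    proof (rule AE_noise_finite_Union)
      show "disjoint_family_on ?A {j. j < N \<and> v j i = c}"
        using disjoint_atoms[OF jv] by (rule disjoint_family_on_mono[rotated]) auto
    qed (auto intro: atom_fmeasurable[OF jv I s])
  qed
  then show ?thesis
    using AE_noise_empty
  proof eventually_elim
    case (elim \<omega>)
    have "simple_wiener_integral \<mu> G (s i) \<omega> = (\<Sum>c\<in>C. c * G {x \<in> space \<mu>. s i x = c} \<omega>)"
      unfolding simple_wiener_integral_def
    proof (rule sum.mono_neutral_cong)
      show "c * G {x \<in> space \<mu>. s i x = c} \<omega> = 0" if "c \<in> C - s i ` space \<mu>" for c
      proof -
        have "{x \<in> space \<mu>. s i x = c} = {}" using that by auto
        then show ?thesis using elim(2) by (simp only: mult_zero_right)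
      qed
    qed (use fin C in \<open>auto simp: C_def\<close>)
    also have "\<dots> = (\<Sum>c\<in>C. \<Sum>j\<in>{j. j < N \<and> v j i = c}. v j i * G (?A j) \<omega>)"
      using elim(1) by (intro sum.cong refl) (simp add: sum_distrib_left)
    also have "\<dots> = (\<Sum>c\<in>C. \<Sum>j\<in>{j \<in> {j. j < N \<and> v j i \<noteq> 0}. v j i = c}. v j i * G (?A j) \<omega>)"
      by (intro sum.cong refl) (auto simp: C_def)
    also have "\<dots> = (\<Sum>j\<in>{j. j < N \<and> v j i \<noteq> 0}. v j i * G (?A j) \<omega>)"
      using C by (intro sum.group) (auto simp: C_def)
    also have "\<dots> = (\<Sum>j<N. v j i * G (?A j) \<omega>)"
      by (intro sum.mono_neutral_left) auto
    finally show ?case .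
  qed
qed

text \<open>
  Characteristic functions also cover vanishing coefficients and atoms of measure 0, where a summand
  is degenerate.
\<close>
lemma distr_noise_linear_combination:
  fixes I :: "nat set"
  assumes I: "finite I" and A: "\<And>i. i \<in> I \<Longrightarrow> A i \<in> fmeasurable \<mu>" and disj: "disjoint_family_on A I"
  shows "distr M borel (\<lambda>\<omega>. \<Sum>i\<in>I. a i * G (A i) \<omega>) = centered_normal (\<Sum>i\<in>I. (a i)\<^sup>2 * measure \<mu> (A i))"
proof (rule Levy_uniqueness)
  have [measurable]: "G (A i) \<in> borel_measurable M" if "i \<in> I" for i
    using measurable_noise A that by blast
  have meas: "(\<lambda>\<omega>. \<Sum>i\<in>I. a i * G (A i) \<omega>) \<in> borel_measurable M" by measurable
  have nonneg: "0 \<le> (\<Sum>i\<in>I. (a i)\<^sup>2 * measure \<mu> (A i))" by (intro sum_nonneg) simp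
  show "real_distribution (distr M borel (\<lambda>\<omega>. \<Sum>i\<in>I. a i * G (A i) \<omega>))"
    using prob_space_distr[OF meas] by (simp add: real_distribution_def real_distribution_axioms_def)
  show "real_distribution (centered_normal (\<Sum>i\<in>I. (a i)\<^sup>2 * measure \<mu> (A i)))"
    by (rule real_distribution_centered_normal[OF nonneg])
  show "char (distr M borel (\<lambda>\<omega>. \<Sum>i\<in>I. a i * G (A i) \<omega>)) =
      char (centered_normal (\<Sum>i\<in>I. (a i)\<^sup>2 * measure \<mu> (A i)))"
  proof
    fix t
    have "indep_vars (\<lambda>_. borel) (\<lambda>i \<omega>. a i * G (A i) \<omega>) I"
      by (rule indep_vars_compose2[OF indep_noise[OF I A disj]]) auto
    then have "char (distr M borel (\<lambda>\<omega>. \<Sum>i\<in>I. a i * G (A i) \<omega>)) t =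
        (\<Prod>i\<in>I. char (distr M borel (\<lambda>\<omega>. a i * G (A i) \<omega>)) t)"
      by (rule char_distr_sum)
    also have "\<dots> = (\<Prod>i\<in>I. complex_of_real (exp (- ((a i)\<^sup>2 * measure \<mu> (A i) * t\<^sup>2) / 2)))"
    proof (intro prod.cong refl)
      fix i assume i: "i \<in> I"
      note [measurable] = measurable_noise[OF A[OF i]]
      have "char (distr M borel (\<lambda>\<omega>. a i * G (A i) \<omega>)) t = char (distr M borel (G (A i))) (a i * t)"
        by (simp add: char_def integral_distr mult_ac)
      then show "char (distr M borel (\<lambda>\<omega>. a i * G (A i) \<omega>)) t =
          complex_of_real (exp (- ((a i)\<^sup>2 * measure \<mu> (A i) * t\<^sup>2) / 2))"
        by (simp add: distr_noise[OF A[OF i]] char_centered_normal power_mult_distrib mult_ac)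
    qed
    also have "\<dots> = complex_of_real (exp (\<Sum>i\<in>I. - ((a i)\<^sup>2 * measure \<mu> (A i) * t\<^sup>2) / 2))"
      by (simp only: exp_sum[OF I] of_real_prod)
    also have "(\<Sum>i\<in>I. - ((a i)\<^sup>2 * measure \<mu> (A i) * t\<^sup>2) / 2) =
        - ((\<Sum>i\<in>I. (a i)\<^sup>2 * measure \<mu> (A i)) * t\<^sup>2) / 2"
      by (simp add: sum_distrib_right sum_divide_distrib sum_negf)
    finally show "char (distr M borel (\<lambda>\<omega>. \<Sum>i\<in>I. a i * G (A i) \<omega>)) t =
        char (centered_normal (\<Sum>i\<in>I. (a i)\<^sup>2 * measure \<mu> (A i))) t"
      by (simp only: char_centered_normal[OF nonneg])
  qed
qed

text \<open>
  On common atoms of \<open>s\<close> and \<open>s'\<close> the difference of the integrals is a linear combination of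
  independent centered normal variables, whose variance is the squared \<open>L\<^sup>2\<close>-distance of \<open>s\<close> and \<open>s'\<close>.
  For \<open>m = 1\<close> this is the isometry of the integral.
\<close>
lemma simple_wiener_integral_diff_moment:
  assumes s: "step_function \<mu> s" and s': "step_function \<mu> s'"
  shows "(\<integral>\<^sup>+\<omega>. ennreal ((simple_wiener_integral \<mu> G s \<omega> - simple_wiener_integral \<mu> G s' \<omega>) ^ (2 * m)) \<partial>M) =
    ennreal (normal_moment m) * sqdist \<mu> s s' ^ m"
proof -
  define S where "S b = (if b then s else s')" for b
  have S: "step_function \<mu> (S b)" for b using s s' by (simp add: S_def)
  have S_eq: "S True = s" "S False = s'" by (simp_all add: S_def)
  obtain N v where jv: "joint_values \<mu> UNIV S N v"
    using joint_values_exist[of UNIV S \<mu>] step_functionD(3)[OF S] by auto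
  let ?A = "\<lambda>j. atom \<mu> UNIV S (v j)"
  define a where "a j = v j True - v j False" for j
  have A: "?A j \<in> fmeasurable \<mu>" if "j \<in> {..<N}" for j
    using that by (intro atom_fmeasurable[OF jv _ S]) auto
  have A': "?A j \<in> sets \<mu>" if "j < N" for j using A that by blast
  define V where "V = (\<Sum>j<N. (a j)\<^sup>2 * measure \<mu> (?A j))"
  have V: "0 \<le> V" unfolding V_def by (intro sum_nonneg) simp
  have [measurable]: "G (?A j) \<in> borel_measurable M" if "j \<in> {..<N}" for j
    by (rule measurable_noise[OF A[OF that]])
  have fin: "finite (UNIV :: bool set)" by simp
  have law: "distr M borel (\<lambda>\<omega>. \<Sum>j<N. a j * G (?A j) \<omega>) = centered_normal V"
    unfolding V_def by (rule distr_noise_linear_combination[OF finite_lessThan A disjoint_atoms[OF jv]])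
  have "AE \<omega> in M. simple_wiener_integral \<mu> G s \<omega> - simple_wiener_integral \<mu> G s' \<omega> = (\<Sum>j<N. a j * G (?A j) \<omega>)"
    using AE_simple_wiener_integral_eq[OF jv fin S UNIV_I, of True]
      AE_simple_wiener_integral_eq[OF jv fin S UNIV_I, of False]
    by eventually_elim (simp add: S_eq a_def left_diff_distrib sum_subtractf)
  then have "(\<integral>\<^sup>+\<omega>. ennreal ((simple_wiener_integral \<mu> G s \<omega> - simple_wiener_integral \<mu> G s' \<omega>) ^ (2 * m)) \<partial>M) =
      (\<integral>\<^sup>+\<omega>. ennreal ((\<Sum>j<N. a j * G (?A j) \<omega>) ^ (2 * m)) \<partial>M)"
    by (intro nn_integral_cong_AE) (auto elim: eventually_mono)
  also have "\<dots> = (\<integral>\<^sup>+x. ennreal (x ^ (2 * m)) \<partial>distr M borel (\<lambda>\<omega>. \<Sum>j<N. a j * G (?A j) \<omega>))"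
    by (subst nn_integral_distr) measurable
  also have "\<dots> = ennreal (normal_moment m * V ^ m)"
    unfolding law by (rule nn_integral_centered_normal_even_power[OF V])
  finally have lhs: "(\<integral>\<^sup>+\<omega>. ennreal ((simple_wiener_integral \<mu> G s \<omega> - simple_wiener_integral \<mu> G s' \<omega>) ^ (2 * m)) \<partial>M) =
      ennreal (normal_moment m * V ^ m)" .
  have "sqdist \<mu> s s' = (\<integral>\<^sup>+x. (\<Sum>j<N. ennreal ((a j)\<^sup>2) * indicator (?A j) x) \<partial>\<mu>)"
  proof (rule nn_integral_cong)
    fix x assume x: "x \<in> space \<mu>"
    have "s x - s' x = (\<Sum>j<N. a j * indicator (?A j) x)"
      using simple_eq_sum_atoms[OF jv x UNIV_I, of True] simple_eq_sum_atoms[OF jv x UNIV_I, of False]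
      by (simp add: S_eq a_def left_diff_distrib sum_subtractf)
    also have "(\<Sum>j<N. a j * indicator (?A j) x)\<^sup>2 = (\<Sum>j<N. (a j)\<^sup>2 * indicator (?A j) x)"
    proof (cases "\<exists>j<N. x \<in> ?A j")
      case True
      then obtain j where j: "j < N" "x \<in> ?A j" by blast
      have *: "x \<notin> ?A j'" if "j' < N" "j' \<noteq> j" for j'
        using disjoint_family_onD[OF disjoint_atoms[OF jv], of j j'] that j by auto
      have "(\<Sum>j'<N. f j' * indicator (?A j') x) = f j" for f :: "nat \<Rightarrow> real"
      proof -
        have "(\<Sum>j'<N. f j' * indicator (?A j') x) = (\<Sum>j'<N. if j' = j then f j else 0)"
          using j * by (intro sum.cong) auto
        then show ?thesis using j by simp
      qed
      then show ?thesis by simp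
    qed simp
    finally have "(s x - s' x)\<^sup>2 = (\<Sum>j<N. (a j)\<^sup>2 * indicator (?A j) x)" .
    then show "ennreal ((s x - s' x)\<^sup>2) = (\<Sum>j<N. ennreal ((a j)\<^sup>2) * indicator (?A j) x)"
      by (simp add: sum_nonneg ennreal_mult ennreal_indicator flip: sum_ennreal)
  qed
  also have "\<dots> = (\<Sum>j<N. ennreal ((a j)\<^sup>2) * emeasure \<mu> (?A j))"
    using A' by (subst nn_integral_sum) (auto simp: nn_integral_cmult_indicator)
  also have "\<dots> = ennreal V"
    using A unfolding V_def
    by (subst sum_ennreal[symmetric]) (auto simp: ennreal_mult emeasure_eq_measure2 intro!: sum.cong)
  finally have "sqdist \<mu> s s' = ennreal V" .
  then show ?thesis
    using lhs V by (simp add: ennreal_mult ennreal_power normal_moment_nonneg)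
qed

text \<open>
  The step functions that approximate \<open>f\<close> and \<open>g\<close> are eventually at a squared distance of at most
  \<open>3 \<delta>\<close>; the moments of their integrals are known, and pass to the limit by Fatou's lemma along a
  subsequence. The bound holds for all versions of the integrals. With \<open>m = 1\<close> it serves as a
  substitute for the isometry, where a constant factor does not matter.
\<close>
lemma wiener_integral_diff_moment:
  assumes f: "has_wiener_integral M \<mu> G f Y" and g: "has_wiener_integral M \<mu> G g Z"
    and \<delta>: "0 < \<delta>" and le: "sqdist \<mu> f g \<le> ennreal \<delta>"
  shows "(\<integral>\<^sup>+\<omega>. ennreal ((Y \<omega> - Z \<omega>) ^ (2 * m)) \<partial>M) \<le> ennreal (normal_moment m * (3 * \<delta>) ^ m)"
proof -
  let ?I = "simple_wiener_integral \<mu> G"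
  obtain s where s: "\<And>n. step_function \<mu> (s n)"
    and sf: "(\<lambda>n. \<integral>\<^sup>+x. ennreal ((s n x - f x)\<^sup>2) \<partial>\<mu>) \<longlonglongrightarrow> 0"
    and sY: "(\<lambda>n. \<integral>\<^sup>+\<omega>. ennreal ((?I (s n) \<omega> - Y \<omega>)\<^sup>2) \<partial>M) \<longlonglongrightarrow> 0"
    using f unfolding has_wiener_integral_def by blast
  obtain s' where s': "\<And>n. step_function \<mu> (s' n)"
    and sg: "(\<lambda>n. \<integral>\<^sup>+x. ennreal ((s' n x - g x)\<^sup>2) \<partial>\<mu>) \<longlonglongrightarrow> 0"
    and sZ: "(\<lambda>n. \<integral>\<^sup>+\<omega>. ennreal ((?I (s' n) \<omega> - Z \<omega>)\<^sup>2) \<partial>M) \<longlonglongrightarrow> 0"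
    using g unfolding has_wiener_integral_def by blast
  have [measurable]: "f \<in> borel_measurable \<mu>" "g \<in> borel_measurable \<mu>" "Y \<in> borel_measurable M" "Z \<in> borel_measurable M"
    using f g by (auto simp: has_wiener_integral_def)
  have [measurable]: "s n \<in> borel_measurable \<mu>" "s' n \<in> borel_measurable \<mu>" for n
    using step_functionD(1)[OF s] step_functionD(1)[OF s']
    by (auto intro: borel_measurable_simple_function)
  have [measurable]: "?I (s n) \<in> borel_measurable M" "?I (s' n) \<in> borel_measurable M" for n
    using s s' by (auto intro: measurable_simple_wiener_integral)
  define u where "u n \<omega> = (?I (s n) \<omega> - ?I (s' n) \<omega>) - (Y \<omega> - Z \<omega>)" for n \<omega>
  have [measurable]: "u n \<in> borel_measurable M" for n unfolding u_def[abs_def] by measurable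
  have "(\<lambda>n. \<integral>\<^sup>+\<omega>. ennreal ((u n \<omega>)\<^sup>2) \<partial>M) \<longlonglongrightarrow> 0"
  proof (rule tendsto_sandwich[OF _ _ tendsto_const])
    show "(\<lambda>n. 2 * sqdist M (?I (s n)) Y + 2 * sqdist M (?I (s' n)) Z) \<longlonglongrightarrow> 0"
      using tendsto_add[OF ennreal_tendsto_cmult[OF _ sY, of 2] ennreal_tendsto_cmult[OF _ sZ, of 2]] by simp
    show "\<forall>\<^sub>F n in sequentially. (\<integral>\<^sup>+\<omega>. ennreal ((u n \<omega>)\<^sup>2) \<partial>M) \<le>
        2 * sqdist M (?I (s n)) Y + 2 * sqdist M (?I (s' n)) Z"
    proof (intro always_eventually allI)
      fix n
      have "u n \<omega> = (?I (s n) \<omega> - Y \<omega>) - (?I (s' n) \<omega> - Z \<omega>)" for \<omega> by (simp add: u_def)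
      then show "(\<integral>\<^sup>+\<omega>. ennreal ((u n \<omega>)\<^sup>2) \<partial>M) \<le>
          2 * sqdist M (?I (s n)) Y + 2 * sqdist M (?I (s' n)) Z"
        using nn_integral_diff_square_le[of "\<lambda>\<omega>. ?I (s n) \<omega> - Y \<omega>" M "\<lambda>\<omega>. ?I (s' n) \<omega> - Z \<omega>"] by simp
    qed
  qed simp
  then obtain r where r: "strict_mono r" and ae: "AE \<omega> in M. (\<lambda>n. u (r n) \<omega>) \<longlonglongrightarrow> 0"
    using AE_tendsto_zero_subseq[of u M] by auto
  have diff: "sqdist \<mu> (s n) (s' n) \<le> 2 * ennreal \<delta> +
      (4 * sqdist \<mu> (s n) f + 4 * sqdist \<mu> (s' n) g)" for n
  proof -
    have "sqdist \<mu> (s n) (s' n) =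
        (\<integral>\<^sup>+x. ennreal (((f x - g x) - ((s' n x - g x) - (s n x - f x)))\<^sup>2) \<partial>\<mu>)" by (simp add: algebra_simps)
    also have "\<dots> \<le> 2 * sqdist \<mu> f g +
        2 * (\<integral>\<^sup>+x. ennreal (((s' n x - g x) - (s n x - f x))\<^sup>2) \<partial>\<mu>)"
      by (rule nn_integral_diff_square_le) measurable
    also have "\<dots> \<le> 2 * sqdist \<mu> f g +
        2 * (2 * sqdist \<mu> (s' n) g + 2 * sqdist \<mu> (s n) f)"
      by (intro add_left_mono mult_left_mono nn_integral_diff_square_le) measurable
    also have "\<dots> = 2 * sqdist \<mu> f g +
        (4 * sqdist \<mu> (s n) f + 4 * sqdist \<mu> (s' n) g)"
      by (simp add: distrib_left mult.assoc[symmetric] add.commute)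
    also have "\<dots> \<le> 2 * ennreal \<delta> +
        (4 * sqdist \<mu> (s n) f + 4 * sqdist \<mu> (s' n) g)"
      by (intro add_right_mono mult_left_mono le) simp
    finally show ?thesis .
  qed
  have "(\<lambda>n. 4 * sqdist \<mu> (s n) f + 4 * sqdist \<mu> (s' n) g) \<longlonglongrightarrow> 0"
    using tendsto_add[OF ennreal_tendsto_cmult[OF _ sf, of 4] ennreal_tendsto_cmult[OF _ sg, of 4]] by simp
  then have "\<forall>\<^sub>F n in sequentially. 4 * sqdist \<mu> (s n) f + 4 * sqdist \<mu> (s' n) g < ennreal \<delta>"
    using \<delta> by (intro order_tendstoD(2)) auto
  then obtain N where N: "\<And>n. n \<ge> N \<Longrightarrow> 4 * sqdist \<mu> (s n) f + 4 * sqdist \<mu> (s' n) g < ennreal \<delta>"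
    by (auto simp: eventually_sequentially)
  have diff3: "sqdist \<mu> (s n) (s' n) \<le> ennreal (3 * \<delta>)" if "n \<ge> N" for n
  proof -
    have "sqdist \<mu> (s n) (s' n) \<le> 2 * ennreal \<delta> + ennreal \<delta>"
      using diff[of n] N[OF that] by (meson add_left_mono less_imp_le order_trans)
    also have "2 * ennreal \<delta> + ennreal \<delta> = ennreal (3 * \<delta>)"
      using \<delta> by (simp add: ennreal_mult[symmetric] ennreal_plus[symmetric] flip: ennreal_numeral del: ennreal_plus)
    finally show ?thesis .
  qed
  have "(\<integral>\<^sup>+\<omega>. ennreal \<bar>(Y \<omega> - Z \<omega>) ^ (2 * m)\<bar> \<partial>M) \<le> ennreal (normal_moment m * (3 * \<delta>) ^ m)"
  proof (rule nn_integral_abs_le_of_tendsto)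
    show "AE \<omega> in M. (\<lambda>n. (?I (s (r (n + N))) \<omega> - ?I (s' (r (n + N))) \<omega>) ^ (2 * m)) \<longlonglongrightarrow> (Y \<omega> - Z \<omega>) ^ (2 * m)"
      using ae
    proof eventually_elim
      case (elim \<omega>)
      have "(\<lambda>n. u (r (n + N)) \<omega> + (Y \<omega> - Z \<omega>)) \<longlonglongrightarrow> 0 + (Y \<omega> - Z \<omega>)"
        by (intro tendsto_add tendsto_const LIMSEQ_ignore_initial_segment[OF elim])
      then show ?case by (intro tendsto_power) (simp add: u_def)
    qed
    fix n
    have "r (n + N) \<ge> N" using seq_suble[OF r, of "n + N"] by simp
    have "(\<integral>\<^sup>+\<omega>. ennreal \<bar>(?I (s (r (n + N))) \<omega> - ?I (s' (r (n + N))) \<omega>) ^ (2 * m)\<bar> \<partial>M) =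
        ennreal (normal_moment m) * sqdist \<mu> (s (r (n + N))) (s' (r (n + N))) ^ m"
      using simple_wiener_integral_diff_moment[OF s s'] by simp
    also have "\<dots> \<le> ennreal (normal_moment m) * ennreal (3 * \<delta>) ^ m"
      by (intro mult_left_mono power_mono diff3 \<open>r (n + N) \<ge> N\<close>) auto
    also have "\<dots> = ennreal (normal_moment m * (3 * \<delta>) ^ m)"
    proof -
      have "ennreal (3 * \<delta>) ^ m = ennreal ((3 * \<delta>) ^ m)" using \<delta> by (intro ennreal_power) simp
      then show ?thesis by (simp only: ennreal_mult'[OF normal_moment_nonneg])
    qed
    finally show "(\<integral>\<^sup>+\<omega>. ennreal \<bar>(?I (s (r (n + N))) \<omega> - ?I (s' (r (n + N))) \<omega>) ^ (2 * m)\<bar> \<partial>M) \<le> \<dots>" .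
  qed (auto intro: tendsto_const)
  then show ?thesis by simp
qed

lemma has_wiener_integral_simple:
  assumes "step_function \<mu> s"
  shows "has_wiener_integral M \<mu> G s (simple_wiener_integral \<mu> G s)"
  unfolding has_wiener_integral_def
  using assms step_functionD(1)[OF assms] measurable_simple_wiener_integral[OF assms]
  by (auto intro!: exI[of _ "\<lambda>_. s"] borel_measurable_simple_function)

text \<open>
  Pointwise approximation by simple functions dominated by \<open>2 |f|\<close>, followed by dominated
  convergence; the domination also forces supports of finite measure.
\<close>
lemma simple_approx_L2:
  fixes f :: "'b \<Rightarrow> real"
  assumes [measurable]: "f \<in> borel_measurable \<mu>" and fin: "(\<integral>\<^sup>+x. ennreal ((f x)\<^sup>2) \<partial>\<mu>) < \<infinity>"
  obtains s where "\<And>n. step_function \<mu> (s n)"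
    "(\<lambda>n. \<integral>\<^sup>+x. ennreal ((s n x - f x)\<^sup>2) \<partial>\<mu>) \<longlonglongrightarrow> 0"
proof -
  obtain s where s: "\<And>n. simple_function \<mu> (s n)" and lim: "\<And>x. x \<in> space \<mu> \<Longrightarrow> (\<lambda>n. s n x) \<longlonglongrightarrow> f x"
    and bd: "\<And>n x. x \<in> space \<mu> \<Longrightarrow> dist (s n x) 0 \<le> 2 * dist (f x) 0"
    using borel_measurable_implies_sequence_metric[OF assms(1), of 0] by metis
  have [measurable]: "s n \<in> borel_measurable \<mu>" for n using s by (rule borel_measurable_simple_function)
  have bd': "\<bar>s n x\<bar> \<le> 2 * \<bar>f x\<bar>" if "x \<in> space \<mu>" for n x using bd[OF that, of n] by simp
  have sq: "(s n x)\<^sup>2 \<le> 4 * (f x)\<^sup>2" if "x \<in> space \<mu>" for n x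
    using power_mono[OF bd'[OF that, of n] abs_ge_zero, of 2] by (simp add: power_mult_distrib)
  have four: "(\<integral>\<^sup>+x. ennreal (c * (f x)\<^sup>2) \<partial>\<mu>) < \<infinity>" if "0 \<le> c" for c
  proof -
    have "(\<integral>\<^sup>+x. ennreal (c * (f x)\<^sup>2) \<partial>\<mu>) = ennreal c * (\<integral>\<^sup>+x. ennreal ((f x)\<^sup>2) \<partial>\<mu>)"
      using that by (simp add: ennreal_mult nn_integral_cmult)
    then show ?thesis using fin by (simp add: ennreal_mult_less_top)
  qed
  show thesis
  proof (rule that[of s])
    fix n
    have "simple_function \<mu> (\<lambda>x. ennreal ((s n x)\<^sup>2))" by (rule simple_function_compose1[OF s])
    moreover have "(\<integral>\<^sup>+x. ennreal ((s n x)\<^sup>2) \<partial>\<mu>) < \<infinity>"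
    proof -
      have "(\<integral>\<^sup>+x. ennreal ((s n x)\<^sup>2) \<partial>\<mu>) \<le> (\<integral>\<^sup>+x. ennreal (4 * (f x)\<^sup>2) \<partial>\<mu>)"
        by (intro nn_integral_mono ennreal_leI sq)
      also have "\<dots> < \<infinity>" by (rule four) simp
      finally show ?thesis .
    qed
    ultimately have "emeasure \<mu> {x \<in> space \<mu>. ennreal ((s n x)\<^sup>2) \<noteq> 0} \<noteq> \<infinity>"
      by (rule simple_function_finite_support) simp
    then show "step_function \<mu> (s n)"
      by (intro Bochner_Integration.simple_bochner_integrable.intros s) simp
  next
    have "(\<lambda>n. \<integral>\<^sup>+x. ennreal ((s n x - f x)\<^sup>2) \<partial>\<mu>) \<longlonglongrightarrow> (\<integral>\<^sup>+x. 0 \<partial>\<mu>)"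
    proof (rule nn_integral_dominated_convergence[where w = "\<lambda>x. ennreal (9 * (f x)\<^sup>2)"])
      show "AE x in \<mu>. ennreal ((s n x - f x)\<^sup>2) \<le> ennreal (9 * (f x)\<^sup>2)" for n
      proof (rule AE_I2)
        fix x assume x: "x \<in> space \<mu>"
        have "\<bar>s n x - f x\<bar> \<le> 3 * \<bar>f x\<bar>" using bd'[OF x, of n] by linarith
        from power_mono[OF this abs_ge_zero, of 2]
        show "ennreal ((s n x - f x)\<^sup>2) \<le> ennreal (9 * (f x)\<^sup>2)"
          by (intro ennreal_leI) (simp add: power_mult_distrib)
      qed
      show "AE x in \<mu>. (\<lambda>n. ennreal ((s n x - f x)\<^sup>2)) \<longlonglongrightarrow> 0"
      proof (rule AE_I2)
        fix x assume x: "x \<in> space \<mu>"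
        have "(\<lambda>n. (s n x - f x)\<^sup>2) \<longlonglongrightarrow> (f x - f x)\<^sup>2"
          by (intro tendsto_intros lim x)
        then have "(\<lambda>n. ennreal ((s n x - f x)\<^sup>2)) \<longlonglongrightarrow> ennreal ((f x - f x)\<^sup>2)" by (rule tendsto_ennrealI)
        then show "(\<lambda>n. ennreal ((s n x - f x)\<^sup>2)) \<longlonglongrightarrow> 0" by simp
      qed
    qed (use four in auto)
    then show "(\<lambda>n. \<integral>\<^sup>+x. ennreal ((s n x - f x)\<^sup>2) \<partial>\<mu>) \<longlonglongrightarrow> 0" by simp
  qed
qed

text \<open>
  Completeness of \<open>L\<^sup>2\<close>, carried out for step functions at a squared distance of at most \<open>8\<^sup>-\<^sup>n\<close> from
  \<open>f\<close>: the increments of their integrals are summable almost surely, and by Fatou's lemma the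
  pointwise limit is also the limit in \<open>L\<^sup>2\<close>.
\<close>
lemma has_wiener_integral_exists:
  fixes f :: "'b \<Rightarrow> real"
  assumes f [measurable]: "f \<in> borel_measurable \<mu>" and fin: "(\<integral>\<^sup>+x. ennreal ((f x)\<^sup>2) \<partial>\<mu>) < \<infinity>"
  shows "\<exists>Y. has_wiener_integral M \<mu> G f Y"
proof -
  let ?I = "simple_wiener_integral \<mu> G"
  obtain s0 where s0: "\<And>n. step_function \<mu> (s0 n)"
    and lim: "(\<lambda>n. \<integral>\<^sup>+x. ennreal ((s0 n x - f x)\<^sup>2) \<partial>\<mu>) \<longlonglongrightarrow> 0"
    using simple_approx_L2[OF f fin] by blast
  have "\<exists>n. sqdist \<mu> (s0 n) f < ennreal ((1/8) ^ k)" for k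
  proof -
    have "\<forall>\<^sub>F n in sequentially. sqdist \<mu> (s0 n) f < ennreal ((1/8) ^ k)"
      by (rule order_tendstoD(2)[OF lim]) simp
    then show ?thesis by (rule eventually_happens'[OF sequentially_bot])
  qed
  then obtain r where r: "\<And>k. sqdist \<mu> (s0 (r k)) f < ennreal ((1/8) ^ k)"
    by metis
  define s where "s k = s0 (r k)" for k
  have s: "\<And>n. step_function \<mu> (s n)" by (simp add: s_def s0)
  have sf: "sqdist \<mu> (s k) f \<le> ennreal ((1/8) ^ k)" for k
    using r[of k] by (simp add: s_def less_imp_le)
  have [measurable]: "s n \<in> borel_measurable \<mu>" for n
    using step_functionD(1)[OF s] by (rule borel_measurable_simple_function)
  have [measurable]: "?I (s n) \<in> borel_measurable M" for n
    by (rule measurable_simple_wiener_integral[OF s])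
  have L2: "sqdist M (?I (s n)) (?I (s m)) \<le> ennreal (4 * (1/8) ^ n)" if "n \<le> m" for n m
  proof -
    have "sqdist M (?I (s n)) (?I (s m)) = sqdist \<mu> (s n) (s m)"
      using simple_wiener_integral_diff_moment[OF s s, of n m 1] normal_moment_0_1(2) by simp
    also have "\<dots> \<le> 2 * sqdist \<mu> (s n) f + 2 * sqdist \<mu> (s m) f"
      using nn_integral_diff_square_le[of "\<lambda>x. s n x - f x" \<mu> "\<lambda>x. s m x - f x"] by simp
    also have "\<dots> \<le> 2 * ennreal ((1/8) ^ n) + 2 * ennreal ((1/8) ^ n)"
    proof (intro add_mono mult_left_mono sf)
      have "ennreal ((1/8) ^ m) \<le> ennreal ((1/8) ^ n)"
        using that by (intro ennreal_leI power_decreasing) auto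
      then show "sqdist \<mu> (s m) f \<le> ennreal ((1/8) ^ n)"
        using sf[of m] by (rule order_trans[rotated])
    qed auto
    also have "\<dots> = ennreal (4 * (1/8) ^ n)"
    proof -
      have "2 * ennreal x + 2 * ennreal x = ennreal (4 * x)" if "0 \<le> x" for x
        using that by (simp add: ennreal_mult ennreal_plus[symmetric] distrib_right[symmetric] del: ennreal_plus)
      then show ?thesis by simp
    qed
    finally show ?thesis .
  qed
  define D where "D n \<omega> = ?I (s (Suc n)) \<omega> - ?I (s n) \<omega>" for n \<omega>
  have [measurable]: "D n \<in> borel_measurable M" for n unfolding D_def[abs_def] by measurable
  have L1: "(\<integral>\<^sup>+\<omega>. ennreal \<bar>D n \<omega>\<bar> \<partial>M) \<le> ennreal (5 * (1/2) ^ n)" for n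
  proof -
    have "(\<integral>\<^sup>+\<omega>. ennreal \<bar>D n \<omega>\<bar> \<partial>M) \<le> (\<integral>\<^sup>+\<omega>. ennreal ((1/2) ^ n) + ennreal (2 ^ n) * ennreal ((?I (s n) \<omega> - ?I (s (Suc n)) \<omega>)\<^sup>2) \<partial>M)"
    proof (rule nn_integral_mono)
      fix \<omega>
      let ?d = "?I (s n) \<omega> - ?I (s (Suc n)) \<omega>"
      \<comment> \<open>arithmetic-geometric mean inequality, with weights that keep both terms summable\<close>
      have "2 * \<bar>?d\<bar> \<le> (1/2) ^ n + 2 ^ n * ?d\<^sup>2"
      proof -
        have "0 \<le> (1/2) ^ n * (1 - 2 ^ n * \<bar>?d\<bar>)\<^sup>2" by simp
        also have "\<dots> = (1/2) ^ n - 2 * \<bar>?d\<bar> + 2 ^ n * ?d\<^sup>2"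
          by (simp add: power2_eq_square algebra_simps power_divide abs_mult_self_eq flip: power2_abs)
        finally show ?thesis by simp
      qed
      moreover have "\<bar>x\<bar> \<le> y" if "2 * \<bar>x\<bar> \<le> y" for x y :: real using that by linarith
      ultimately have "\<bar>?d\<bar> \<le> (1/2) ^ n + 2 ^ n * ?d\<^sup>2" by blast
      then have "\<bar>D n \<omega>\<bar> \<le> (1/2) ^ n + 2 ^ n * ?d\<^sup>2" by (simp add: D_def abs_minus_commute)
      from ennreal_leI[OF this]
      show "ennreal \<bar>D n \<omega>\<bar> \<le> ennreal ((1/2) ^ n) + ennreal (2 ^ n) * ennreal (?d\<^sup>2)"
        by (simp add: ennreal_mult)
    qed
    also have "\<dots> = ennreal ((1/2) ^ n) + ennreal (2 ^ n) * sqdist M (?I (s n)) (?I (s (Suc n)))"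
      by (simp add: nn_integral_add nn_integral_cmult emeasure_space_1)
    also have "\<dots> \<le> ennreal ((1/2) ^ n) + ennreal (2 ^ n) * ennreal (4 * (1/8) ^ n)"
      by (intro add_left_mono mult_left_mono L2) auto
    also have "\<dots> = ennreal ((1/2) ^ n + 4 * (1/4) ^ n)"
    proof -
      have "(8::real) ^ n = 2 ^ n * 4 ^ n" by (simp flip: power_mult_distrib)
      then show ?thesis by (simp add: ennreal_mult[symmetric] power_divide)
    qed
    also have "\<dots> \<le> ennreal (5 * (1/2) ^ n)"
      using power_mono[of "1/4" "1/2::real" n] by (intro ennreal_leI) linarith
    finally show ?thesis .
  qed
  have "(\<integral>\<^sup>+\<omega>. (\<Sum>n. ennreal \<bar>D n \<omega>\<bar>) \<partial>M) = (\<Sum>n. \<integral>\<^sup>+\<omega>. ennreal \<bar>D n \<omega>\<bar> \<partial>M)"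
    by (rule nn_integral_suminf) measurable
  also have "\<dots> \<le> (\<Sum>n. ennreal (5 * (1/2) ^ n))"
    by (intro suminf_le L1 summableI)
  also have "\<dots> = ennreal (\<Sum>n. 5 * (1/2) ^ n)"
    by (intro suminf_ennreal2 summable_mult summable_geometric) auto
  finally have "(\<integral>\<^sup>+\<omega>. (\<Sum>n. ennreal \<bar>D n \<omega>\<bar>) \<partial>M) \<noteq> \<infinity>"
    by (auto simp: top_unique)
  then have "AE \<omega> in M. (\<Sum>n. ennreal \<bar>D n \<omega>\<bar>) \<noteq> \<infinity>"
    by (intro nn_integral_PInf_AE) measurable
  then have conv: "AE \<omega> in M. convergent (\<lambda>n. ?I (s n) \<omega>)"
  proof eventually_elim
    case (elim \<omega>)
    then have "summable (\<lambda>n. \<bar>D n \<omega>\<bar>)" by (intro summable_suminf_not_top) auto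
    then have "summable (\<lambda>n. D n \<omega>)" by (rule summable_rabs_cancel)
    then have "convergent (\<lambda>n. \<Sum>i<n. D i \<omega>)" by (simp add: summable_iff_convergent)
    moreover have "(\<Sum>i<n. D i \<omega>) = ?I (s n) \<omega> - ?I (s 0) \<omega>" for n
      unfolding D_def by (rule sum_lessThan_telescope)
    ultimately have "convergent (\<lambda>n. (?I (s n) \<omega> - ?I (s 0) \<omega>) + ?I (s 0) \<omega>)"
      by (intro convergent_add convergent_const) simp
    then show ?case by simp
  qed
  define Y where "Y \<omega> = lim (\<lambda>n. ?I (s n) \<omega>)" for \<omega>
  have [measurable]: "Y \<in> borel_measurable M" unfolding Y_def[abs_def] by measurable
  have limY: "AE \<omega> in M. (\<lambda>n. ?I (s n) \<omega>) \<longlonglongrightarrow> Y \<omega>"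
    using conv by eventually_elim (simp add: Y_def convergent_LIMSEQ_iff)
  have close: "sqdist M (?I (s n)) Y \<le> ennreal (4 * (1/8) ^ n)" for n
  proof -
    have "(\<integral>\<^sup>+\<omega>. ennreal \<bar>(?I (s n) \<omega> - Y \<omega>)\<^sup>2\<bar> \<partial>M) \<le> ennreal (4 * (1/8) ^ n)"
    proof (rule nn_integral_abs_le_of_tendsto)
      show "AE \<omega> in M. (\<lambda>m. (?I (s n) \<omega> - ?I (s (m + n)) \<omega>)\<^sup>2) \<longlonglongrightarrow> (?I (s n) \<omega> - Y \<omega>)\<^sup>2"
        using limY by eventually_elim (intro tendsto_intros LIMSEQ_ignore_initial_segment)
      show "(\<integral>\<^sup>+\<omega>. ennreal \<bar>(?I (s n) \<omega> - ?I (s (m + n)) \<omega>)\<^sup>2\<bar> \<partial>M) \<le> ennreal (4 * (1/8) ^ n)" for m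
        using L2[of n "m + n"] by simp
    qed (auto intro: tendsto_const)
    then show ?thesis by simp
  qed
  have null: "(\<lambda>n. ennreal (c * (1/8) ^ n)) \<longlonglongrightarrow> 0" for c
  proof -
    have "(\<lambda>n. c * (1/8) ^ n) \<longlonglongrightarrow> c * 0"
      by (intro tendsto_intros LIMSEQ_power_zero) simp
    from tendsto_ennrealI[OF this] show ?thesis by simp
  qed
  have "has_wiener_integral M \<mu> G f Y"
    unfolding has_wiener_integral_def
  proof (intro conjI exI[of _ s] allI s)
    show "(\<lambda>n. \<integral>\<^sup>+x. ennreal ((s n x - f x)\<^sup>2) \<partial>\<mu>) \<longlonglongrightarrow> 0"
      by (rule tendsto_sandwich[OF _ _ tendsto_const null[of 1]]) (use sf in auto)
    show "(\<lambda>n. \<integral>\<^sup>+\<omega>. ennreal ((?I (s n) \<omega> - Y \<omega>)\<^sup>2) \<partial>M) \<longlonglongrightarrow> 0"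
      by (rule tendsto_sandwich[OF _ _ tendsto_const null[of 4]]) (use close in auto)
  qed measurable
  then show ?thesis by blast
qed

lemma has_wiener_integral_wiener_integral:
  fixes f :: "'b \<Rightarrow> real"
  assumes "f \<in> borel_measurable \<mu>" "(\<integral>\<^sup>+x. ennreal ((f x)\<^sup>2) \<partial>\<mu>) < \<infinity>"
  shows "has_wiener_integral M \<mu> G f (wiener_integral M \<mu> G f)"
  unfolding wiener_integral_def using someI_ex[OF has_wiener_integral_exists[OF assms]] .

lemma simple_wiener_integral_cmult:
  assumes "a \<noteq> 0"
  shows "simple_wiener_integral \<mu> G (\<lambda>x. a * s x) \<omega> = a * simple_wiener_integral \<mu> G s \<omega>"
proof -
  have "simple_wiener_integral \<mu> G (\<lambda>x. a * s x) \<omega> =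
      (\<Sum>c\<in>(*) a ` s ` space \<mu>. c * G {x \<in> space \<mu>. a * s x = c} \<omega>)"
    by (simp add: simple_wiener_integral_def image_image)
  also have "\<dots> = (\<Sum>c\<in>s ` space \<mu>. a * c * G {x \<in> space \<mu>. a * s x = a * c} \<omega>)"
    using assms by (subst sum.reindex) (auto simp: inj_on_def)
  finally show ?thesis
    using assms by (simp add: simple_wiener_integral_def sum_distrib_left mult.assoc)
qed

lemma has_wiener_integral_cmult:
  assumes a: "a \<noteq> 0" and f: "has_wiener_integral M \<mu> G f Y"
  shows "has_wiener_integral M \<mu> G (\<lambda>x. a * f x) (\<lambda>\<omega>. a * Y \<omega>)"
proof -
  let ?I = "simple_wiener_integral \<mu> G"
  obtain s where s: "\<And>n. step_function \<mu> (s n)"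
    and sf: "(\<lambda>n. \<integral>\<^sup>+x. ennreal ((s n x - f x)\<^sup>2) \<partial>\<mu>) \<longlonglongrightarrow> 0"
    and sY: "(\<lambda>n. \<integral>\<^sup>+\<omega>. ennreal ((?I (s n) \<omega> - Y \<omega>)\<^sup>2) \<partial>M) \<longlonglongrightarrow> 0"
    using f unfolding has_wiener_integral_def by blast
  have [measurable]: "f \<in> borel_measurable \<mu>" "Y \<in> borel_measurable M"
    using f by (auto simp: has_wiener_integral_def)
  have [measurable]: "s n \<in> borel_measurable \<mu>" for n
    using step_functionD(1)[OF s] by (rule borel_measurable_simple_function)
  have [measurable]: "?I (s n) \<in> borel_measurable M" for n
    by (rule measurable_simple_wiener_integral[OF s])
  have sq: "ennreal ((a * x - a * y)\<^sup>2) = ennreal (a\<^sup>2) * ennreal ((x - y)\<^sup>2)" for x y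
    by (simp add: power_mult_distrib ennreal_mult[symmetric] flip: right_diff_distrib)
  show ?thesis
    unfolding has_wiener_integral_def
  proof (intro conjI exI[of _ "\<lambda>n x. a * s n x"] allI)
    show "step_function \<mu> (\<lambda>x. a * s n x)" for n
      using Bochner_Integration.simple_bochner_integrable_compose2[OF _ s[of n] s[of n], of "\<lambda>x _. a * x"] by simp
    show "(\<lambda>n. \<integral>\<^sup>+x. ennreal ((a * s n x - a * f x)\<^sup>2) \<partial>\<mu>) \<longlonglongrightarrow> 0"
      using ennreal_tendsto_cmult[OF _ sf, of "ennreal (a\<^sup>2)"] by (simp add: sq nn_integral_cmult)
    show "(\<lambda>n. \<integral>\<^sup>+\<omega>. ennreal ((?I (\<lambda>x. a * s n x) \<omega> - a * Y \<omega>)\<^sup>2) \<partial>M) \<longlonglongrightarrow> 0"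
      using ennreal_tendsto_cmult[OF _ sY, of "ennreal (a\<^sup>2)"]
      by (simp add: simple_wiener_integral_cmult[OF a] sq nn_integral_cmult)
  qed measurable
qed

end

section \<open>Joint laws of Wiener integrals\<close>

text \<open>
  The lower orthants are stable under intersection and generate the product sigma-algebra.
\<close>
lemma PiM_borel_eqI:
  fixes P Q :: "('i \<Rightarrow> real) measure"
  assumes I: "finite I" and sets: "sets P = sets (PiM I (\<lambda>_. borel))" "sets Q = sets (PiM I (\<lambda>_. borel))"
    and fin: "emeasure P (space P) \<noteq> \<infinity>"
    and eq: "\<And>a. emeasure P (\<Pi>\<^sub>E i\<in>I. {..a i}) = emeasure Q (\<Pi>\<^sub>E i\<in>I. {..a i})"
  shows "P = Q"
proof -
  define E where "E = {{f\<in>(\<Pi>\<^sub>E i\<in>I. UNIV). \<forall>i\<in>j. f i \<in> A i} | A j.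
    j \<in> {I} \<and> A \<in> Pi j (\<lambda>_. range (\<lambda>a::real. {..a}))}"
  have box: "{f\<in>(\<Pi>\<^sub>E i\<in>I. UNIV). \<forall>i\<in>I. f i \<in> A i} = (\<Pi>\<^sub>E i\<in>I. A i)" for A :: "'i \<Rightarrow> real set"
    by (simp add: set_eq_iff PiE_iff conj_commute)
  have E_iff: "X \<in> E \<longleftrightarrow> (\<exists>a. X = (\<Pi>\<^sub>E i\<in>I. {..a i}))" for X
  proof
    assume "X \<in> E"
    then obtain A where X: "X = {f\<in>(\<Pi>\<^sub>E i\<in>I. UNIV). \<forall>i\<in>I. f i \<in> A i}"
      and A: "\<And>i. i \<in> I \<Longrightarrow> A i \<in> range (\<lambda>a::real. {..a})" by (auto simp: E_def)
    then have "\<forall>i\<in>I. \<exists>a. A i = {..a}" by blast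
    then obtain a where "\<And>i. i \<in> I \<Longrightarrow> A i = {..a i}" by metis
    then have "X = (\<Pi>\<^sub>E i\<in>I. {..a i})" unfolding X box by (intro PiE_cong)
    then show "\<exists>a. X = (\<Pi>\<^sub>E i\<in>I. {..a i})" by blast
  next
    assume "\<exists>a. X = (\<Pi>\<^sub>E i\<in>I. {..a i})"
    then obtain a where "X = (\<Pi>\<^sub>E i\<in>I. {..a i})" by blast
    then have "X = {f\<in>(\<Pi>\<^sub>E i\<in>I. UNIV). \<forall>i\<in>I. f i \<in> {..a i}}" by (simp only: box)
    then show "X \<in> E" unfolding E_def by (intro CollectI exI[of _ "\<lambda>i. {..a i}"] exI[of _ I]) auto
  qed
  have gen: "sets (PiM I (\<lambda>_. borel :: real measure)) = sigma_sets (\<Pi>\<^sub>E i\<in>I. UNIV) E"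
  proof -
    have "sets (PiM I (\<lambda>_. borel :: real measure)) = sets (PiM I (\<lambda>_. sigma UNIV (range (\<lambda>a::real. {..a}))))"
      by (intro sets_PiM_cong refl) (simp add: borel_eq_atMost)
    also have "\<dots> = sets (sigma (\<Pi>\<^sub>E i\<in>I. UNIV) E)"
      unfolding E_def
    proof (rule sets_PiM_sigma)
      show "\<exists>S\<subseteq>range (\<lambda>a::real. {..a}). countable S \<and> UNIV = \<Union>S" for i :: 'i
        by (intro exI[of _ "range (\<lambda>n::nat. {..real n})"]) (auto intro: real_arch_simple)
    qed (use I in auto)
    also have "\<dots> = sigma_sets (\<Pi>\<^sub>E i\<in>I. UNIV) E" by (rule sets_measure_of) (auto simp: E_def)
    finally show ?thesis .
  qed
  show ?thesis
  proof (rule measure_eqI_generator_eq[where E = E and \<Omega> = "\<Pi>\<^sub>E i\<in>I. UNIV" and A = "\<lambda>n. \<Pi>\<^sub>E i\<in>I. {..real n}"])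
    show "Int_stable E"
    proof (rule Int_stableI)
      fix X Y assume "X \<in> E" "Y \<in> E"
      then obtain a b where "X = (\<Pi>\<^sub>E i\<in>I. {..a i})" "Y = (\<Pi>\<^sub>E i\<in>I. {..b i})" by (auto simp: E_iff)
      then have "X \<inter> Y = (\<Pi>\<^sub>E i\<in>I. {..min (a i) (b i)})" by (auto simp: PiE_iff)
      then show "X \<inter> Y \<in> E" unfolding E_iff by (rule exI[of _ "\<lambda>i. min (a i) (b i)"])
    qed
    show "E \<subseteq> Pow (\<Pi>\<^sub>E i\<in>I. UNIV)" by (auto simp: E_def)
    show "emeasure P X = emeasure Q X" if "X \<in> E" for X using that eq by (auto simp: E_iff)
    show "sets P = sigma_sets (\<Pi>\<^sub>E i\<in>I. UNIV) E" "sets Q = sigma_sets (\<Pi>\<^sub>E i\<in>I. UNIV) E"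
      using sets gen by simp_all
    show "range (\<lambda>n. \<Pi>\<^sub>E i\<in>I. {..real n}) \<subseteq> E"
      unfolding E_iff image_subset_iff by (intro ballI exI) (rule refl)
    show "(\<Union>n. \<Pi>\<^sub>E i\<in>I. {..real n}) = (\<Pi>\<^sub>E i\<in>I. UNIV)"
    proof (intro equalityI subsetI)
      fix f :: "'i \<Rightarrow> real" assume f: "f \<in> (\<Pi>\<^sub>E i\<in>I. UNIV)"
      obtain n :: nat where n: "(\<Sum>i\<in>I. \<bar>f i\<bar>) \<le> real n" using real_arch_simple by blast
      have "f i \<le> real n" if "i \<in> I" for i
        using member_le_sum[of i I "\<lambda>i. \<bar>f i\<bar>"] that I n by force
      then show "f \<in> (\<Union>n. \<Pi>\<^sub>E i\<in>I. {..real n})" using f by (auto simp: PiE_iff)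
    qed (auto simp: PiE_iff)
    show "emeasure P (\<Pi>\<^sub>E i\<in>I. {..real n}) \<noteq> \<infinity>" for n
      using fin emeasure_space[of P "\<Pi>\<^sub>E i\<in>I. {..real n}"] by (auto simp: top_unique)
  qed
qed

text \<open>
  Along a subsequence all components converge almost surely. Hence the expectations of products of
  bounded continuous functions of the components agree in the limit, and such products approximate
  the indicators of lower orthants.
\<close>
lemma (in prob_space) joint_law_limit_eq:
  fixes U :: "nat \<Rightarrow> 'i \<Rightarrow> 'a \<Rightarrow> real"
  assumes I: "finite I"
    and [measurable]: "\<And>n i. i \<in> I \<Longrightarrow> U n i \<in> borel_measurable M" "\<And>n i. i \<in> I \<Longrightarrow> U' n i \<in> borel_measurable M"
      "\<And>i. i \<in> I \<Longrightarrow> X i \<in> borel_measurable M" "\<And>i. i \<in> I \<Longrightarrow> X' i \<in> borel_measurable M"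
    and law: "\<And>n. distr M (PiM I (\<lambda>_. borel)) (\<lambda>\<omega>. \<lambda>i\<in>I. U n i \<omega>) = distr M (PiM I (\<lambda>_. borel)) (\<lambda>\<omega>. \<lambda>i\<in>I. U' n i \<omega>)"
    and lim: "\<And>i. i \<in> I \<Longrightarrow> (\<lambda>n. \<integral>\<^sup>+\<omega>. ennreal ((U n i \<omega> - X i \<omega>)\<^sup>2) \<partial>M) \<longlonglongrightarrow> 0"
    and lim': "\<And>i. i \<in> I \<Longrightarrow> (\<lambda>n. \<integral>\<^sup>+\<omega>. ennreal ((U' n i \<omega> - X' i \<omega>)\<^sup>2) \<partial>M) \<longlonglongrightarrow> 0"
  shows "distr M (PiM I (\<lambda>_. borel)) (\<lambda>\<omega>. \<lambda>i\<in>I. X i \<omega>) = distr M (PiM I (\<lambda>_. borel)) (\<lambda>\<omega>. \<lambda>i\<in>I. X' i \<omega>)"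
proof -
  define u where "u n \<omega> = sqrt (\<Sum>i\<in>I. (U n i \<omega> - X i \<omega>)\<^sup>2 + (U' n i \<omega> - X' i \<omega>)\<^sup>2)" for n \<omega>
  have [measurable]: "u n \<in> borel_measurable M" for n unfolding u_def[abs_def] by measurable
  have "(\<lambda>n. \<integral>\<^sup>+\<omega>. ennreal ((u n \<omega>)\<^sup>2) \<partial>M) \<longlonglongrightarrow> 0"
  proof -
    have "(\<integral>\<^sup>+\<omega>. ennreal ((u n \<omega>)\<^sup>2) \<partial>M) = (\<Sum>i\<in>I. (\<integral>\<^sup>+\<omega>. ennreal ((U n i \<omega> - X i \<omega>)\<^sup>2) \<partial>M) +
        sqdist M (U' n i) (X' i))" for n
    proof -
      have "(\<integral>\<^sup>+\<omega>. ennreal ((u n \<omega>)\<^sup>2) \<partial>M) = (\<integral>\<^sup>+\<omega>. (\<Sum>i\<in>I. ennreal ((U n i \<omega> - X i \<omega>)\<^sup>2) + ennreal ((U' n i \<omega> - X' i \<omega>)\<^sup>2)) \<partial>M)"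
      proof (rule nn_integral_cong)
        fix \<omega>
        have "0 \<le> (\<Sum>i\<in>I. (U n i \<omega> - X i \<omega>)\<^sup>2 + (U' n i \<omega> - X' i \<omega>)\<^sup>2)" by (intro sum_nonneg) simp
        then show "ennreal ((u n \<omega>)\<^sup>2) = (\<Sum>i\<in>I. ennreal ((U n i \<omega> - X i \<omega>)\<^sup>2) + ennreal ((U' n i \<omega> - X' i \<omega>)\<^sup>2))"
          by (simp add: u_def flip: ennreal_plus)
      qed
      also have "\<dots> = (\<Sum>i\<in>I. (\<integral>\<^sup>+\<omega>. ennreal ((U n i \<omega> - X i \<omega>)\<^sup>2) + ennreal ((U' n i \<omega> - X' i \<omega>)\<^sup>2) \<partial>M))"
        by (intro nn_integral_sum) measurable
      also have "\<dots> = (\<Sum>i\<in>I. sqdist M (U n i) (X i) + sqdist M (U' n i) (X' i))"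
        by (intro sum.cong refl nn_integral_add) measurable
      finally show ?thesis .
    qed
    moreover have "(\<lambda>n. \<Sum>i\<in>I. sqdist M (U n i) (X i) +
        sqdist M (U' n i) (X' i)) \<longlonglongrightarrow> (\<Sum>i\<in>I. 0 + 0)"
      by (intro tendsto_sum tendsto_add lim lim')
    ultimately show ?thesis by simp
  qed
  then obtain r where ae: "AE \<omega> in M. (\<lambda>n. u (r n) \<omega>) \<longlonglongrightarrow> 0"
    using AE_tendsto_zero_subseq[of u M] by auto
  have ae_lim: "AE \<omega> in M. \<forall>i\<in>I. (\<lambda>n. U (r n) i \<omega>) \<longlonglongrightarrow> X i \<omega> \<and> (\<lambda>n. U' (r n) i \<omega>) \<longlonglongrightarrow> X' i \<omega>"
    using ae
  proof eventually_elim
    case (elim \<omega>)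
    show ?case
    proof
      fix i assume i: "i \<in> I"
      have le: "(U n i \<omega> - X i \<omega>)\<^sup>2 + (U' n i \<omega> - X' i \<omega>)\<^sup>2 \<le> (\<Sum>i\<in>I. (U n i \<omega> - X i \<omega>)\<^sup>2 + (U' n i \<omega> - X' i \<omega>)\<^sup>2)" for n
        using i I by (intro member_le_sum) auto
      have "\<bar>U n i \<omega> - X i \<omega>\<bar> \<le> u n \<omega>" "\<bar>U' n i \<omega> - X' i \<omega>\<bar> \<le> u n \<omega>" for n
        unfolding u_def using le[of n] by (auto intro!: real_le_rsqrt order_trans[OF _ le[of n]])
      then have "(\<lambda>n. U (r n) i \<omega> - X i \<omega>) \<longlonglongrightarrow> 0" "(\<lambda>n. U' (r n) i \<omega> - X' i \<omega>) \<longlonglongrightarrow> 0"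
        by (auto intro!: Lim_null_comparison[OF _ elim])
      then show "(\<lambda>n. U (r n) i \<omega>) \<longlonglongrightarrow> X i \<omega> \<and> (\<lambda>n. U' (r n) i \<omega>) \<longlonglongrightarrow> X' i \<omega>"
        by (simp add: LIM_zero_iff)
    qed
  qed
  \<comment> \<open>piecewise linear, equal to 1 up to \<open>a\<close> and decreasing to the indicator of \<open>{..a}\<close> as \<open>m\<close> grows\<close>
  define h where "h m a x = min 1 (max 0 (1 - real m * (x - a)))" for m :: nat and a x :: real
  have h_cont: "continuous_on UNIV (h m a)" for m a unfolding h_def[abs_def] by (intro continuous_intros)
  have [measurable]: "h m a \<in> borel_measurable borel" for m a
    by (rule borel_measurable_continuous_onI[OF h_cont])
  have h01: "0 \<le> h m a x" "h m a x \<le> 1" for m a x by (auto simp: h_def)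
  have h_prod: "\<bar>\<Prod>i\<in>I. h m (a i) (y i)\<bar> \<le> 1" for m a y
    using h01 by (simp add: abs_prod prod_le_1)
  have h_lim: "(\<lambda>m. h m a x) \<longlonglongrightarrow> indicator {..a} x" for a x
  proof (cases "x \<le> a")
    case True
    have "h m a x = 1" for m
      using True mult_nonneg_nonpos[of "real m" "x - a"] by (auto simp: h_def)
    then show ?thesis using True by simp
  next
    case False
    then obtain m0 :: nat where m0: "1 / (x - a) < real m0" using reals_Archimedean2 by blast
    have "h m a x = 0" if "m \<ge> m0" for m
    proof -
      have "1 / (x - a) < real m" using m0 that by linarith
      then have "1 < real m * (x - a)" using False by (simp add: field_simps)
      then show ?thesis by (simp add: h_def)
    qed
    then have "\<forall>\<^sub>F m in sequentially. h m a x = indicator {..a} x"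
      using False by (auto simp: eventually_sequentially)
    then show ?thesis by (rule tendsto_eventually)
  qed
  have prod_meas: "(\<lambda>\<omega>. \<Prod>i\<in>I. h m (a i) (W i \<omega>)) \<in> borel_measurable M"
    if "\<And>i. i \<in> I \<Longrightarrow> W i \<in> borel_measurable M" for W m and a :: "'i \<Rightarrow> real"
    using that by (intro borel_measurable_prod) measurable
  have exp_eq: "expectation (\<lambda>\<omega>. \<Prod>i\<in>I. h m (a i) (X i \<omega>)) = expectation (\<lambda>\<omega>. \<Prod>i\<in>I. h m (a i) (X' i \<omega>))" for m and a :: "'i \<Rightarrow> real"
  proof (rule LIMSEQ_unique)
    have "expectation (\<lambda>\<omega>. \<Prod>i\<in>I. h m (a i) (U n i \<omega>)) = expectation (\<lambda>\<omega>. \<Prod>i\<in>I. h m (a i) (U' n i \<omega>))" for n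
    proof -
      let ?F = "\<lambda>y. \<Prod>i\<in>I. h m (a i) (y i)"
      have F: "?F \<in> borel_measurable (PiM I (\<lambda>_. borel))" by measurable
      have "expectation (\<lambda>\<omega>. ?F (\<lambda>i\<in>I. U n i \<omega>)) = expectation (\<lambda>\<omega>. ?F (\<lambda>i\<in>I. U' n i \<omega>))"
        using arg_cong[OF law[of n], of "\<lambda>N. integral\<^sup>L N ?F"] F by (simp add: integral_distr)
      then show ?thesis by (simp cong: prod.cong)
    qed
    then have e: "(\<lambda>n. expectation (\<lambda>\<omega>. \<Prod>i\<in>I. h m (a i) (U (r n) i \<omega>))) = (\<lambda>n. expectation (\<lambda>\<omega>. \<Prod>i\<in>I. h m (a i) (U' (r n) i \<omega>)))"
      by simp
    have cont: "isCont (h m b) x" for b x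
      using h_cont[of m b] by (simp add: continuous_on_eq_continuous_at)
    show "(\<lambda>n. expectation (\<lambda>\<omega>. \<Prod>i\<in>I. h m (a i) (U (r n) i \<omega>))) \<longlonglongrightarrow> expectation (\<lambda>\<omega>. \<Prod>i\<in>I. h m (a i) (X i \<omega>))"
    proof (rule integral_dominated_convergence[where w = "\<lambda>_. 1"])
      show "AE \<omega> in M. (\<lambda>n. \<Prod>i\<in>I. h m (a i) (U (r n) i \<omega>)) \<longlonglongrightarrow> (\<Prod>i\<in>I. h m (a i) (X i \<omega>))"
        using ae_lim by eventually_elim (intro tendsto_prod isCont_tendsto_compose[OF cont], blast)
      show "AE \<omega> in M. norm (\<Prod>i\<in>I. h m (a i) (U (r n) i \<omega>)) \<le> 1" for n
        using h_prod by simp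
    qed (auto intro!: prod_meas)
    show "(\<lambda>n. expectation (\<lambda>\<omega>. \<Prod>i\<in>I. h m (a i) (U (r n) i \<omega>))) \<longlonglongrightarrow> expectation (\<lambda>\<omega>. \<Prod>i\<in>I. h m (a i) (X' i \<omega>))"
      unfolding e
    proof (rule integral_dominated_convergence[where w = "\<lambda>_. 1"])
      show "AE \<omega> in M. (\<lambda>n. \<Prod>i\<in>I. h m (a i) (U' (r n) i \<omega>)) \<longlonglongrightarrow> (\<Prod>i\<in>I. h m (a i) (X' i \<omega>))"
        using ae_lim by eventually_elim (intro tendsto_prod isCont_tendsto_compose[OF cont], blast)
      show "AE \<omega> in M. norm (\<Prod>i\<in>I. h m (a i) (U' (r n) i \<omega>)) \<le> 1" for n
        using h_prod by simp
    qed (auto intro!: prod_meas)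
  qed
  have box: "emeasure (distr M (PiM I (\<lambda>_. borel)) (\<lambda>\<omega>. \<lambda>i\<in>I. W i \<omega>)) (\<Pi>\<^sub>E i\<in>I. {..a i}) =
      ennreal (expectation (\<lambda>\<omega>. \<Prod>i\<in>I. indicator {..a i} (W i \<omega>)))"
    if [measurable]: "\<And>i. i \<in> I \<Longrightarrow> W i \<in> borel_measurable M" for W and a :: "'i \<Rightarrow> real"
  proof -
    let ?S = "{\<omega> \<in> space M. \<forall>i\<in>I. W i \<omega> \<le> a i}"
    have S[measurable]: "?S \<in> events" using I by measurable
    have "emeasure (distr M (PiM I (\<lambda>_. borel)) (\<lambda>\<omega>. \<lambda>i\<in>I. W i \<omega>)) (\<Pi>\<^sub>E i\<in>I. {..a i}) =
        emeasure M ((\<lambda>\<omega>. \<lambda>i\<in>I. W i \<omega>) -` (\<Pi>\<^sub>E i\<in>I. {..a i}) \<inter> space M)"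
      using I by (intro emeasure_distr sets_PiM_I_finite) measurable
    also have "(\<lambda>\<omega>. \<lambda>i\<in>I. W i \<omega>) -` (\<Pi>\<^sub>E i\<in>I. {..a i}) \<inter> space M = ?S"
      by (auto simp: PiE_iff)
    also have "emeasure M ?S = ennreal (expectation (indicator ?S))" using S by (simp add: emeasure_eq_measure)
    also have "expectation (indicator ?S) = expectation (\<lambda>\<omega>. \<Prod>i\<in>I. indicator {..a i} (W i \<omega>) :: real)"
    proof (rule Bochner_Integration.integral_cong[OF refl])
      fix \<omega> assume "\<omega> \<in> space M"
      then show "indicator ?S \<omega> = (\<Prod>i\<in>I. indicator {..a i} (W i \<omega>) :: real)"
        using I by (cases "\<forall>i\<in>I. W i \<omega> \<le> a i") (auto simp: indicator_def prod_zero_iff)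
    qed
    finally show ?thesis .
  qed
  have ind_lim: "(\<lambda>m. expectation (\<lambda>\<omega>. \<Prod>i\<in>I. h m (a i) (W i \<omega>))) \<longlonglongrightarrow> expectation (\<lambda>\<omega>. \<Prod>i\<in>I. indicator {..a i} (W i \<omega>))"
    if [measurable]: "\<And>i. i \<in> I \<Longrightarrow> W i \<in> borel_measurable M" for W and a :: "'i \<Rightarrow> real"
  proof (rule integral_dominated_convergence[where w = "\<lambda>_. 1"])
    show "AE \<omega> in M. (\<lambda>m. \<Prod>i\<in>I. h m (a i) (W i \<omega>)) \<longlonglongrightarrow> (\<Prod>i\<in>I. indicator {..a i} (W i \<omega>))"
      by (intro AE_I2 tendsto_prod h_lim)
    show "AE \<omega> in M. norm (\<Prod>i\<in>I. h m (a i) (W i \<omega>)) \<le> 1" for m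
      using h_prod by simp
    show "(\<lambda>\<omega>. \<Prod>i\<in>I. indicator {..a i} (W i \<omega>) :: real) \<in> borel_measurable M"
      by (intro borel_measurable_prod) measurable
  qed (auto intro!: prod_meas)
  show ?thesis
  proof (rule PiM_borel_eqI[OF I])
    show "emeasure (distr M (PiM I (\<lambda>_. borel)) (\<lambda>\<omega>. \<lambda>i\<in>I. X i \<omega>)) (\<Pi>\<^sub>E i\<in>I. {..a i}) =
        emeasure (distr M (PiM I (\<lambda>_. borel)) (\<lambda>\<omega>. \<lambda>i\<in>I. X' i \<omega>)) (\<Pi>\<^sub>E i\<in>I. {..a i})" for a :: "'i \<Rightarrow> real"
    proof -
      have "expectation (\<lambda>\<omega>. \<Prod>i\<in>I. indicator {..a i} (X i \<omega>)) = expectation (\<lambda>\<omega>. \<Prod>i\<in>I. indicator {..a i} (X' i \<omega>) :: real)"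
        by (rule LIMSEQ_unique[OF ind_lim[of X]]) (use ind_lim[of X' a] exp_eq in auto)
      then show ?thesis by (simp add: box)
    qed
    have "(\<lambda>\<omega>. \<lambda>i\<in>I. X i \<omega>) \<in> M \<rightarrow>\<^sub>M PiM I (\<lambda>_. borel)" by measurable
    from prob_space.emeasure_space_1[OF prob_space_distr[OF this]]
    show "emeasure (distr M (PiM I (\<lambda>_. borel)) (\<lambda>\<omega>. \<lambda>i\<in>I. X i \<omega>))
        (space (distr M (PiM I (\<lambda>_. borel)) (\<lambda>\<omega>. \<lambda>i\<in>I. X i \<omega>))) \<noteq> \<infinity>" by simp
  qed simp_all
qed

context white_noise
begin

lemma distr_scaled_noise:
  assumes A: "A \<in> fmeasurable \<mu>"
  shows "distr M borel (\<lambda>\<omega>. a * G A \<omega>) = centered_normal (a\<^sup>2 * measure \<mu> A)"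
  using distr_noise_linear_combination[of "{0}" "\<lambda>_. A" "\<lambda>_. a"] A
  by (simp add: disjoint_family_on_def)

text \<open>
  Both families are independent, and their members have the same centered normal laws because
  \<open>E\<close> multiplies measures by \<open>\<kappa>\<close>.
\<close>
lemma joint_law_noise_pullback:
  fixes N :: nat
  assumes E: "E \<in> \<mu> \<rightarrow>\<^sub>M \<mu>" and scale: "distr \<mu> \<mu> E = scale_measure (ennreal \<kappa>) \<mu>" and \<kappa>: "0 \<le> \<kappa>"
    and A: "\<And>j. j < N \<Longrightarrow> A j \<in> fmeasurable \<mu>" and disj: "disjoint_family_on A {..<N}"
  shows "distr M (PiM {..<N} (\<lambda>_. borel)) (\<lambda>\<omega>. \<lambda>j\<in>{..<N}. G (E -` A j \<inter> space \<mu>) \<omega>) =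
    distr M (PiM {..<N} (\<lambda>_. borel)) (\<lambda>\<omega>. \<lambda>j\<in>{..<N}. sqrt \<kappa> * G (A j) \<omega>)"
proof (cases "N = 0")
  case True
  then show ?thesis by (simp add: restrict_def)
next
  case False
  let ?A' = "\<lambda>j. E -` A j \<inter> space \<mu>"
  have em: "emeasure \<mu> (?A' j) = ennreal \<kappa> * emeasure \<mu> (A j)" if "j < N" for j
  proof -
    have "emeasure \<mu> (?A' j) = emeasure (distr \<mu> \<mu> E) (A j)"
      using A[OF that] by (intro emeasure_distr[symmetric] E) auto
    then show ?thesis by (simp add: scale)
  qed
  have A': "?A' j \<in> fmeasurable \<mu>" if "j < N" for j
  proof (rule fmeasurableI)
    show "?A' j \<in> sets \<mu>" using A[OF that] by (intro measurable_sets[OF E]) auto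
    show "emeasure \<mu> (?A' j) < \<infinity>"
      using fmeasurableD2[OF A[OF that]] by (simp add: em[OF that] ennreal_mult_less_top less_top)
  qed
  have meas: "measure \<mu> (?A' j) = \<kappa> * measure \<mu> (A j)" if "j < N" for j
    using em[OF that] \<kappa> by (simp add: measure_def enn2real_mult)
  have disj': "disjoint_family_on ?A' {..<N}"
    using disj by (auto simp: disjoint_family_on_def)
  have "indep_vars (\<lambda>_. borel) (\<lambda>j. G (A j)) {..<N}"
    by (rule indep_noise[OF finite_lessThan _ disj]) (auto intro: A)
  then have ind: "indep_vars (\<lambda>_. borel) (\<lambda>j \<omega>. sqrt \<kappa> * G (A j) \<omega>) {..<N}"
    by (rule indep_vars_compose2) auto
  have rv: "(\<lambda>\<omega>. sqrt \<kappa> * G (A j) \<omega>) \<in> borel_measurable M" if "j \<in> {..<N}" for j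
    using that by (auto intro!: borel_measurable_times measurable_noise A)
  have ind': "indep_vars (\<lambda>_. borel) (\<lambda>j. G (?A' j)) {..<N}"
    by (rule indep_noise[OF finite_lessThan _ disj']) (auto intro: A')
  have "distr M (PiM {..<N} (\<lambda>_. borel)) (\<lambda>\<omega>. \<lambda>j\<in>{..<N}. G (?A' j) \<omega>) = (\<Pi>\<^sub>M j\<in>{..<N}. distr M borel (G (?A' j)))"
    using indep_vars_iff_distr_eq_PiM'[where I = "{..<N}" and M' = "\<lambda>_. borel" and X = "\<lambda>j. G (?A' j)"] ind' False
    by (auto intro: measurable_noise A')
  also have "\<dots> = (\<Pi>\<^sub>M j\<in>{..<N}. distr M borel (\<lambda>\<omega>. sqrt \<kappa> * G (A j) \<omega>))"
    using \<kappa> by (intro PiM_cong refl) (simp add: distr_noise A' distr_scaled_noise A meas)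
  also have "\<dots> = distr M (PiM {..<N} (\<lambda>_. borel)) (\<lambda>\<omega>. \<lambda>j\<in>{..<N}. sqrt \<kappa> * G (A j) \<omega>)"
    by (rule indep_vars_iff_distr_eq_PiM'[THEN iffD1, OF _ rv ind, symmetric]) (use False in auto)
  finally show ?thesis .
qed

lemma step_function_pullback:
  assumes E: "E \<in> \<mu> \<rightarrow>\<^sub>M \<mu>" and scale: "distr \<mu> \<mu> E = scale_measure (ennreal \<kappa>) \<mu>"
    and s: "step_function \<mu> s"
  shows "step_function \<mu> (\<lambda>x. s (E x))"
proof (rule Bochner_Integration.simple_bochner_integrable.intros)
  let ?S = "{x \<in> space \<mu>. s x \<noteq> 0}"
  show "simple_function \<mu> (\<lambda>x. s (E x))"
    using simple_function_comp[OF E step_functionD(1)[OF s]] by (simp add: comp_def)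
  have "?S = space \<mu> - {x \<in> space \<mu>. s x = 0}" by auto
  then have S: "?S \<in> sets \<mu>" using step_functionD(4)[OF s, of 0] by auto
  have "{x \<in> space \<mu>. s (E x) \<noteq> 0} = E -` ?S \<inter> space \<mu>"
    using measurable_space[OF E] by auto
  also have "emeasure \<mu> \<dots> = emeasure (distr \<mu> \<mu> E) ?S"
    by (rule emeasure_distr[symmetric, OF E S])
  also have "\<dots> = ennreal \<kappa> * emeasure \<mu> ?S" by (simp add: scale)
  finally show "emeasure \<mu> {x \<in> space \<mu>. s (E x) \<noteq> 0} \<noteq> \<infinity>"
    using step_functionD(2)[OF s] by (simp add: ennreal_mult_eq_top_iff)
qed

text \<open>
  The atoms of \<open>s \<circ> E\<close> are the preimages of the atoms of \<open>s\<close>, with the same values. So both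
  vectors are the image under the same linear map of the families compared in
  \<open>joint_law_noise_pullback\<close>.
\<close>
lemma joint_law_simple_pullback:
  assumes E: "E \<in> \<mu> \<rightarrow>\<^sub>M \<mu>" and scale: "distr \<mu> \<mu> E = scale_measure (ennreal \<kappa>) \<mu>" and \<kappa>: "0 \<le> \<kappa>"
    and I: "finite I" and s: "\<And>i. i \<in> I \<Longrightarrow> step_function \<mu> (s i)"
  shows "distr M (PiM I (\<lambda>_. borel)) (\<lambda>\<omega>. \<lambda>i\<in>I. simple_wiener_integral \<mu> G (\<lambda>x. s i (E x)) \<omega>) =
    distr M (PiM I (\<lambda>_. borel)) (\<lambda>\<omega>. \<lambda>i\<in>I. sqrt \<kappa> * simple_wiener_integral \<mu> G (s i) \<omega>)"
proof -
  let ?I = "simple_wiener_integral \<mu> G" and ?B = "PiM I (\<lambda>_. borel :: real measure)"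
  have s': "step_function \<mu> (\<lambda>x. s i (E x))" if "i \<in> I" for i
    by (rule step_function_pullback[OF E scale s[OF that]])
  obtain N v where jv: "joint_values \<mu> I s N v"
    using joint_values_exist[OF I, of s \<mu>] step_functionD(3)[OF s] by auto
  have jv': "joint_values \<mu> I (\<lambda>i x. s i (E x)) N v"
    using measurable_space[OF E] by (intro joint_values_compose[OF jv]) blast
  let ?A = "\<lambda>j. atom \<mu> I s (v j)" and ?A' = "\<lambda>j. atom \<mu> I (\<lambda>i x. s i (E x)) (v j)"
  have A': "?A' j = E -` ?A j \<inter> space \<mu>" for j
    using measurable_space[OF E] by (auto simp: atom_def)
  have fA: "?A j \<in> fmeasurable \<mu>" if "j < N" for j by (rule atom_fmeasurable[OF jv I s that])
  have fA': "?A' j \<in> fmeasurable \<mu>" if "j < N" for j by (rule atom_fmeasurable[OF jv' I s' that])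
  define L where "L w = (\<lambda>i\<in>I. \<Sum>j<N. v j i * w j)" for w :: "nat \<Rightarrow> real"
  have L: "L \<in> PiM {..<N} (\<lambda>_. borel) \<rightarrow>\<^sub>M ?B" unfolding L_def[abs_def] by measurable
  have [measurable]: "G (?A j) \<in> borel_measurable M" "G (?A' j) \<in> borel_measurable M" if "j \<in> {..<N}" for j
    using measurable_noise fA fA' that by auto
  have [measurable]: "?I (s i) \<in> borel_measurable M" "?I (\<lambda>x. s i (E x)) \<in> borel_measurable M" if "i \<in> I" for i
    using measurable_simple_wiener_integral s s' that by auto
  have "distr M ?B (\<lambda>\<omega>. \<lambda>i\<in>I. ?I (\<lambda>x. s i (E x)) \<omega>) = distr M ?B (\<lambda>\<omega>. L (\<lambda>j\<in>{..<N}. G (?A' j) \<omega>))"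
  proof (rule distr_cong_AE[OF refl refl])
    have "AE \<omega> in M. \<forall>i\<in>I. ?I (\<lambda>x. s i (E x)) \<omega> = (\<Sum>j<N. v j i * G (?A' j) \<omega>)"
      by (intro AE_finite_allI I AE_simple_wiener_integral_eq[OF jv' I s'])
    then show "AE \<omega> in M. (\<lambda>i\<in>I. ?I (\<lambda>x. s i (E x)) \<omega>) = L (\<lambda>j\<in>{..<N}. G (?A' j) \<omega>)"
      by eventually_elim (auto simp: L_def fun_eq_iff restrict_def)
    show "(\<lambda>\<omega>. \<lambda>i\<in>I. ?I (\<lambda>x. s i (E x)) \<omega>) \<in> M \<rightarrow>\<^sub>M ?B" by measurable
    show "(\<lambda>\<omega>. L (\<lambda>j\<in>{..<N}. G (?A' j) \<omega>)) \<in> M \<rightarrow>\<^sub>M ?B"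
      by (rule measurable_compose[OF _ L]) measurable
  qed
  also have "\<dots> = distr (distr M (PiM {..<N} (\<lambda>_. borel)) (\<lambda>\<omega>. \<lambda>j\<in>{..<N}. G (?A' j) \<omega>)) ?B L"
    by (subst distr_distr[OF L]) (measurable, simp add: comp_def)
  also have "distr M (PiM {..<N} (\<lambda>_. borel)) (\<lambda>\<omega>. \<lambda>j\<in>{..<N}. G (?A' j) \<omega>) =
      distr M (PiM {..<N} (\<lambda>_. borel)) (\<lambda>\<omega>. \<lambda>j\<in>{..<N}. sqrt \<kappa> * G (?A j) \<omega>)"
    unfolding A' by (rule joint_law_noise_pullback[OF E scale \<kappa> fA disjoint_atoms[OF jv]])
  also have "distr \<dots> ?B L = distr M ?B (\<lambda>\<omega>. L (\<lambda>j\<in>{..<N}. sqrt \<kappa> * G (?A j) \<omega>))"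
    by (subst distr_distr[OF L]) (measurable, simp add: comp_def)
  also have "\<dots> = distr M ?B (\<lambda>\<omega>. \<lambda>i\<in>I. sqrt \<kappa> * ?I (s i) \<omega>)"
  proof (rule distr_cong_AE[OF refl refl])
    have "AE \<omega> in M. \<forall>i\<in>I. ?I (s i) \<omega> = (\<Sum>j<N. v j i * G (?A j) \<omega>)"
      by (intro AE_finite_allI I AE_simple_wiener_integral_eq[OF jv I s])
    then show "AE \<omega> in M. L (\<lambda>j\<in>{..<N}. sqrt \<kappa> * G (?A j) \<omega>) = (\<lambda>i\<in>I. sqrt \<kappa> * ?I (s i) \<omega>)"
      by eventually_elim (auto simp: L_def fun_eq_iff restrict_def sum_distrib_left mult_ac)
    show "(\<lambda>\<omega>. \<lambda>i\<in>I. sqrt \<kappa> * ?I (s i) \<omega>) \<in> M \<rightarrow>\<^sub>M ?B" by measurable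
    show "(\<lambda>\<omega>. L (\<lambda>j\<in>{..<N}. sqrt \<kappa> * G (?A j) \<omega>)) \<in> M \<rightarrow>\<^sub>M ?B"
      by (rule measurable_compose[OF _ L]) measurable
  qed
  finally show ?thesis .
qed

text \<open>
  If \<open>s\<^sub>n\<close> approximates \<open>f\<close>, then \<open>s\<^sub>n \<circ> E\<close> approximates \<open>f \<circ> E\<close>, since squared \<open>L\<^sup>2\<close>-distances are
  multiplied by \<open>\<kappa>\<close>. Thus the equality of joint laws passes from step functions to the integrals.
  It is the only fact about laws that self-similarity requires, and it does not involve
  the covariance structure explicitly.
\<close>
theorem joint_law_wiener_integral_pullback:
  assumes E: "E \<in> \<mu> \<rightarrow>\<^sub>M \<mu>" and scale: "distr \<mu> \<mu> E = scale_measure (ennreal \<kappa>) \<mu>" and \<kappa>: "0 \<le> \<kappa>"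
    and I: "finite I" and f: "\<And>i. i \<in> I \<Longrightarrow> has_wiener_integral M \<mu> G (f i) (Z i)"
    and fE: "\<And>i. i \<in> I \<Longrightarrow> has_wiener_integral M \<mu> G (\<lambda>x. f i (E x)) (Y i)"
  shows "distr M (PiM I (\<lambda>_. borel)) (\<lambda>\<omega>. \<lambda>i\<in>I. Y i \<omega>) =
    distr M (PiM I (\<lambda>_. borel)) (\<lambda>\<omega>. \<lambda>i\<in>I. sqrt \<kappa> * Z i \<omega>)"
proof -
  let ?I = "simple_wiener_integral \<mu> G"
  have "\<forall>i\<in>I. \<exists>s. (\<forall>n. step_function \<mu> (s n)) \<and>
       (\<lambda>n. \<integral>\<^sup>+ x. ennreal ((s n x - f i x)\<^sup>2) \<partial>\<mu>) \<longlonglongrightarrow> 0 \<and>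
       (\<lambda>n. \<integral>\<^sup>+ \<omega>. ennreal ((?I (s n) \<omega> - Z i \<omega>)\<^sup>2) \<partial>M) \<longlonglongrightarrow> 0"
    using f unfolding has_wiener_integral_def by blast
  from bchoice[OF this] obtain s where s: "\<And>i n. i \<in> I \<Longrightarrow> step_function \<mu> (s i n)"
    and sf: "\<And>i. i \<in> I \<Longrightarrow> (\<lambda>n. \<integral>\<^sup>+ x. ennreal ((s i n x - f i x)\<^sup>2) \<partial>\<mu>) \<longlonglongrightarrow> 0"
    and sZ: "\<And>i. i \<in> I \<Longrightarrow> (\<lambda>n. \<integral>\<^sup>+ \<omega>. ennreal ((?I (s i n) \<omega> - Z i \<omega>)\<^sup>2) \<partial>M) \<longlonglongrightarrow> 0"
    by auto
  have [measurable]: "f i \<in> borel_measurable \<mu>" "Z i \<in> borel_measurable M" "Y i \<in> borel_measurable M" if "i \<in> I" for i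
    using f[OF that] fE[OF that] by (auto simp: has_wiener_integral_def)
  have [measurable]: "s i n \<in> borel_measurable \<mu>" if "i \<in> I" for i n
    using step_functionD(1)[OF s[OF that]] by (rule borel_measurable_simple_function)
  have sE: "step_function \<mu> (\<lambda>x. s i n (E x))" if "i \<in> I" for i n
    by (rule step_function_pullback[OF E scale s[OF that]])
  show ?thesis
  proof (rule joint_law_limit_eq[OF I, where U = "\<lambda>n i. ?I (\<lambda>x. s i n (E x))" and U' = "\<lambda>n i \<omega>. sqrt \<kappa> * ?I (s i n) \<omega>"])
    show "distr M (PiM I (\<lambda>_. borel)) (\<lambda>\<omega>. \<lambda>i\<in>I. ?I (\<lambda>x. s i n (E x)) \<omega>) =
        distr M (PiM I (\<lambda>_. borel)) (\<lambda>\<omega>. \<lambda>i\<in>I. sqrt \<kappa> * ?I (s i n) \<omega>)" for n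
      by (rule joint_law_simple_pullback[OF E scale \<kappa> I s])
    fix i assume i: "i \<in> I"
    note [measurable] = measurable_simple_wiener_integral[OF s[OF i]] measurable_simple_wiener_integral[OF sE[OF i]]
    show "?I (\<lambda>x. s i n (E x)) \<in> borel_measurable M" "(\<lambda>\<omega>. sqrt \<kappa> * ?I (s i n) \<omega>) \<in> borel_measurable M"
      "Y i \<in> borel_measurable M" "(\<lambda>\<omega>. sqrt \<kappa> * Z i \<omega>) \<in> borel_measurable M" for n
      using i by measurable
    have "(sqrt \<kappa> * a - sqrt \<kappa> * b)\<^sup>2 = \<kappa> * (a - b)\<^sup>2" for a b
      using \<kappa> by (simp add: power_mult_distrib flip: right_diff_distrib)
    then have sq: "ennreal ((sqrt \<kappa> * a - sqrt \<kappa> * b)\<^sup>2) = ennreal \<kappa> * ennreal ((a - b)\<^sup>2)" for a b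
      using \<kappa> by (simp add: ennreal_mult)
    show "(\<lambda>n. \<integral>\<^sup>+ \<omega>. ennreal ((sqrt \<kappa> * ?I (s i n) \<omega> - sqrt \<kappa> * Z i \<omega>)\<^sup>2) \<partial>M) \<longlonglongrightarrow> 0"
      using ennreal_tendsto_cmult[OF _ sZ[OF i], of "ennreal \<kappa>"] i by (simp add: sq nn_integral_cmult)
    have "(\<lambda>n. ennreal \<kappa> * sqdist \<mu> (s i n) (f i)) \<longlonglongrightarrow> 0"
      using ennreal_tendsto_cmult[OF _ sf[OF i], of "ennreal \<kappa>"] by simp
    moreover have "(\<integral>\<^sup>+ x. ennreal ((s i n (E x) - f i (E x))\<^sup>2) \<partial>\<mu>) = ennreal \<kappa> * (\<integral>\<^sup>+ x. ennreal ((s i n x - f i x)\<^sup>2) \<partial>\<mu>)" for n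
      using i by (intro nn_integral_scale_distr[OF scale E]) measurable
    ultimately have L2: "(\<lambda>n. \<integral>\<^sup>+ x. ennreal ((s i n (E x) - f i (E x))\<^sup>2) \<partial>\<mu>) \<longlonglongrightarrow> 0" by simp
    show "(\<lambda>n. \<integral>\<^sup>+ \<omega>. ennreal ((?I (\<lambda>x. s i n (E x)) \<omega> - Y i \<omega>)\<^sup>2) \<partial>M) \<longlonglongrightarrow> 0"
    proof (rule order_tendstoI)
      fix a :: ennreal assume "0 < a"
      then obtain b where b: "0 < b" "b < a" using dense by blast
      define e where "e = enn2real b"
      have e: "0 < e" "ennreal e < a"
        using b less_le_trans[OF b(2) top_greatest] by (simp_all add: e_def enn2real_positive_iff)
      have "\<forall>\<^sub>F n in sequentially. (\<integral>\<^sup>+ x. ennreal ((s i n (E x) - f i (E x))\<^sup>2) \<partial>\<mu>) < ennreal (e / 6)"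
        using e by (intro order_tendstoD(2)[OF L2]) simp
      then show "\<forall>\<^sub>F n in sequentially. sqdist M (?I (\<lambda>x. s i n (E x))) (Y i) < a"
      proof eventually_elim
        case (elim n)
        have "(\<integral>\<^sup>+ \<omega>. ennreal ((?I (\<lambda>x. s i n (E x)) \<omega> - Y i \<omega>) ^ (2 * 1)) \<partial>M) \<le> ennreal (normal_moment 1 * (3 * (e / 6)) ^ 1)"
          using e elim by (intro wiener_integral_diff_moment[OF has_wiener_integral_simple[OF sE[OF i]] fE[OF i]]) (auto intro: less_imp_le)
        also have "\<dots> < ennreal e" using e by (simp add: normal_moment_def ennreal_lessI)
        also note e(2)
        finally show ?case by simp
      qed
    qed simp
  qed
qed

end

section \<open>The limiting processes\<close>

lemma distr_scale_measure:
  assumes E: "E \<in> P \<rightarrow>\<^sub>M P"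
  shows "distr (scale_measure b P) (scale_measure b P) E = scale_measure b (distr P P E)"
proof (rule measure_eqI)
  have E': "E \<in> scale_measure b P \<rightarrow>\<^sub>M scale_measure b P"
    using E by (simp cong: measurable_cong_sets)
  fix A assume "A \<in> sets (distr (scale_measure b P) (scale_measure b P) E)"
  then have A: "A \<in> sets P" by simp
  then show "emeasure (distr (scale_measure b P) (scale_measure b P) E) A = emeasure (scale_measure b (distr P P E)) A"
    by (simp add: emeasure_distr[OF E'] emeasure_distr[OF E] space_scale_measure)
qed simp

lemma has_wiener_integral_cong:
  assumes f: "has_wiener_integral M \<mu> G f Y" and eq: "\<And>x. x \<in> space \<mu> \<Longrightarrow> f x = g x"
  shows "has_wiener_integral M \<mu> G g Y"
proof -
  have "sqdist \<mu> s g = sqdist \<mu> s f" for s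
    by (rule nn_integral_cong) (simp add: eq)
  moreover have "g \<in> borel_measurable \<mu> \<longleftrightarrow> f \<in> borel_measurable \<mu>"
    by (rule measurable_cong) (simp add: eq)
  ultimately show ?thesis using f unfolding has_wiener_integral_def by simp
qed

context connected_pattern
begin

lemma limit_process_eq_wiener_integral:
  fixes G :: "nat \<Rightarrow> (nat \<Rightarrow> 'a::euclidean_space) set \<Rightarrow> 'w \<Rightarrow> real"
  assumes l: "l \<in> {2..k}"
  shows "limit_process M \<Gamma> k \<alpha> G1 G l t = wiener_integral M (noise_intensity \<alpha> k l) (G l) (partial_kernel l t)"
proof (cases "l = k")
  case True
  have point: "(\<integral>z. F z \<partial>lebesgue_on_positions {}) = F (\<lambda>_. undefined)" for F :: "(nat \<Rightarrow> 'a) \<Rightarrow> real"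
    by (simp add: PiM_empty lebesgue_integral_count_space_finite)
  have empty: "{Suc k..k} = {}" by simp
  have "partial_kernel k t = (\<lambda>y :: nat \<Rightarrow> 'a. pinned_ind t y)"
  proof
    fix y :: "nat \<Rightarrow> 'a"
    show "partial_kernel k t y = pinned_ind t y"
      unfolding partial_kernel_def empty point by (rule subgraph_ind_cong) (auto simp: merge_def)
  qed
  moreover have "l \<noteq> 1" using l by simp
  ultimately show ?thesis
    unfolding limit_process_def if_not_P[OF \<open>l \<noteq> 1\<close>] if_P[OF True] by (simp only: True)
next
  case False
  then show ?thesis using l by (simp add: limit_process_def partial_kernel_def[abs_def])
qed

lemma limit_process_1:
  fixes G :: "nat \<Rightarrow> (nat \<Rightarrow> 'a::euclidean_space) set \<Rightarrow> 'w \<Rightarrow> real"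
  shows "limit_process M \<Gamma> k \<alpha> G1 G 1 t = (\<lambda>\<omega>. partial_kernel 1 t (\<lambda>_. undefined :: 'a) * G1 \<omega>)"
proof -
  have "(\<integral>z. pinned_ind t (z :: nat \<Rightarrow> 'a) \<partial>lebesgue_on_positions {2..k}) = partial_kernel 1 t (\<lambda>_. undefined :: 'a)"
  proof -
    have "{Suc 1..k} = {2..k}" by (simp add: numeral_2_eq_2)
    show ?thesis
      unfolding partial_kernel_def \<open>{Suc 1..k} = {2..k}\<close>
      by (intro Bochner_Integration.integral_cong subgraph_ind_cong refl) (auto simp: merge_def)
  qed
  then show ?thesis unfolding limit_process_def if_P[OF refl] by (rule arg_cong)
qed

lemma undefined_in_space: "(\<lambda>_. undefined) \<in> space (lebesgue_on_positions {2..1::nat})"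
  by (simp add: space_PiM)

lemma nn_integral_noise_intensity:
  assumes "f \<in> borel_measurable (lebesgue_on_positions {2..l} :: (nat \<Rightarrow> 'a::euclidean_space) measure)"
  shows "(\<integral>\<^sup>+x. f x \<partial>noise_intensity \<alpha> k l) = ennreal (noise_const TYPE('a) \<alpha> k l) * (\<integral>\<^sup>+x. f x \<partial>lebesgue_on_positions {2..l})"
  unfolding noise_intensity_def using assms by (rule nn_integral_scale_measure)

lemma measurable_noise_intensity:
  "borel_measurable (noise_intensity \<alpha> k l) = borel_measurable (lebesgue_on_positions {2..l})"
  unfolding noise_intensity_def by (rule measurable_cong_sets) simp_all

lemma has_wiener_integral_limit_process:
  fixes G :: "nat \<Rightarrow> (nat \<Rightarrow> 'a::euclidean_space) set \<Rightarrow> 'w \<Rightarrow> real"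
  assumes M: "prob_space M" and noise: "gaussian_noise M (noise_intensity \<alpha> k l) (G l)"
    and l: "l \<in> {2..k}" and t: "0 \<le> t"
  shows "has_wiener_integral M (noise_intensity \<alpha> k l) (G l) (partial_kernel l t) (limit_process M \<Gamma> k \<alpha> G1 G l t)"
proof -
  interpret white_noise M "noise_intensity \<alpha> k l" "G l"
    using M noise by (simp add: white_noise_def white_noise_axioms_def)
  have l1: "l \<in> {1..k}" and k: "2 \<le> k" using l by auto
  have meas [measurable]: "partial_kernel l t \<in> borel_measurable (lebesgue_on_positions {2..l} :: (nat \<Rightarrow> 'a) measure)"
    by (rule measurable_partial_kernel[OF l1])
  show ?thesis
    unfolding limit_process_eq_wiener_integral[OF l]
  proof (rule has_wiener_integral_wiener_integral)
    show "partial_kernel l t \<in> borel_measurable (noise_intensity \<alpha> k l :: (nat \<Rightarrow> 'a) measure)"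
      unfolding measurable_noise_intensity by (rule meas)
    have "(\<integral>\<^sup>+x. ennreal ((partial_kernel l t x)\<^sup>2) \<partial>(noise_intensity \<alpha> k l :: (nat \<Rightarrow> 'a) measure)) =
        ennreal (noise_const TYPE('a) \<alpha> k l) * (\<integral>\<^sup>+x. ennreal ((partial_kernel l t x)\<^sup>2) \<partial>(lebesgue_on_positions {2..l} :: (nat \<Rightarrow> 'a) measure))"
      by (rule nn_integral_noise_intensity) measurable
    then show "(\<integral>\<^sup>+x. ennreal ((partial_kernel l t x)\<^sup>2) \<partial>(noise_intensity \<alpha> k l :: (nat \<Rightarrow> 'a) measure)) < \<infinity>"
      using nn_integral_partial_kernel_square_finite[OF l1 t k, where 'a = 'a] by (simp add: ennreal_mult_less_top)
  qed
qed

text \<open>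
  The noise \<open>G\<^sub>l\<close> has the \<open>l - 1\<close> variables \<open>y\<^sub>2, \<dots>, y\<^sub>l\<close>.
\<close>
lemma distr_noise_intensity_dilate:
  fixes \<alpha> :: real and l :: nat
  assumes c: "0 < c"
  defines "\<mu> \<equiv> (noise_intensity \<alpha> k l :: (nat \<Rightarrow> 'a::euclidean_space) measure)"
  shows "dilate (1 / c) {2..l} \<in> \<mu> \<rightarrow>\<^sub>M \<mu>"
    "distr \<mu> \<mu> (dilate (1 / c) {2..l}) = scale_measure (ennreal (c ^ (DIM('a) * (l - 1)))) \<mu>"
proof -
  have m: "dilate (1 / c) {2..l} \<in> lebesgue_on_positions {2..l} \<rightarrow>\<^sub>M (lebesgue_on_positions {2..l} :: (nat \<Rightarrow> 'a) measure)"
    by (rule measurable_dilate)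
  then show "dilate (1 / c) {2..l} \<in> \<mu> \<rightarrow>\<^sub>M \<mu>"
    unfolding \<mu>_def noise_intensity_def by (simp cong: measurable_cong_sets)
  show "distr \<mu> \<mu> (dilate (1 / c) {2..l}) = scale_measure (ennreal (c ^ (DIM('a) * (l - 1)))) \<mu>"
    unfolding \<mu>_def noise_intensity_def distr_scale_measure[OF m]
    using distr_PiM_dilate[OF c, of "{2..l}", where 'a = 'a] by (simp add: mult.commute)
qed

text \<open>
  By the scaling of the kernel, \<open>V\<^sub>l(c t)\<close> is the integral of \<open>c powr (d (k - l))\<close> times the kernel of
  \<open>V\<^sub>l(t)\<close> composed with the dilation by \<open>1 / c\<close>. In law this dilation contributes the square root of
  its Jacobian \<open>c powr (d (l - 1))\<close>. The exponents add up to
  \<open>d (k - l) + d (l - 1) / 2 = d (2 k - l - 1) / 2\<close>.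
\<close>
lemma self_similar_limit_process:
  fixes G :: "nat \<Rightarrow> (nat \<Rightarrow> 'a::euclidean_space) set \<Rightarrow> 'w \<Rightarrow> real"
  assumes M: "prob_space M" and noise: "gaussian_noise M (noise_intensity \<alpha> k l) (G l)"
    and l: "l \<in> {2..k}"
  shows "self_similar M (\<lambda>t. limit_process M \<Gamma> k \<alpha> G1 G l t) (real DIM('a) * (2 * real k - real l - 1) / 2)"
proof -
  interpret white_noise M "noise_intensity \<alpha> k l" "G l"
    using M noise by (simp add: white_noise_def white_noise_axioms_def)
  let ?X = "limit_process M \<Gamma> k \<alpha> G1 G l" and ?d = "DIM('a)"
  note X = has_wiener_integral_limit_process[where G = G and \<alpha> = \<alpha> and l = l and ?G1.0 = G1, OF M noise l]
  have l1: "l \<in> {1..k}" using l by auto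
  show ?thesis
    unfolding self_similar_def
  proof (intro conjI allI impI)
    show "?X t \<in> borel_measurable M" if "0 \<le> t" for t
      using X[OF that] by (simp add: has_wiener_integral_def)
    fix c :: real and q :: nat and t :: "nat \<Rightarrow> real"
    assume c: "0 < c" and t: "\<forall>i\<in>{1..q}. 0 \<le> t i"
    define a where "a = c ^ (?d * (k - l))"
    let ?E = "dilate (1 / c) {2..l} :: (nat \<Rightarrow> 'a) \<Rightarrow> _"
    have a: "a \<noteq> 0" using c by (simp add: a_def)
    have factor: "sqrt (c ^ (?d * (l - 1))) * (a * x) = c powr (real ?d * (2 * real k - real l - 1) / 2) * x" for x
    proof -
      have "sqrt (c ^ (?d * (l - 1))) = c powr (real (?d * (l - 1)) / 2)"
        using c by (simp add: powr_half_sqrt[symmetric] powr_powr flip: powr_realpow)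
      moreover have "a = c powr real (?d * (k - l))"
        by (simp only: a_def powr_realpow[OF c])
      moreover have "real (?d * (l - 1)) / 2 + real (?d * (k - l)) = real ?d * (2 * real k - real l - 1) / 2"
        using l by (simp add: of_nat_diff field_simps)
      ultimately show ?thesis by (simp only: mult.assoc[symmetric] powr_add[symmetric])
    qed
    have "distr M (PiM {1..q} (\<lambda>_. borel)) (\<lambda>\<omega>. \<lambda>i\<in>{1..q}. ?X (c * t i) \<omega>) =
        distr M (PiM {1..q} (\<lambda>_. borel)) (\<lambda>\<omega>. \<lambda>i\<in>{1..q}. sqrt (c ^ (?d * (l - 1))) * (a * ?X (t i) \<omega>))"
    proof (rule joint_law_wiener_integral_pullback[OF distr_noise_intensity_dilate[OF c]])
      fix i assume i: "i \<in> {1..q}"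
      show "has_wiener_integral M (noise_intensity \<alpha> k l) (G l) (\<lambda>x. a * partial_kernel l (t i) x) (\<lambda>\<omega>. a * ?X (t i) \<omega>)"
        using t i by (intro has_wiener_integral_cmult[OF a] X) auto
      show "has_wiener_integral M (noise_intensity \<alpha> k l) (G l) (\<lambda>x. a * partial_kernel l (t i) (?E x)) (?X (c * t i))"
      proof (rule has_wiener_integral_cong[OF X])
        show "0 \<le> c * t i" using c t i by simp
        show "partial_kernel l (c * t i) y = a * partial_kernel l (t i) (?E y)" if "y \<in> space (noise_intensity \<alpha> k l)" for y
          using that partial_kernel_scale[OF l1 c] by (simp add: a_def noise_intensity_def space_scale_measure)
      qed
    qed (use c in auto)
    then show "distr M (PiM {1..q} (\<lambda>_. borel)) (\<lambda>\<omega>. \<lambda>i\<in>{1..q}. ?X (c * t i) \<omega>) =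
        distr M (PiM {1..q} (\<lambda>_. borel))
          (\<lambda>\<omega>. \<lambda>i\<in>{1..q}. c powr (real ?d * (2 * real k - real l - 1) / 2) * ?X (t i) \<omega>)"
      by (simp only: factor)
  qed
qed

text \<open>
  The squared distance of the kernels is of the order \<open>\<bar>t - s\<bar>\<close>, and the moment of order \<open>2 m\<close> of a
  difference of Wiener integrals is at most of the order of its \<open>m\<close>-th power.
\<close>
lemma limit_process_increment_moment:
  fixes G :: "nat \<Rightarrow> (nat \<Rightarrow> 'a::euclidean_space) set \<Rightarrow> 'w \<Rightarrow> real"
  assumes M: "prob_space M" and noise: "gaussian_noise M (noise_intensity \<alpha> k l) (G l)"
    and l: "l \<in> {2..k}" and T: "0 < T"
  obtains K where "0 \<le> K" "\<And>m s t. s \<in> {0..T} \<Longrightarrow> t \<in> {0..T} \<Longrightarrow>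
    (\<integral>\<^sup>+\<omega>. ennreal ((limit_process M \<Gamma> k \<alpha> G1 G l t \<omega> - limit_process M \<Gamma> k \<alpha> G1 G l s \<omega>) ^ (2 * m)) \<partial>M)
      \<le> ennreal (normal_moment m * K ^ m * \<bar>t - s\<bar> ^ m)"
proof -
  interpret white_noise M "noise_intensity \<alpha> k l" "G l"
    using M noise by (simp add: white_noise_def white_noise_axioms_def)
  let ?X = "limit_process M \<Gamma> k \<alpha> G1 G l"
  have l1: "l \<in> {1..k}" using l by auto
  note X = has_wiener_integral_limit_process[where G = G and \<alpha> = \<alpha> and l = l and ?G1.0 = G1, OF M noise l]
  \<comment> \<open>\<open>ennreal\<close> maps negative numbers to 0\<close>
  define B where "B = max 0 (noise_const TYPE('a) \<alpha> k l)"
  have B: "0 \<le> B" "ennreal (noise_const TYPE('a) \<alpha> k l) = ennreal B"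
    by (auto simp: B_def max_def ennreal_neg)
  define V where "V = box_volume TYPE('a) T ^ (k - l) * increment_const TYPE('a) T"
  have V: "0 \<le> V" using T by (simp add: V_def box_volume_nonneg increment_const_nonneg)
  \<comment> \<open>the summand 1 makes the bound positive, as \<open>wiener_integral_diff_moment\<close> requires\<close>
  define K where "K = B * V + 1"
  have K: "0 < K" using B V by (simp add: K_def add_nonneg_pos)
  have L2: "sqdist (noise_intensity \<alpha> k l :: (nat \<Rightarrow> 'a) measure) (partial_kernel l t) (partial_kernel l s) \<le> ennreal (K * (t - s))"
    if "0 \<le> s" "s \<le> t" "t \<le> T" for s t
  proof -
    have [measurable]: "partial_kernel l t \<in> borel_measurable (lebesgue_on_positions {2..l} :: (nat \<Rightarrow> 'a) measure)" for t
      by (rule measurable_partial_kernel[OF l1])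
    have "sqdist (noise_intensity \<alpha> k l :: (nat \<Rightarrow> 'a) measure) (partial_kernel l t) (partial_kernel l s) =
        ennreal B * sqdist (lebesgue_on_positions {2..l} :: (nat \<Rightarrow> 'a) measure) (partial_kernel l t) (partial_kernel l s)"
      unfolding B(2)[symmetric] by (rule nn_integral_noise_intensity) measurable
    also have "\<dots> \<le> ennreal B * ennreal (V * (t - s))"
      unfolding V_def by (intro mult_left_mono nn_integral_partial_kernel_diff_square_le[OF l1 that]) simp
    also have "\<dots> = ennreal (B * V * (t - s))"
      using B V that by (simp add: ennreal_mult[symmetric] mult.assoc)
    also have "\<dots> \<le> ennreal (K * (t - s))"
      using that by (intro ennreal_leI mult_right_mono) (simp_all add: K_def)
    finally show ?thesis .
  qed
  show thesis
  proof (rule that[of "3 * K"])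
    fix m and s t :: real assume st: "s \<in> {0..T}" "t \<in> {0..T}"
    show "(\<integral>\<^sup>+\<omega>. ennreal ((?X t \<omega> - ?X s \<omega>) ^ (2 * m)) \<partial>M) \<le> ennreal (normal_moment m * (3 * K) ^ m * \<bar>t - s\<bar> ^ m)"
    proof (cases "s = t")
      case True
      then show ?thesis by (cases m) (simp_all add: emeasure_space_1 normal_moment_0_1)
    next
      case False
      have "sqdist (noise_intensity \<alpha> k l :: (nat \<Rightarrow> 'a) measure) (partial_kernel l t) (partial_kernel l s) \<le> ennreal (K * \<bar>t - s\<bar>)"
      proof (cases "s \<le> t")
        case True
        then show ?thesis using L2[of s t] st by simp
      next
        case False
        then show ?thesis using L2[of t s] st by (simp add: power2_commute[of "partial_kernel l t _"])
      qed
      then have "(\<integral>\<^sup>+\<omega>. ennreal ((?X t \<omega> - ?X s \<omega>) ^ (2 * m)) \<partial>M) \<le> ennreal (normal_moment m * (3 * (K * \<bar>t - s\<bar>)) ^ m)"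
        using st K False by (intro wiener_integral_diff_moment[OF X X]) auto
      then show ?thesis by (simp add: power_mult_distrib mult_ac)
    qed
  qed (use K in simp)
qed

lemma hoelder_modification_limit_process:
  fixes G :: "nat \<Rightarrow> (nat \<Rightarrow> 'a::euclidean_space) set \<Rightarrow> 'w \<Rightarrow> real"
  assumes M: "prob_space M" and noise: "gaussian_noise M (noise_intensity \<alpha> k l) (G l)"
    and l: "l \<in> {2..k}" and T: "0 < T"
  shows "\<exists>Y. modification_on M {0..T} (\<lambda>t. limit_process M \<Gamma> k \<alpha> G1 G l t) Y \<and>
    (\<forall>\<omega>\<in>space M. \<forall>\<gamma>\<in>{0..<1/2}. hoelder_on \<gamma> {0..T} (\<lambda>t. Y t \<omega>))"
proof -
  obtain K where K: "0 \<le> K" "\<And>m s t. s \<in> {0..T} \<Longrightarrow> t \<in> {0..T} \<Longrightarrow>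
    (\<integral>\<^sup>+\<omega>. ennreal ((limit_process M \<Gamma> k \<alpha> G1 G l t \<omega> - limit_process M \<Gamma> k \<alpha> G1 G l s \<omega>) ^ (2 * m)) \<partial>M)
      \<le> ennreal (normal_moment m * K ^ m * \<bar>t - s\<bar> ^ m)"
    using limit_process_increment_moment[where G = G and \<alpha> = \<alpha> and l = l and ?G1.0 = G1, OF M noise l T] by blast
  show ?thesis
  proof (rule kolmogorov_chentsov[OF T _ K(2)])
    show "limit_process M \<Gamma> k \<alpha> G1 G l t \<in> borel_measurable M" if "t \<in> {0..T}" for t
      using has_wiener_integral_limit_process[where G = G and \<alpha> = \<alpha> and l = l and ?G1.0 = G1, OF M noise l, of t] that by (simp add: has_wiener_integral_def)
  qed (use K(1) in \<open>simp_all add: normal_moment_nonneg\<close>)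
qed

text \<open>
  For \<open>l = 1\<close> the equality in law is an equality of functions: the random factor \<open>G\<^sub>1\<close> is not
  affected by scaling.
\<close>
lemma self_similar_limit_process_1:
  fixes G :: "nat \<Rightarrow> (nat \<Rightarrow> 'a::euclidean_space) set \<Rightarrow> 'w \<Rightarrow> real"
  assumes [measurable]: "G1 \<in> borel_measurable M" and k: "1 \<le> k"
  shows "self_similar M (\<lambda>t. limit_process M \<Gamma> k \<alpha> G1 G 1 t) (real DIM('a) * (2 * real k - real 1 - 1) / 2)"
proof -
  let ?b = "\<lambda>t. partial_kernel 1 t (\<lambda>_. undefined :: 'a)"
  have scale: "?b (c * t) = c powr (real DIM('a) * (2 * real k - real 1 - 1) / 2) * ?b t" if c: "0 < c" for c t
  proof -
    have "?b (c * t) = c ^ (DIM('a) * (k - 1)) * partial_kernel 1 t (dilate (1 / c) {2..1} (\<lambda>_. undefined :: 'a))"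
      using k by (intro partial_kernel_scale c undefined_in_space) simp
    also have "dilate (1 / c) {2..1::nat} (\<lambda>_. undefined :: 'a) = (\<lambda>_. undefined)"
      by (simp add: dilate_def restrict_def)
    also have "c ^ (DIM('a) * (k - 1)) = c powr (real DIM('a) * (2 * real k - real 1 - 1) / 2)"
    proof -
      have "real (DIM('a) * (k - 1)) = real DIM('a) * (2 * real k - real 1 - 1) / 2"
        using k by (simp add: of_nat_diff field_simps)
      then show ?thesis by (simp only: powr_realpow[OF c, symmetric])
    qed
    finally show ?thesis .
  qed
  show ?thesis
    unfolding self_similar_def limit_process_1
  proof (intro conjI allI impI)
    fix c :: real and q :: nat and t :: "nat \<Rightarrow> real"
    assume c: "0 < c"
    show "distr M (PiM {1..q} (\<lambda>_. borel)) (\<lambda>\<omega>. \<lambda>i\<in>{1..q}. ?b (c * t i) * G1 \<omega>) =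
        distr M (PiM {1..q} (\<lambda>_. borel)) (\<lambda>\<omega>. \<lambda>i\<in>{1..q}.
          c powr (real DIM('a) * (2 * real k - real 1 - 1) / 2) * (?b (t i) * G1 \<omega>))"
      by (simp only: scale[OF c] mult.assoc)
  qed measurable
qed

text \<open>
  The paths are Lipschitz continuous, because the deterministic factor is.
\<close>
lemma hoelder_limit_process_1:
  fixes G :: "nat \<Rightarrow> (nat \<Rightarrow> 'a::euclidean_space) set \<Rightarrow> 'w \<Rightarrow> real"
  assumes k: "1 \<le> k" and T: "0 < T" and \<gamma>: "\<gamma> \<le> 1"
  shows "hoelder_on \<gamma> {0..T} (\<lambda>t. limit_process M \<Gamma> k \<alpha> G1 G 1 t \<omega>)"
proof -
  let ?b = "\<lambda>t. partial_kernel 1 t (\<lambda>_. undefined :: 'a)" and ?C = "increment_const TYPE('a) T"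
  have le: "\<bar>?b t - ?b s\<bar> \<le> ?C * (t - s)" if "0 \<le> s" "s \<le> t" "t \<le> T" for s t
  proof -
    have "ennreal \<bar>?b t - ?b s\<bar> \<le> ennreal (?C * (t - s))"
      using nn_integral_partial_kernel_diff_le[of 1 s t T, where 'a = 'a] that k
      by (simp add: PiM_empty nn_integral_count_space_finite)
    then show ?thesis using that T by (simp add: ennreal_le_iff increment_const_nonneg)
  qed
  have "hoelder_on 1 {0..T} (\<lambda>t. ?b t * G1 \<omega>)"
    unfolding hoelder_on_def
  proof (intro exI[of _ "?C * \<bar>G1 \<omega>\<bar>"] ballI)
    fix s t assume st: "s \<in> {0..T}" "t \<in> {0..T}"
    have "\<bar>?b s - ?b t\<bar> \<le> ?C * \<bar>s - t\<bar>"
      using le[of s t] le[of t s] st by (cases "s \<le> t") (auto simp: abs_minus_commute)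
    then have "\<bar>?b s - ?b t\<bar> * \<bar>G1 \<omega>\<bar> \<le> ?C * \<bar>s - t\<bar> * \<bar>G1 \<omega>\<bar>" by (intro mult_right_mono) auto
    then show "\<bar>?b s * G1 \<omega> - ?b t * G1 \<omega>\<bar> \<le> ?C * \<bar>G1 \<omega>\<bar> * \<bar>s - t\<bar> powr 1"
      by (simp add: mult_ac flip: abs_mult left_diff_distrib right_diff_distrib)
  qed
  then show ?thesis unfolding limit_process_1 using hoelder_on_mono \<gamma> T by blast
qed

end

theorem proposition4p2:
  fixes M :: "'w measure"
    and \<Gamma> :: "'v pair_pre_digraph"
    and k :: nat and \<alpha> :: real
    and G1 :: "'w \<Rightarrow> real"
    and G :: "nat \<Rightarrow> (nat \<Rightarrow> 'a::euclidean_space) set \<Rightarrow> 'w \<Rightarrow> real"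
  assumes "k \<ge> 2" and "\<alpha> > real DIM('a)"
    and "pair_graph \<Gamma>" and "Digraph_Component.connected (with_proj \<Gamma>)" and "card (pverts \<Gamma>) = k"
    and "prob_space M"
    and "G1 \<in> borel_measurable M"
    and "distr M borel G1 = centered_normal (noise_const TYPE('a) \<alpha> k 1)"
    and "\<And>l. l \<in> {2..k} \<Longrightarrow> gaussian_noise M (noise_intensity \<alpha> k l) (G l)"
    and "prob_space.indep_sets M
           (\<lambda>l. generated_events M
                  (if l = 1 then {G1} else G l ` fmeasurable (noise_intensity \<alpha> k l))) {1..k}"
  shows "(\<forall>l\<in>{1..k}.
            self_similar M (\<lambda>t. limit_process M \<Gamma> k \<alpha> G1 G l t)
              (real DIM('a) * (2 * real k - real l - 1) / 2))
       \<and> (\<forall>l\<in>{1..k}. \<forall>T>0. \<exists>Y.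
            modification_on M {0..T} (\<lambda>t. limit_process M \<Gamma> k \<alpha> G1 G l t) Y \<and>
            (\<forall>\<omega>\<in>space M. \<forall>\<gamma>\<in>{0..<1/2}. hoelder_on \<gamma> {0..T} (\<lambda>t. Y t \<omega>)))"
proof -
  interpret connected_pattern \<Gamma> k
    by (rule connected_pattern.intro[OF assms(3,4,5)])
  note [measurable] = assms(7)
  have k1: "1 \<le> k" using assms(1) by simp
  have cases: "l = 1 \<or> l \<in> {2..k}" if "l \<in> {1..k}" for l using that by auto
  show ?thesis
  proof (intro conjI ballI allI impI)
    fix l assume "l \<in> {1..k}"
    from cases[OF this]
    show "self_similar M (\<lambda>t. limit_process M \<Gamma> k \<alpha> G1 G l t) (real DIM('a) * (2 * real k - real l - 1) / 2)"
    proof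
      assume "l = 1"
      then show ?thesis using self_similar_limit_process_1[OF assms(7) k1, of \<alpha> G] by (simp only:)
    next
      assume l: "l \<in> {2..k}"
      show ?thesis
        by (rule self_similar_limit_process[where G = G and l = l, OF assms(6) assms(9)[OF l] l])
    qed
  next
    fix l and T :: real assume "l \<in> {1..k}" and T: "0 < T"
    from cases[OF this(1)]
    show "\<exists>Y. modification_on M {0..T} (\<lambda>t. limit_process M \<Gamma> k \<alpha> G1 G l t) Y \<and>
        (\<forall>\<omega>\<in>space M. \<forall>\<gamma>\<in>{0..<1/2}. hoelder_on \<gamma> {0..T} (\<lambda>t. Y t \<omega>))"
    proof
      assume l: "l \<in> {2..k}"
      show ?thesis
        by (rule hoelder_modification_limit_process[where G = G and l = l, OF assms(6) assms(9)[OF l] l T])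
    next
      assume l: "l = 1"
      have "modification_on M {0..T} (\<lambda>t. limit_process M \<Gamma> k \<alpha> G1 G l t) (\<lambda>t. limit_process M \<Gamma> k \<alpha> G1 G l t)"
        unfolding modification_on_def l limit_process_1 by simp
      moreover have "hoelder_on \<gamma> {0..T} (\<lambda>t. limit_process M \<Gamma> k \<alpha> G1 G l t \<omega>)" if "\<gamma> \<in> {0..<1/2}" for \<omega> \<gamma>
        unfolding l using that by (intro hoelder_limit_process_1 k1 T) simp
      ultimately show ?thesis by blast
    qed
  qed
qed

end
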